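(* Let $n\ge1$ be an integer, let $0<s<\min\{1,\frac n2\}$, and let $\Gamma$, $\gamma$, $\gamma_\lambda$ be as in the context. Let $u\in\mathcal S_s'$ be a distribution such that $(-\Delta)^su\ge0$ in an open set $\Omega\subseteq\mathbb R^n$. Then $u$ coincides in $\Omega$ (as a distribution) with a lower semicontinuous function such that, for any $x_0\in\Omega$, $$u(x_0)\ge\langle u,\gamma_\lambda(x_0-\cdot)\rangle\qquad\text{for all }0<\lambda<\mathrm{dist}(x_0,\partial\Omega).$$
   Context: $\mathcal S_s$ is the space of $\varphi\in C^\infty(\mathbb R^n)$ with $\|(1+|x|^{n+2s})D^k\varphi\|_{L^\infty}<\infty$ for all $k\ge0$, with the topology of these seminorms; $\mathcal S_s'$ is its dual. The fractional Laplacian is $(-\Delta)^s\varphi(x)=C_{n,s}\,\mathrm{P.V.}\int_{\mathbb R^n}\frac{\varphi(x)-\varphi(y)}{|x-y|^{n+2s}}\,dy$, with $C_{n,s}>0$ chosen so that its Fourier symbol is $|\xi|^{2s}$, extended to $u\in\mathcal S_s'$ by $\langle(-\Delta)^su,\varphi\rangle=\langle u,(-\Delta)^s\varphi\rangle$ for Schwartz $\varphi$. Let $\Phi(x):=C_{n,-s}|x|^{-(n-2s)}$ be the fundamental solution of $(-\Delta)^s$ in $\mathbb R^n$, $C_{n,-s}>0$ being the constant for which $(-\Delta)^s(\Phi\ast\varphi)=\varphi$ for Schwartz $\varphi$. Fix a radial decreasing function $\Gamma\in C^\infty(\mathbb R^n)$ with the following properties (such a function exists): $\Gamma>0$ on $\mathbb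 R^n$; its radial derivative satisfies $\Gamma'<0$ on $\mathbb R^n\setminus\{0\}$; $\Gamma=\Phi$ on $\mathbb R^n\setminus B_1$; $(-\Delta)^s\Gamma$ is a strictly positive smooth function with $\int_{\mathbb R^n}(-\Delta)^s\Gamma=1$; and $\Gamma_{\lambda_1}\ge\Gamma_{\lambda_2}$ for all $0<\lambda_1<\lambda_2$, where $\Gamma_\lambda(x):=\lambda^{-(n-2s)}\Gamma(x/\lambda)$. Set $\gamma:=(-\Delta)^s\Gamma$ and $\gamma_\lambda(x):=\lambda^{-n}\gamma(x/\lambda)$ for $\lambda>0$; one has $\gamma,\gamma_\lambda\in\mathcal S_s$. $B_1$ is the open unit ball. Lower semicontinuous functions may take the value $+\infty$. *)

theory Defs
  imports "HOL-Analysis.Analysis"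
begin

text \<open>
  The space \<open>\<real>\<^sup>n\<close> is an arbitrary type \<open>'a\<close> of class \<open>euclidean_space\<close>, with \<open>n = DIM('a) \<ge> 1\<close>.
  All functions and distributions are real-valued.
\<close>

subsection \<open>Smooth functions and function spaces\<close>

text \<open>\<open>partials [b\<^sub>1, \<dots>, b\<^sub>k] f\<close> is the iterated directional derivative
  \<open>\<partial>\<^bsub>b\<^sub>1\<^esub> \<dots> \<partial>\<^bsub>b\<^sub>k\<^esub> f\<close>.\<close>

fun partials :: "'a::euclidean_space list \<Rightarrow> ('a \<Rightarrow> real) \<Rightarrow> 'a \<Rightarrow> real" where
  "partials [] f = f"
| "partials (b # bs) f = (\<lambda>x. frechet_derivative (partials bs f) (at x) b)"

text \<open>Being \<open>C\<^sup>\<infinity>\<close>: all iterated partial derivatives exist and are differentiable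
  (hence also continuous) on the whole space.\<close>

definition smooth :: "('a::euclidean_space \<Rightarrow> real) \<Rightarrow> bool" where
  "smooth f \<longleftrightarrow> (\<forall>bs. set bs \<subseteq> Basis \<longrightarrow> (\<forall>x. partials bs f differentiable (at x)))"

text \<open>The Euclidean norm of the tensor \<open>D\<^sup>k f(x)\<close> of all partial derivatives of order \<open>k\<close>.\<close>

definition norm_D :: "nat \<Rightarrow> ('a::euclidean_space \<Rightarrow> real) \<Rightarrow> 'a \<Rightarrow> real" where
  "norm_D k f x = L2_set (\<lambda>bs. partials bs f x) {bs. set bs \<subseteq> Basis \<and> length bs = k}"

definition Schwartz :: "('a::euclidean_space \<Rightarrow> real) set" where
  "Schwartz = {\<phi>. smooth \<phi> \<and> (\<forall>m k. bdd_above (range (\<lambda>x. norm x ^ m * norm_D k \<phi> x)))}"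

definition test_functions :: "'a::euclidean_space set \<Rightarrow> ('a \<Rightarrow> real) set" where
  "test_functions \<Omega> = {\<phi>. smooth \<phi> \<and> compact (closure {x. \<phi> x \<noteq> 0}) \<and> closure {x. \<phi> x \<noteq> 0} \<subseteq> \<Omega>}"

definition Ss_weighted :: "real \<Rightarrow> nat \<Rightarrow> ('a::euclidean_space \<Rightarrow> real) \<Rightarrow> 'a \<Rightarrow> real" where
  "Ss_weighted s k \<phi> x = (1 + norm x powr (real DIM('a) + 2 * s)) * norm_D k \<phi> x"

definition Ss :: "real \<Rightarrow> ('a::euclidean_space \<Rightarrow> real) set" where
  "Ss s = {\<phi>. smooth \<phi> \<and> (\<forall>k. bdd_above (range (Ss_weighted s k \<phi>)))}"

text \<open>For continuous functions the \<open>L\<^sup>\<infinity>\<close> norm is the supremum.\<close>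

definition Ss_seminorm :: "real \<Rightarrow> nat \<Rightarrow> ('a::euclidean_space \<Rightarrow> real) \<Rightarrow> real" where
  "Ss_seminorm s k \<phi> = (SUP x. Ss_weighted s k \<phi> x)"

definition Ss_topology :: "real \<Rightarrow> ('a::euclidean_space \<Rightarrow> real) topology" where
  "Ss_topology s = topology_generated_by
     {{\<psi> \<in> Ss s. Ss_seminorm s k (\<lambda>x. \<psi> x - \<phi> x) < r} | \<phi> k r. \<phi> \<in> Ss s \<and> r > 0}"

text \<open>The dual space; only the values of \<open>u\<close> on \<open>Ss s\<close> are meaningful.\<close>

definition Ss_dual :: "real \<Rightarrow> (('a::euclidean_space \<Rightarrow> real) \<Rightarrow> real) set" where
  "Ss_dual s = {u.
     (\<forall>\<phi>\<in>Ss s. \<forall>\<psi>\<in>Ss s. \<forall>a b. u (\<lambda>x. a * \<phi> x + b * \<psi> x) = a * u \<phi> + b * u \<psi>) \<and>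
     continuous_map (Ss_topology s) euclideanreal u}"


subsection \<open>The fractional Laplacian\<close>

text \<open>\<open>frac_lap C s\<close> is the singular integral operator with normalising constant \<open>C\<close>.\<close>

definition frac_lap :: "real \<Rightarrow> real \<Rightarrow> ('a::euclidean_space \<Rightarrow> real) \<Rightarrow> 'a \<Rightarrow> real" where
  "frac_lap C s \<phi> x =
     C * Lim (at_right 0) (\<lambda>\<epsilon>. LINT y : - ball x \<epsilon> | lborel.
           (\<phi> x - \<phi> y) / norm (x - y) powr (real DIM('a) + 2 * s))"

definition fourier :: "('a::euclidean_space \<Rightarrow> real) \<Rightarrow> 'a \<Rightarrow> complex" where
  "fourier \<phi> \<xi> = (LINT x | lborel. cis (- (\<xi> \<bullet> x)) * complex_of_real (\<phi> x))"

definition has_fourier_symbol ::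
    "(('a::euclidean_space \<Rightarrow> real) \<Rightarrow> 'a \<Rightarrow> real) \<Rightarrow> ('a \<Rightarrow> real) \<Rightarrow> bool" where
  "has_fourier_symbol L m \<longleftrightarrow>
     (\<forall>\<phi>\<in>Schwartz. \<forall>\<xi>. fourier (L \<phi>) \<xi> = complex_of_real (m \<xi>) * fourier \<phi> \<xi>)"

text \<open>\<open>C\<close> is the constant \<open>C\<^bsub>n,s\<^esub>\<close>, for \<open>n = DIM('a)\<close>.\<close>

definition is_frac_lap_constant :: "'a::euclidean_space itself \<Rightarrow> real \<Rightarrow> real \<Rightarrow> bool" where
  "is_frac_lap_constant (_ :: 'a itself) s C \<longleftrightarrow>
     C > 0 \<and> has_fourier_symbol (frac_lap C s) (\<lambda>\<xi>::'a. norm \<xi> powr (2 * s))"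

definition frac_lap_distr ::
    "real \<Rightarrow> real \<Rightarrow> (('a::euclidean_space \<Rightarrow> real) \<Rightarrow> real) \<Rightarrow> ('a \<Rightarrow> real) \<Rightarrow> real" where
  "frac_lap_distr C s u \<phi> = u (frac_lap C s \<phi>)"

definition distr_nonneg_on :: "'a::euclidean_space set \<Rightarrow> (('a \<Rightarrow> real) \<Rightarrow> real) \<Rightarrow> bool" where
  "distr_nonneg_on \<Omega> T \<longleftrightarrow> (\<forall>\<phi>\<in>test_functions \<Omega>. (\<forall>x. \<phi> x \<ge> 0) \<longrightarrow> T \<phi> \<ge> 0)"


subsection \<open>The fundamental solution and its regularisation\<close>

definition Phi :: "real \<Rightarrow> real \<Rightarrow> 'a::euclidean_space \<Rightarrow> real" where
  "Phi K s x = K * norm x powr - (real DIM('a) - 2 * s)"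

definition conv :: "('a::euclidean_space \<Rightarrow> real) \<Rightarrow> ('a \<Rightarrow> real) \<Rightarrow> 'a \<Rightarrow> real" where
  "conv f g x = (LINT y | lborel. f (x - y) * g y)"

text \<open>\<open>K\<close> is the constant \<open>C\<^bsub>n,-s\<^esub>\<close>, given \<open>C = C\<^bsub>n,s\<^esub>\<close>.\<close>

definition is_Phi_constant :: "'a::euclidean_space itself \<Rightarrow> real \<Rightarrow> real \<Rightarrow> real \<Rightarrow> bool" where
  "is_Phi_constant (_ :: 'a itself) s C K \<longleftrightarrow>
     K > 0 \<and> (\<forall>\<phi>\<in>Schwartz. \<forall>x::'a. frac_lap C s (conv (Phi K s) \<phi>) x = \<phi> x)"

definition radial_decreasing :: "('a::euclidean_space \<Rightarrow> real) \<Rightarrow> bool" where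
  "radial_decreasing f \<longleftrightarrow> (\<exists>g. (\<forall>x. f x = g (norm x)) \<and> antimono_on {0..} g)"

definition radial_deriv :: "('a::euclidean_space \<Rightarrow> real) \<Rightarrow> 'a \<Rightarrow> real" where
  "radial_deriv f x = frechet_derivative f (at x) (x /\<^sub>R norm x)"

definition Gamma_scaled :: "real \<Rightarrow> ('a::euclidean_space \<Rightarrow> real) \<Rightarrow> real \<Rightarrow> 'a \<Rightarrow> real" where
  "Gamma_scaled s G l x = l powr - (real DIM('a) - 2 * s) * G (x /\<^sub>R l)"

definition gamma_scaled ::
    "real \<Rightarrow> real \<Rightarrow> ('a::euclidean_space \<Rightarrow> real) \<Rightarrow> real \<Rightarrow> 'a \<Rightarrow> real" where
  "gamma_scaled C s G l x = l powr - real DIM('a) * frac_lap C s G (x /\<^sub>R l)"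

definition regularised_Phi ::
    "real \<Rightarrow> real \<Rightarrow> real \<Rightarrow> ('a::euclidean_space \<Rightarrow> real) \<Rightarrow> bool" where
  "regularised_Phi C K s G \<longleftrightarrow>
     smooth G \<and> radial_decreasing G \<and> (\<forall>x. G x > 0) \<and>
     (\<forall>x. x \<noteq> 0 \<longrightarrow> radial_deriv G x < 0) \<and>
     (\<forall>x. x \<notin> ball 0 1 \<longrightarrow> G x = Phi K s x) \<and>
     smooth (frac_lap C s G) \<and> (\<forall>x. frac_lap C s G x > 0) \<and>
     has_bochner_integral lborel (frac_lap C s G) 1 \<and>
     (\<forall>l1 l2 x. 0 < l1 \<and> l1 < l2 \<longrightarrow> Gamma_scaled s G l1 x \<ge> Gamma_scaled s G l2 x)"


subsection \<open>Lower semicontinuous representatives\<close>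

definition lower_semicontinuous_on :: "'a::topological_space set \<Rightarrow> ('a \<Rightarrow> ereal) \<Rightarrow> bool" where
  "lower_semicontinuous_on \<Omega> f \<longleftrightarrow>
     (\<forall>x\<in>\<Omega>. f x \<noteq> -\<infinity>) \<and> (\<forall>a. openin (top_of_set \<Omega>) {x \<in> \<Omega>. f x > a})"

text \<open>The distribution \<open>u\<close> coincides in \<open>\<Omega>\<close> with the locally integrable function \<open>f\<close>. Finiteness
  almost everywhere has to be demanded separately, since \<open>real_of_ereal\<close> sends infinite values
  to \<open>0\<close>.\<close>

definition coincides_on ::
    "'a::euclidean_space set \<Rightarrow> (('a \<Rightarrow> real) \<Rightarrow> real) \<Rightarrow> ('a \<Rightarrow> ereal) \<Rightarrow> bool" where
  "coincides_on \<Omega> u f \<longleftrightarrow>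
     (AE x in lborel. x \<in> \<Omega> \<longrightarrow> \<bar>f x\<bar> \<noteq> \<infinity>) \<and>
     (\<forall>A. compact A \<and> A \<subseteq> \<Omega> \<longrightarrow> set_integrable lborel A (\<lambda>x. real_of_ereal (f x))) \<and>
     (\<forall>\<phi>\<in>test_functions \<Omega>. u \<phi> = (LINT x : \<Omega> | lborel. real_of_ereal (f x) * \<phi> x))"

text \<open>The distance to a set with the convention \<open>dist(x, \<emptyset>) = \<infinity>\<close>, needed for \<open>\<partial>\<Omega> = \<emptyset>\<close>;
  the library's \<open>infdist\<close> returns \<open>0\<close> there.\<close>

definition edist_to :: "'a::metric_space \<Rightarrow> 'a set \<Rightarrow> ereal" where
  "edist_to x A = (INF y\<in>A. ereal (dist x y))"

end

theory Submission
  imports Defs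
begin

text \<open>
  For \<open>l1 < l2 < dist(x, \<partial>\<Omega>)\<close> the function \<open>(\<Gamma>\<^bsub>l1\<^esub> - \<Gamma>\<^bsub>l2\<^esub>)(x - \<cdot>)\<close> is a nonnegative
  test function on \<open>\<Omega>\<close> whose fractional Laplacian is \<open>(\<gamma>\<^bsub>l1\<^esub> - \<gamma>\<^bsub>l2\<^esub>)(x - \<cdot>)\<close>. Hence
  \<open>\<langle>u, \<gamma>\<^sub>l(x - \<cdot>)\<rangle>\<close>, which is continuous in \<open>x\<close>, increases as \<open>l\<close> decreases to 0; its supremum
  over \<open>l\<close> is the representative, and monotone convergence together with
  \<open>\<gamma>\<^sub>l * \<phi> \<rightarrow> \<phi>\<close> in \<open>\<S>\<^sub>s\<close> identifies it with \<open>u\<close>.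

  That \<open>\<gamma> \<in> \<S>\<^sub>s\<close> comes from integrability of \<open>\<gamma>\<close> and scaling alone: \<open>\<gamma>\<close> differs from
  a convolution of \<open>\<Phi> - \<Gamma>\<close> with a kernel equal to a multiple of \<open>|z|\<^bsup>-n-2s\<^esup>\<close> far out by a
  function that is homogeneous of degree \<open>-n\<close> under dilation by 2, which is not integrable at
  infinity unless it vanishes there.
\<close>

subsection \<open>Iterated partial derivatives\<close>

text \<open>A direct route to the decay of \<open>\<gamma>\<close> would show that the fractional
  Laplacian of \<open>Phi\<close> vanishes off the origin, but \<open>Phi\<close> is neither smooth
  nor bounded there. The dyadic difference of \<open>Gamma_scaled\<close> at \<open>1/2\<close> and
  \<open>1\<close> avoids this: the copies of \<open>Phi\<close> cancel, the support is compact, and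
  outside the support the operator is an absolutely convergent integral. Two further obstacles shape
  the proof. Since \<open>\<gamma>\<close> is positive everywhere, mollifying destroys compact
  support, and convergence to a test function has to be shown in the weighted norms; the decay of
  order \<open>n + 2 * s\<close> is just enough, with a far-field error of order
  \<open>l powr (2 * s)\<close>. And \<open>u\<close> is known only as a functional bounded by
  finitely many seminorms, so it is moved inside an integral by means of finite sums and error
  estimates. The supremum over the radii might a priori be infinite everywhere. Its local
  integrability is extracted from the convergence of integrals against nonnegative bump functions,
  for which differences of scaled \<open>\<Gamma>\<close> serve once more.\<close>

lemma partials_append: "partials (as @ bs) f = partials as (partials bs f)"
  by (induction as) auto

lemma smooth_differentiable: "smooth f \<Longrightarrow> set bs \<subseteq> Basis \<Longrightarrow> partials bs f differentiable (at x)"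
  by (auto simp: smooth_def)

lemma smooth_partials: "smooth f \<Longrightarrow> set bs \<subseteq> Basis \<Longrightarrow> smooth (partials bs f)"
  unfolding smooth_def by (metis partials_append set_append Un_least)

lemma smooth_continuous_on:
  assumes "smooth f"
  shows "continuous_on A f"
proof -
  have "f differentiable (at x)" for x
    using smooth_differentiable[OF assms, of "[]"] by simp
  then show ?thesis
    by (metis differentiable_imp_continuous_within continuous_at_imp_continuous_on)
qed

lemma smooth_borel [measurable (raw)]: "smooth f \<Longrightarrow> f \<in> borel_measurable borel"
  by (intro borel_measurable_continuous_onI smooth_continuous_on)

lemma smooth_has_derivative:
  assumes "smooth f"
  shows "(f has_derivative (\<lambda>h. \<Sum>b\<in>Basis. (h \<bullet> b) * partials [b] f x)) (at x)"
proof -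
  have d: "(f has_derivative frechet_derivative f (at x)) (at x)"
    using smooth_differentiable[OF assms, of "[]" x] by (simp add: frechet_derivative_works)
  interpret L: linear "frechet_derivative f (at x)"
    using d by (rule has_derivative_linear)
  have "frechet_derivative f (at x) h = (\<Sum>b\<in>Basis. (h \<bullet> b) * partials [b] f x)" for h
  proof -
    have "frechet_derivative f (at x) h = frechet_derivative f (at x) (\<Sum>b\<in>Basis. (h \<bullet> b) *\<^sub>R b)"
      by (simp add: euclidean_representation)
    also have "\<dots> = (\<Sum>b\<in>Basis. (h \<bullet> b) * partials [b] f x)"
      by (simp add: L.sum L.scaleR)
    finally show ?thesis .
  qed
  then have "frechet_derivative f (at x) = (\<lambda>h. \<Sum>b\<in>Basis. (h \<bullet> b) * partials [b] f x)"
    by blast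
  with d show ?thesis by (simp only:)
qed

lemma partial_eqI:
  assumes "(f has_derivative f') (at x)"
  shows "partials [b] f x = f' b"
  using frechet_derivative_at[OF assms] by simp

text \<open>Smoothness is reduced to an invariant \<open>P\<close> that survives one
  differentiation. This suits classes such as spans of products, whose higher derivatives have no
  convenient closed form.\<close>

lemma smooth_coinduct:
  assumes "P f"
    and "\<And>f x. P f \<Longrightarrow> f differentiable (at x)"
    and "\<And>f b. P f \<Longrightarrow> b \<in> Basis \<Longrightarrow> P (partials [b] f)"
  shows "smooth f"
proof -
  have "P (partials bs f)" if "set bs \<subseteq> Basis" for bs
    using that
  proof (induction bs)
    case (Cons b bs)
    then show ?case using assms(3)[of "partials bs f" b] by auto
  qed (simp add: assms(1))
  then show ?thesis unfolding smooth_def using assms(2) by blast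
qed

lemma partials_lincomb:
  assumes "smooth f" "smooth g" "set bs \<subseteq> Basis"
  shows "partials bs (\<lambda>x. a * f x + c * g x) = (\<lambda>x. a * partials bs f x + c * partials bs g x)"
  using assms(3)
proof (induction bs)
  case (Cons b bs)
  have "frechet_derivative (\<lambda>x. a * partials bs f x + c * partials bs g x) (at x) b
      = a * partials (b # bs) f x + c * partials (b # bs) g x" for x
  proof -
    have "(partials bs f has_derivative frechet_derivative (partials bs f) (at x)) (at x)"
      "(partials bs g has_derivative frechet_derivative (partials bs g) (at x)) (at x)"
      using smooth_differentiable[OF assms(1)] smooth_differentiable[OF assms(2)] Cons.prems
      by (auto simp: frechet_derivative_works)
    then have "((\<lambda>x. a * partials bs f x + c * partials bs g x) has_derivative
      (\<lambda>h. a * frechet_derivative (partials bs f) (at x) h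
         + c * frechet_derivative (partials bs g) (at x) h)) (at x)"
      by (auto intro!: derivative_eq_intros)
    from frechet_derivative_at[OF this] show ?thesis by (simp add: fun_eq_iff)
  qed
  with Cons show ?case by auto
qed simp

lemma smooth_lincomb:
  assumes "smooth f" "smooth g"
  shows "smooth (\<lambda>x. a * f x + c * g x)"
  unfolding smooth_def
proof (intro allI impI)
  fix bs :: "'a list" and x assume b: "set bs \<subseteq> Basis"
  show "partials bs (\<lambda>x. a * f x + c * g x) differentiable (at x)"
    unfolding partials_lincomb[OF assms b]
    using smooth_differentiable[OF assms(1) b, of x] smooth_differentiable[OF assms(2) b, of x]
    by auto
qed

lemma partials_cong_open:
  assumes "open S" "\<And>x. x \<in> S \<Longrightarrow> f x = g x" "x \<in> S"
  shows "partials bs f x = partials bs g x"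
  using assms(3)
proof (induction bs arbitrary: x)
  case (Cons b bs)
  have "(partials bs f has_derivative D) (at x) \<longleftrightarrow> (partials bs g has_derivative D) (at x)" for D
    using has_derivative_transform_within_open[OF _ assms(1) Cons.prems, of "partials bs f" D UNIV "partials bs g"]
      has_derivative_transform_within_open[OF _ assms(1) Cons.prems, of "partials bs g" D UNIV "partials bs f"]
      Cons.IH by auto
  then show ?case by (simp add: frechet_derivative_def)
qed (simp add: assms(2))

lemma partials_zero_set:
  assumes "open S" "\<And>x. x \<in> S \<Longrightarrow> f x = 0" "x \<in> S"
  shows "partials bs f x = 0"
proof -
  have "partials bs (\<lambda>_. 0) = (\<lambda>_. 0 :: real)" for bs :: "'a list"
    by (induction bs) auto
  then show ?thesis using partials_cong_open[OF assms(1), of f "\<lambda>_. 0" x bs] assms by simp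
qed

lemma partials_affine:
  assumes "smooth f" "set bs \<subseteq> Basis"
  shows "partials bs (\<lambda>y. f (x0 + c *\<^sub>R y)) = (\<lambda>y. c ^ length bs * partials bs f (x0 + c *\<^sub>R y))"
  using assms(2)
proof (induction bs)
  case (Cons b bs)
  have "frechet_derivative (\<lambda>y. c ^ length bs * partials bs f (x0 + c *\<^sub>R y)) (at y) b
      = c ^ length (b # bs) * partials (b # bs) f (x0 + c *\<^sub>R y)" for y
  proof -
    let ?D = "frechet_derivative (partials bs f) (at (x0 + c *\<^sub>R y))"
    have d: "(partials bs f has_derivative ?D) (at (x0 + c *\<^sub>R y))"
      using smooth_differentiable[OF assms(1)] Cons.prems by (auto simp: frechet_derivative_works)
    have a: "((\<lambda>y. x0 + c *\<^sub>R y) has_derivative (\<lambda>h. c *\<^sub>R h)) (at y)"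
      by (auto intro!: derivative_eq_intros)
    have "((\<lambda>y. c ^ length bs * partials bs f (x0 + c *\<^sub>R y)) has_derivative
        (\<lambda>h. c ^ length bs * ?D (c *\<^sub>R h))) (at y)"
      using has_derivative_mult_right[OF has_derivative_compose[OF a d]] by simp
    then have "frechet_derivative (\<lambda>y. c ^ length bs * partials bs f (x0 + c *\<^sub>R y)) (at y) b
      = c ^ length bs * ?D (c *\<^sub>R b)"
      using frechet_derivative_at by metis
    also have "?D (c *\<^sub>R b) = c * ?D b"
      using has_derivative_linear[OF d] by (simp add: linear_cmul)
    finally show ?thesis by simp
  qed
  with Cons show ?case by auto
qed simp

lemma smooth_affine:
  assumes "smooth f"
  shows "smooth (\<lambda>y. f (x0 + c *\<^sub>R y))"
  unfolding smooth_def
proof (intro allI impI)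
  fix bs :: "'a list" and y assume b: "set bs \<subseteq> Basis"
  have "(\<lambda>y. partials bs f (x0 + c *\<^sub>R y)) differentiable (at y)"
    using differentiable_compose[OF smooth_differentiable[OF assms b], of "\<lambda>y. x0 + c *\<^sub>R y" y UNIV]
    by (auto intro!: derivative_intros)
  then show "partials bs (\<lambda>y. f (x0 + c *\<^sub>R y)) differentiable (at y)"
    unfolding partials_affine[OF assms b] by simp
qed

lemma smooth_const: "smooth (\<lambda>_. c)"
  by (rule smooth_coinduct[where P = "\<lambda>f. \<exists>c. f = (\<lambda>_. c)"]) auto

text \<open>The span of the products \<open>f \<cdot> g\<close> is closed under partial derivatives.\<close>

inductive product_span :: "('a::euclidean_space \<Rightarrow> real) \<Rightarrow> bool" where
  "smooth f \<Longrightarrow> smooth g \<Longrightarrow> product_span (\<lambda>x. f x * g x)"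
| "product_span f \<Longrightarrow> product_span g \<Longrightarrow> product_span (\<lambda>x. f x + g x)"

lemma smooth_mult:
  assumes "smooth f" "smooth g"
  shows "smooth (\<lambda>x. f x * g x)"
proof (rule smooth_coinduct[where P = product_span])
  show "product_span (\<lambda>x. f x * g x)" using assms by (rule product_span.intros)
  show d: "f differentiable (at x)" if "product_span f" for f :: "'a \<Rightarrow> real" and x
    using that
  proof induction
    case (1 f g)
    then show ?case using smooth_differentiable[of f "[]" x] smooth_differentiable[of g "[]" x] by auto
  qed auto
  show "product_span (partials [b] f)" if "product_span f" "b \<in> Basis" for f :: "'a \<Rightarrow> real" and b
    using that
  proof induction
    case (1 f g)
    have "partials [b] (\<lambda>x. f x * g x) = (\<lambda>x. f x * partials [b] g x + partials [b] f x * g x)"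
    proof
      fix x
      have "((\<lambda>x. f x * g x) has_derivative
          (\<lambda>h. f x * frechet_derivative g (at x) h + frechet_derivative f (at x) h * g x)) (at x)"
        using smooth_differentiable[OF 1(1), of "[]" x] smooth_differentiable[OF 1(2), of "[]" x]
        by (intro has_derivative_mult) (auto simp: frechet_derivative_works)
      then show "partials [b] (\<lambda>x. f x * g x) x = f x * partials [b] g x + partials [b] f x * g x"
        by (subst partial_eqI) auto
    qed
    moreover have "smooth (partials [b] f)" "smooth (partials [b] g)"
      using 1 by (auto intro!: smooth_partials simp del: partials.simps)
    ultimately show ?case using 1 by (auto intro: product_span.intros simp del: partials.simps)
  next
    case (2 f g)
    have "partials [b] (\<lambda>x. f x + g x) = (\<lambda>x. partials [b] f x + partials [b] g x)"
    proof
      fix x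
      have "((\<lambda>x. f x + g x) has_derivative
          (\<lambda>h. frechet_derivative f (at x) h + frechet_derivative g (at x) h)) (at x)"
        using d[OF 2(1), of x] d[OF 2(2), of x]
        by (intro has_derivative_add) (auto simp: frechet_derivative_works)
      then show "partials [b] (\<lambda>x. f x + g x) x = partials [b] f x + partials [b] g x"
        by (subst partial_eqI) auto
    qed
    with 2 show ?case by (simp add: product_span.intros del: partials.simps)
  qed
qed

text \<open>Differentiating \<open>f x * g x powr q\<close> lowers the exponent by one and puts the
  derivative of \<open>g\<close> into the coefficient, so the exponent varies inside the span while
  the base \<open>g\<close> stays fixed.\<close>

inductive powr_span :: "('a::euclidean_space \<Rightarrow> real) \<Rightarrow> ('a \<Rightarrow> real) \<Rightarrow> bool" for g where
  "smooth f \<Longrightarrow> powr_span g (\<lambda>x. f x * g x powr q)"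
| "powr_span g f1 \<Longrightarrow> powr_span g f2 \<Longrightarrow> powr_span g (\<lambda>x. f1 x + f2 x)"

lemma smooth_powr:
  assumes "smooth g" "\<And>x. g x > 0"
  shows "smooth (\<lambda>x. g x powr q)"
proof (rule smooth_coinduct[where P = "powr_span g"])
  show "powr_span g (\<lambda>x. g x powr q)"
    using powr_span.intros(1)[OF smooth_const[of 1], of g q] by simp
  have g': "(g has_derivative frechet_derivative g (at x)) (at x)" for x
    using smooth_differentiable[OF assms(1), of "[]" x] by (simp add: frechet_derivative_works)
  have fg: "((\<lambda>x. f x * g x powr q) has_derivative
      (\<lambda>h. frechet_derivative f (at x) h * g x powr q + q * f x * frechet_derivative g (at x) h * g x powr (q - 1))) (at x)"
    if "smooth f" for f q x
  proof -
    have f': "(f has_derivative frechet_derivative f (at x)) (at x)"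
      using smooth_differentiable[OF that, of "[]" x] by (simp add: frechet_derivative_works)
    show ?thesis
      using assms(2)[of x]
      by (auto intro!: derivative_eq_intros f' g' simp: powr_diff field_simps)
  qed
  show d: "f differentiable (at x)" if "powr_span g f" for f x
    using that
  proof induction
    case (1 f q)
    then show ?case using fg unfolding differentiable_def by blast
  qed auto
  show "powr_span g (partials [b] f)" if "powr_span g f" "b \<in> Basis" for f b
    using that
  proof induction
    case (1 f q)
    have "partials [b] (\<lambda>x. f x * g x powr q) = (\<lambda>x. partials [b] f x * g x powr q
        + ((q * f x) * partials [b] g x) * g x powr (q - 1))"
      using partial_eqI[OF fg[OF 1(1)]] by auto
    moreover have "smooth (partials [b] f)" "smooth (partials [b] g)"
      using 1 assms by (auto intro!: smooth_partials simp del: partials.simps)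
    moreover have "smooth (\<lambda>x. q * f x)"
      using smooth_mult[OF smooth_const 1(1)] .
    ultimately show ?case by (auto intro!: powr_span.intros smooth_mult simp del: partials.simps)
  next
    case (2 f1 f2)
    have "partials [b] (\<lambda>x. f1 x + f2 x) = (\<lambda>x. partials [b] f1 x + partials [b] f2 x)"
    proof
      fix x
      have "((\<lambda>x. f1 x + f2 x) has_derivative
          (\<lambda>h. frechet_derivative f1 (at x) h + frechet_derivative f2 (at x) h)) (at x)"
        using d[OF 2(1), of x] d[OF 2(2), of x]
        by (intro has_derivative_add) (auto simp: frechet_derivative_works)
      then show "partials [b] (\<lambda>x. f1 x + f2 x) x = partials [b] f1 x + partials [b] f2 x"
        by (subst partial_eqI) auto
    qed
    with 2 show ?case by (simp add: powr_span.intros del: partials.simps)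
  qed
qed

section \<open>Lipschitz and Taylor bounds from bounds on partial derivatives\<close>

lemma onorm_partials_le:
  "onorm (\<lambda>h. \<Sum>b\<in>Basis. (h \<bullet> b) * c b) \<le> (\<Sum>b\<in>Basis. \<bar>c b\<bar>)" for c :: "'a::euclidean_space \<Rightarrow> real"
proof (rule onorm_le)
  fix h :: 'a
  have "norm (\<Sum>b\<in>Basis. (h \<bullet> b) * c b) \<le> (\<Sum>b\<in>Basis. norm ((h \<bullet> b) * c b))"
    by (rule norm_sum)
  also have "\<dots> \<le> (\<Sum>b\<in>Basis. \<bar>c b\<bar> * norm h)"
    by (intro sum_mono) (simp add: abs_mult mult.commute[of "\<bar>_ \<bullet> _\<bar>"] mult_left_mono Basis_le_norm)
  finally show "norm (\<Sum>b\<in>Basis. (h \<bullet> b) * c b) \<le> (\<Sum>b\<in>Basis. \<bar>c b\<bar>) * norm h"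
    by (simp add: sum_distrib_right)
qed

lemma smooth_lipschitz:
  fixes f :: "'a::euclidean_space \<Rightarrow> real"
  assumes "smooth f" "convex S" "\<And>b z. b \<in> Basis \<Longrightarrow> z \<in> S \<Longrightarrow> \<bar>partials [b] f z\<bar> \<le> M"
    and "x \<in> S" "y \<in> S"
  shows "\<bar>f x - f y\<bar> \<le> real DIM('a) * M * norm (x - y)"
proof -
  have "norm (f x - f y) \<le> (real DIM('a) * M) * norm (x - y)"
  proof (rule differentiable_bound[OF assms(2) _ _ assms(4,5)])
    show "(f has_derivative (\<lambda>h. \<Sum>b\<in>Basis. (h \<bullet> b) * partials [b] f z)) (at z within S)" for z
      using smooth_has_derivative[OF assms(1)] has_derivative_at_withinI by blast
    show "onorm (\<lambda>h. \<Sum>b\<in>Basis. (h \<bullet> b) * partials [b] f z) \<le> real DIM('a) * M" if "z \<in> S" for z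
    proof -
      have "(\<Sum>b\<in>Basis. \<bar>partials [b] f z\<bar>) \<le> (\<Sum>b\<in>(Basis::'a set). M)"
        by (intro sum_mono assms(3) that)
      then show ?thesis
        using onorm_partials_le[of "\<lambda>b. partials [b] f z"] by simp
    qed
  qed
  then show ?thesis by simp
qed

text \<open>On the ball of radius \<open>norm h\<close> the first derivatives vary by at most a
  Lipschitz constant times \<open>norm h\<close>, and this variation bounds the linearisation error.
  Each of the two mean value inequalities costs a factor \<open>DIM('a)\<close> for passing from
  coordinates to the norm, hence the square.\<close>

lemma smooth_taylor:
  fixes f :: "'a::euclidean_space \<Rightarrow> real"
  assumes "smooth f"
    and M: "\<And>b c z. b \<in> Basis \<Longrightarrow> c \<in> Basis \<Longrightarrow> dist x z \<le> norm h \<Longrightarrow> \<bar>partials [b, c] f z\<bar> \<le> M"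
  shows "\<bar>f (x + h) - f x - (\<Sum>b\<in>Basis. (h \<bullet> b) * partials [b] f x)\<bar> \<le> (real DIM('a))\<^sup>2 * M * (norm h)\<^sup>2"
proof -
  let ?S = "cball x (norm h)"
  have lip: "\<bar>partials [c] f z - partials [c] f x\<bar> \<le> real DIM('a) * M * norm h"
    if "c \<in> Basis" "z \<in> ?S" for c z
  proof -
    have "\<bar>partials [c] f z - partials [c] f x\<bar> \<le> real DIM('a) * M * norm (z - x)"
    proof (rule smooth_lipschitz[where S = ?S])
      show "smooth (partials [c] f)" using assms(1) that by (intro smooth_partials) auto
      show "\<bar>partials [b] (partials [c] f) z\<bar> \<le> M" if "b \<in> Basis" "z \<in> ?S" for b z
        using M[OF that(1) \<open>c \<in> Basis\<close>, of z] that by simp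
    qed (use that in auto)
    also have "\<dots> \<le> real DIM('a) * M * norm h"
    proof (rule mult_left_mono)
      have "0 \<le> M" using M[of "SOME b. b \<in> Basis" "SOME b. b \<in> Basis" x]
        by (smt (verit) SOME_Basis dist_self norm_ge_zero)
      then show "0 \<le> real DIM('a) * M" by simp
    qed (use that in \<open>simp add: dist_norm norm_minus_commute\<close>)
    finally show ?thesis .
  qed
  have "norm (f (x + h) - f x - (\<Sum>b\<in>Basis. ((x + h - x) \<bullet> b) * partials [b] f x))
     \<le> norm (x + h - x) * (real DIM('a) * (real DIM('a) * M * norm h))"
  proof (rule differentiable_bound_linearization[where S = ?S and f' = "\<lambda>z h. \<Sum>b\<in>Basis. (h \<bullet> b) * partials [b] f z"])
    show "x + t *\<^sub>R (x + h - x) \<in> ?S" if "t \<in> {0..1}" for t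
      using that by (auto simp: dist_norm mult_left_le_one_le)
    show "(f has_derivative (\<lambda>h. \<Sum>b\<in>Basis. (h \<bullet> b) * partials [b] f z)) (at z within ?S)" for z
      using smooth_has_derivative[OF assms(1)] has_derivative_at_withinI by blast
    show "onorm ((\<lambda>i. \<Sum>b\<in>Basis. (i \<bullet> b) * partials [b] f z) - (\<lambda>i. \<Sum>b\<in>Basis. (i \<bullet> b) * partials [b] f x))
        \<le> real DIM('a) * (real DIM('a) * M * norm h)" if "z \<in> ?S" for z
    proof -
      have "(\<Sum>b\<in>Basis. \<bar>partials [b] f z - partials [b] f x\<bar>) \<le> (\<Sum>b\<in>(Basis::'a set). real DIM('a) * M * norm h)"
        by (intro sum_mono lip that)
      then show ?thesis
        using onorm_partials_le[of "\<lambda>b. partials [b] f z - partials [b] f x"]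
        by (simp add: sum_subtractf right_diff_distrib fun_diff_def del: partials.simps)
    qed
  qed simp
  then show ?thesis by (simp add: power2_eq_square algebra_simps)
qed

lemma smooth_bounded_on_compact:
  fixes f :: "'a::euclidean_space \<Rightarrow> real"
  assumes "smooth f" "compact S"
  obtains B where "B > 0" "\<And>x. x \<in> S \<Longrightarrow> \<bar>f x\<bar> \<le> B"
proof -
  have "bounded (f ` S)"
    using compact_continuous_image[OF smooth_continuous_on[OF assms(1)] assms(2)] compact_imp_bounded by blast
  then obtain B where "B > 0" "\<forall>y\<in>f ` S. norm y \<le> B"
    using bounded_pos by blast
  then show ?thesis using that by auto
qed

subsection \<open>Integrals over Euclidean space\<close>

lemma
  fixes f :: "'a::euclidean_space \<Rightarrow> real"
  assumes [measurable]: "f \<in> borel_measurable borel" and c: "c \<noteq> 0"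
  shows lborel_integrable_affine: "integrable lborel (\<lambda>x. f (t + c *\<^sub>R x)) \<longleftrightarrow> integrable lborel f"
    and lborel_integral_affine:
      "integral\<^sup>L lborel f = \<bar>c\<bar> ^ DIM('a) * (LINT x|lborel. f (t + c *\<^sub>R x))"
proof -
  let ?D = "density (distr lborel borel (\<lambda>x::'a. t + c *\<^sub>R x)) (\<lambda>_. ennreal (\<bar>c\<bar> ^ DIM('a)))"
  have D: "lborel = ?D" by (rule lborel_affine[OF c])
  have "integrable lborel f \<longleftrightarrow> integrable ?D f" using D by simp
  also have "\<dots> \<longleftrightarrow> integrable lborel (\<lambda>x. f (t + c *\<^sub>R x))"
    using c by (simp add: integrable_density integrable_distr_eq)
  finally show "integrable lborel (\<lambda>x. f (t + c *\<^sub>R x)) \<longleftrightarrow> integrable lborel f" by simp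
  have "integral\<^sup>L lborel f = integral\<^sup>L ?D f" using D by simp
  also have "\<dots> = \<bar>c\<bar> ^ DIM('a) * (LINT x|lborel. f (t + c *\<^sub>R x))"
    by (simp add: integral_density integral_distr)
  finally show "integral\<^sup>L lborel f = \<bar>c\<bar> ^ DIM('a) * (LINT x|lborel. f (t + c *\<^sub>R x))" .
qed

lemma integrable_bounded_mult:
  fixes f g :: "'a::euclidean_space \<Rightarrow> real"
  assumes "integrable lborel f" "g \<in> borel_measurable borel" "\<And>x. \<bar>g x\<bar> \<le> B"
  shows "integrable lborel (\<lambda>x. g x * f x)"
proof (rule Bochner_Integration.integrable_bound)
  show "integrable lborel (\<lambda>x. B * \<bar>f x\<bar>)" using assms(1) by auto
  show "(\<lambda>x. g x * f x) \<in> borel_measurable lborel" using assms by auto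
  have "\<bar>g x\<bar> * \<bar>f x\<bar> \<le> \<bar>B\<bar> * \<bar>f x\<bar>" for x
    using assms(3)[of x] by (intro mult_right_mono) auto
  then show "AE x in lborel. norm (g x * f x) \<le> norm (B * \<bar>f x\<bar>)"
    by (simp add: abs_mult)
qed

text \<open>Stands in for polar coordinates: \<open>f\<close> is dominated by the sum of the
  constants \<open>c k\<close> on the balls of radius \<open>R k\<close>, whose volumes are
  proportional to \<open>R k ^ DIM('a)\<close>.\<close>

lemma integrable_shells:
  fixes f :: "'a::euclidean_space \<Rightarrow> real" and c R :: "nat \<Rightarrow> real"
  assumes [measurable]: "f \<in> borel_measurable borel"
    and f: "\<And>x. f x \<noteq> 0 \<Longrightarrow> \<exists>k. \<bar>f x\<bar> \<le> c k \<and> norm x \<le> R k"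
    and R: "\<And>k. 0 \<le> R k" and c: "\<And>k. 0 \<le> c k"
    and "summable (\<lambda>k. c k * R k ^ DIM('a))"
  shows "integrable lborel f"
proof (rule integrableI_bounded)
  show "f \<in> borel_measurable lborel" by simp
  let ?V = "unit_ball_vol (real DIM('a))"
  have "(\<integral>\<^sup>+x. ennreal (norm (f x)) \<partial>lborel)
      \<le> (\<integral>\<^sup>+x. (\<Sum>k. ennreal (c k) * indicator (cball 0 (R k)) x) \<partial>(lborel :: 'a measure))"
  proof (rule nn_integral_mono)
    fix x :: 'a
    show "ennreal (norm (f x)) \<le> (\<Sum>k. ennreal (c k) * indicator (cball 0 (R k)) x)"
    proof (cases "f x = 0")
      case False
      then obtain k where k: "\<bar>f x\<bar> \<le> c k" "norm x \<le> R k" using f by blast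
      then have "ennreal (norm (f x)) \<le> ennreal (c k) * indicator (cball 0 (R k)) x"
        by (auto intro: ennreal_leI)
      also have "\<dots> = (\<Sum>j\<in>{k}. ennreal (c j) * indicator (cball 0 (R j)) x)" by (subst sum.insert) auto
      also have "\<dots> \<le> (\<Sum>k. ennreal (c k) * indicator (cball 0 (R k)) x)"
        by (rule sum_le_suminf) auto
      finally show ?thesis .
    qed simp
  qed
  also have "\<dots> = (\<Sum>k. ennreal (?V * (c k * R k ^ DIM('a))))"
  proof (subst nn_integral_suminf)
    show "(\<lambda>x. ennreal (c k) * indicator (cball 0 (R k)) x) \<in> borel_measurable (lborel :: 'a measure)" for k
      by (intro borel_measurable_times_ennreal borel_measurable_const borel_measurable_indicator) simp
    have "(\<integral>\<^sup>+x. ennreal (c k) * indicator (cball 0 (R k)) x \<partial>(lborel :: 'a measure))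
        = ennreal (?V * (c k * R k ^ DIM('a)))" for k
      using R c by (subst nn_integral_cmult_indicator)
        (auto simp: emeasure_cball ennreal_mult'[symmetric] mult_ac)
    then show "(\<Sum>k. \<integral>\<^sup>+x. ennreal (c k) * indicator (cball 0 (R k)) x \<partial>(lborel :: 'a measure))
        = (\<Sum>k. ennreal (?V * (c k * R k ^ DIM('a))))" by simp
  qed
  also have "\<dots> < \<infinity>"
    using R c assms(5) by (subst suminf_ennreal2) (auto intro!: mult_nonneg_nonneg)
  finally show "(\<integral>\<^sup>+x. ennreal (norm (f x)) \<partial>lborel) < \<infinity>" .
qed

section \<open>Integrability of powers of the norm\<close>

lemma ex_dyadic:
  fixes y :: real
  assumes "1 \<le> y"
  shows "\<exists>k::nat. 2 ^ k \<le> y \<and> y \<le> 2 ^ Suc k"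
proof -
  obtain m :: nat where "y < 2 ^ m" using real_arch_pow[of 2 y] by auto
  then have m: "y < 2 ^ (LEAST m. y < 2 ^ m)" by (rule LeastI)
  with assms have "(LEAST m. y < 2 ^ m) \<noteq> 0" by (metis not_less power_0)
  then obtain k where k: "(LEAST m. y < 2 ^ m) = Suc k" by (metis not0_implies_Suc)
  then have "\<not> y < 2 ^ k" using not_less_Least[of k "\<lambda>m. y < 2 ^ m"] by simp
  with m k show ?thesis by (intro exI[of _ k]) auto
qed

text \<open>The bounds on the dyadic shells form a geometric series of ratio
  \<open>2 powr (n - a)\<close>, with \<open>n\<close> the dimension, which is below one exactly
  when \<open>n < a\<close>.\<close>

lemma integrable_powr_outside:
  assumes "0 < r" "real DIM('a) < a"
  shows "integrable lborel (\<lambda>x::'a::euclidean_space. indicator (- ball 0 r) x * norm x powr - a)"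
proof (rule integrable_shells[where c = "\<lambda>k. (r * 2 ^ k) powr - a" and R = "\<lambda>k. r * 2 ^ Suc k"])
  fix x :: 'a assume "indicator (- ball 0 r) x * norm x powr - a \<noteq> 0"
  then have x: "r \<le> norm x" by (auto simp: indicator_def split: if_splits)
  with assms obtain k :: nat where k: "2 ^ k \<le> norm x / r" "norm x / r \<le> 2 ^ Suc k"
    using ex_dyadic[of "norm x / r"] by auto
  have "norm x powr - a \<le> (r * 2 ^ k) powr - a"
    using k assms by (intro powr_mono2') (auto simp: field_simps)
  then show "\<exists>k. \<bar>indicator (- ball 0 r) x * norm x powr - a\<bar> \<le> (r * 2 ^ k) powr - a \<and> norm x \<le> r * 2 ^ Suc k"
    using k assms x by (intro exI[of _ k]) (auto simp: field_simps)
next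
  have "(2::real) powr (real DIM('a) - a) < 1"
    using assms by (simp add: powr_less_one)
  then have "summable (\<lambda>k. (r powr - a * (2 * r) ^ DIM('a)) * (2 powr (real DIM('a) - a)) ^ k)"
    by (intro summable_mult summable_geometric) auto
  moreover have "(r * 2 ^ k) powr - a * (r * 2 ^ Suc k) ^ DIM('a)
      = (r powr - a * (2 * r) ^ DIM('a)) * (2 powr (real DIM('a) - a)) ^ k" for k
  proof -
    have "(2 powr (real DIM('a) - a)) ^ k = (2 ^ k) powr - a * (2 ^ k) ^ DIM('a)"
      by (simp add: powr_realpow[symmetric] powr_powr powr_add[symmetric] algebra_simps)
    then show ?thesis using assms by (simp add: powr_mult power_mult_distrib)
  qed
  ultimately show "summable (\<lambda>k. (r * 2 ^ k) powr - a * (r * 2 ^ Suc k) ^ DIM('a))" by simp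
qed (use assms in auto)

text \<open>The shells shrink towards the origin and the series has ratio
  \<open>2 powr (a - n)\<close>. The origin itself lies in no shell, but there the integrand
  vanishes because \<open>0 powr _\<close> is \<open>0\<close>.\<close>

lemma integrable_powr_inside:
  assumes "0 < r" "0 \<le> a" "a < real DIM('a)"
  shows "integrable lborel (\<lambda>x::'a::euclidean_space. indicator (cball 0 r) x * norm x powr - a)"
proof (rule integrable_shells[where c = "\<lambda>k. (r / 2 ^ Suc k) powr - a" and R = "\<lambda>k. r / 2 ^ k"])
  fix x :: 'a assume "indicator (cball 0 r) x * norm x powr - a \<noteq> 0"
  then have x: "0 < norm x" "norm x \<le> r" by (auto simp: indicator_def split: if_splits)
  with assms obtain k :: nat where k: "2 ^ k \<le> r / norm x" "r / norm x \<le> 2 ^ Suc k"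
    using ex_dyadic[of "r / norm x"] by auto
  have "norm x powr - a \<le> (r / 2 ^ Suc k) powr - a"
    using k assms(2,3) x \<open>0 < r\<close> by (intro powr_mono2') (simp_all add: field_simps)
  then show "\<exists>k. \<bar>indicator (cball 0 r) x * norm x powr - a\<bar> \<le> (r / 2 ^ Suc k) powr - a \<and> norm x \<le> r / 2 ^ k"
    using k assms x by (intro exI[of _ k]) (auto simp: field_simps)
next
  have "(2::real) powr (a - real DIM('a)) < 1"
    using assms by (simp add: powr_less_one)
  then have "summable (\<lambda>k. ((r / 2) powr - a * r ^ DIM('a)) * (2 powr (a - real DIM('a))) ^ k)"
    by (intro summable_mult summable_geometric) auto
  moreover have "(r / 2 ^ Suc k) powr - a * (r / 2 ^ k) ^ DIM('a)
      = ((r / 2) powr - a * r ^ DIM('a)) * (2 powr (a - real DIM('a))) ^ k" for k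
  proof -
    have "(2 powr (a - real DIM('a))) ^ k = (2 ^ k) powr a / (2 ^ k) ^ DIM('a)"
      by (simp add: powr_realpow[symmetric] powr_powr powr_diff[symmetric] algebra_simps)
    moreover have "(r / 2 ^ Suc k) powr - a = (r / 2) powr - a * (2 ^ k) powr a"
    proof -
      have "r / 2 ^ Suc k = (r / 2) * inverse (2 ^ k)" by (simp add: field_simps)
      then show ?thesis using assms by (simp only: powr_mult powr_minus) (simp add: powr_minus inverse_powr)
    qed
    ultimately show ?thesis using assms by (simp add: power_divide)
  qed
  ultimately show "summable (\<lambda>k. (r / 2 ^ Suc k) powr - a * (r / 2 ^ k) ^ DIM('a))" by simp
  show "(\<lambda>x::'a. indicator (cball 0 r) x * norm x powr - a) \<in> borel_measurable borel"
  proof (rule borel_measurable_times)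
    show "(indicator (cball 0 r) :: 'a \<Rightarrow> real) \<in> borel_measurable borel"
      by (rule borel_measurable_indicator) simp
  qed measurable
qed (use assms in auto)

subsection \<open>Convolution with a smooth function\<close>

lemma conv_commute:
  fixes f g :: "'a::euclidean_space \<Rightarrow> real"
  assumes [measurable]: "f \<in> borel_measurable borel" "g \<in> borel_measurable borel"
  shows "conv f g = conv g f"
proof
  fix x
  have "conv f g x = (LINT y|lborel. f (x - (x + (-1) *\<^sub>R y)) * g (x + (-1) *\<^sub>R y))"
    unfolding conv_def by (subst lborel_integral_affine[where c = "-1" and t = x]) auto
  then show "conv f g x = conv g f x" by (simp add: conv_def mult.commute)
qed

text \<open>Global bounds on all derivatives allow convolution with a factor that is merely
  integrable, such as the difference of \<open>Phi\<close> and \<open>\<Gamma>\<close>.\<close>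

definition bounded_smooth :: "('a::euclidean_space \<Rightarrow> real) \<Rightarrow> bool" where
  "bounded_smooth f \<longleftrightarrow> smooth f \<and> (\<forall>bs. set bs \<subseteq> Basis \<longrightarrow> (\<exists>B. \<forall>x. \<bar>partials bs f x\<bar> \<le> B))"

lemma bounded_smooth_partials:
  "bounded_smooth f \<Longrightarrow> set bs \<subseteq> Basis \<Longrightarrow> bounded_smooth (partials bs f)"
  unfolding bounded_smooth_def by (metis partials_append set_append Un_least smooth_partials)

lemma bounded_smooth_bounded:
  assumes "bounded_smooth f"
  obtains B where "\<And>x. \<bar>f x\<bar> \<le> B"
  using assms unfolding bounded_smooth_def by (metis empty_set empty_subsetI partials.simps(1))

lemma integrable_conv:
  assumes "bounded_smooth g" "integrable lborel w"
  shows "integrable lborel (\<lambda>y. g (x - y) * w y)"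
proof -
  obtain B where "\<And>x. \<bar>g x\<bar> \<le> B" using bounded_smooth_bounded[OF assms(1)] by metis
  moreover have [measurable]: "g \<in> borel_measurable borel"
    using assms(1) by (intro smooth_borel) (simp add: bounded_smooth_def)
  ultimately show ?thesis by (intro integrable_bounded_mult[OF assms(2)]) auto
qed

lemma has_derivative_quadratic:
  fixes F :: "'a::euclidean_space \<Rightarrow> real"
  assumes "bounded_linear L" "\<And>h. \<bar>F (x + h) - F x - L h\<bar> \<le> B * (norm h)\<^sup>2"
  shows "(F has_derivative L) (at x)"
  unfolding has_derivative_at
proof
  show "bounded_linear L" by fact
  show "(\<lambda>h. norm (F (x + h) - F x - L h) / norm h) \<midarrow>0\<rightarrow> 0"
  proof (rule tendsto_sandwich[where f = "\<lambda>_. 0" and h = "\<lambda>h. B * norm h", OF always_eventually always_eventually])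
    have "norm (F (x + h) - F x - L h) / norm h \<le> B * norm h" for h
      using assms(2)[of h] by (cases "h = 0") (auto simp: field_simps power2_eq_square)
    then show "\<forall>h. norm (F (x + h) - F x - L h) / norm h \<le> B * norm h" by blast
    show "(\<lambda>h::'a. B * norm h) \<midarrow>0\<rightarrow> 0" by (auto intro!: tendsto_eq_intros)
    show "\<forall>h. 0 \<le> norm (F (x + h) - F x - L h) / norm h" by simp
  qed simp
qed

lemma second_partials_bound:
  fixes f :: "'a::euclidean_space \<Rightarrow> real"
  assumes "\<And>bs. set bs \<subseteq> Basis \<Longrightarrow> \<exists>B. \<forall>z\<in>S. \<bar>partials bs f z\<bar> \<le> B"
  shows "\<exists>M. \<forall>b\<in>Basis. \<forall>c\<in>Basis. \<forall>z\<in>S. \<bar>partials [b, c] f z\<bar> \<le> M"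
proof -
  obtain \<beta> where \<beta>: "\<And>bs z. set bs \<subseteq> Basis \<Longrightarrow> z \<in> S \<Longrightarrow> \<bar>partials bs f z\<bar> \<le> \<beta> bs"
    using assms by metis
  have "\<bar>partials [b, c] f z\<bar> \<le> (\<Sum>b\<in>Basis. \<Sum>c\<in>Basis. \<bar>\<beta> [b, c]\<bar>)"
    if "b \<in> Basis" "c \<in> Basis" "z \<in> S" for b c z
  proof -
    have "\<bar>partials [b, c] f z\<bar> \<le> \<bar>\<beta> [b, c]\<bar>"
      using \<beta>[of "[b, c]" z] that by auto
    also have "\<dots> \<le> (\<Sum>c\<in>Basis. \<bar>\<beta> [b, c]\<bar>)"
      using that by (intro member_le_sum) auto
    also have "\<dots> \<le> (\<Sum>b\<in>Basis. \<Sum>c\<in>Basis. \<bar>\<beta> [b, c]\<bar>)"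
      using that by (intro member_le_sum[of b Basis "\<lambda>b. \<Sum>c\<in>Basis. \<bar>\<beta> [b, c]\<bar>"]) (auto intro: sum_nonneg)
    finally show ?thesis .
  qed
  then show ?thesis by blast
qed

text \<open>The Taylor remainder of \<open>g\<close> is quadratic in \<open>h\<close> uniformly in
  the base point, so integrating it against \<open>\<bar>w y\<bar>\<close> leaves a quadratic
  remainder for the convolution. This differentiates under the integral without a limit
  theorem.\<close>

lemma has_derivative_conv:
  fixes g w :: "'a::euclidean_space \<Rightarrow> real"
  assumes g: "bounded_smooth g" and w: "integrable lborel w"
  shows "(conv g w has_derivative (\<lambda>h. \<Sum>b\<in>Basis. (h \<bullet> b) * conv (partials [b] g) w x)) (at x)"
proof -
  have "\<exists>B. \<forall>z\<in>UNIV. \<bar>partials bs g z\<bar> \<le> B" if "set bs \<subseteq> Basis" for bs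
    using g that by (simp add: bounded_smooth_def)
  from second_partials_bound[OF this] obtain M where
    "\<forall>b\<in>Basis. \<forall>c\<in>Basis. \<forall>z. \<bar>partials [b, c] g z\<bar> \<le> M" by auto
  then have M: "\<bar>partials [b, c] g z\<bar> \<le> M" if "b \<in> Basis" "c \<in> Basis" for b c z
    using that by blast
  show ?thesis
  proof (rule has_derivative_quadratic)
    show "bounded_linear (\<lambda>h. \<Sum>b\<in>Basis. (h \<bullet> b) * conv (partials [b] g) w x)"
      by (intro bounded_linear_sum bounded_linear_mult_const bounded_linear_inner_left)
    fix h :: 'a
    let ?N = "(real DIM('a))\<^sup>2 * M * (norm h)\<^sup>2"
    let ?E = "\<lambda>y. g (x - y + h) - g (x - y) - (\<Sum>b\<in>Basis. (h \<bullet> b) * partials [b] g (x - y))"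
    have int: "integrable lborel (\<lambda>y. g (x + h - y) * w y)" "integrable lborel (\<lambda>y. g (x - y) * w y)"
      using integrable_conv[OF g w] by auto
    have intb: "integrable lborel (\<lambda>y. partials [b] g (x - y) * w y)" if "b \<in> Basis" for b
      using that by (intro integrable_conv bounded_smooth_partials g w) auto
    have eq: "?E y * w y = g (x + h - y) * w y - g (x - y) * w y
        - (\<Sum>b\<in>Basis. (h \<bullet> b) * (partials [b] g (x - y) * w y))" for y
    proof -
      have "x - y + h = x + h - y" by simp
      then show ?thesis by (simp add: algebra_simps sum_distrib_left sum_distrib_right del: partials.simps)
    qed
    have intE: "integrable lborel (\<lambda>y. ?E y * w y)"
      unfolding eq using int intb
      by (intro Bochner_Integration.integrable_diff Bochner_Integration.integrable_sum integrable_mult_right) auto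
    have "conv g w (x + h) - conv g w x - (\<Sum>b\<in>Basis. (h \<bullet> b) * conv (partials [b] g) w x)
       = (LINT y|lborel. ?E y * w y)"
    proof -
      have "integrable lborel (\<lambda>y. \<Sum>b\<in>Basis. (h \<bullet> b) * (partials [b] g (x - y) * w y))"
        using intb by (intro Bochner_Integration.integrable_sum integrable_mult_right)
      moreover have "(LINT y|lborel. (\<Sum>b\<in>Basis. (h \<bullet> b) * (partials [b] g (x - y) * w y)))
          = (\<Sum>b\<in>Basis. (h \<bullet> b) * conv (partials [b] g) w x)"
        using intb by (subst Bochner_Integration.integral_sum) (auto simp: conv_def simp del: partials.simps)
      ultimately show ?thesis
        unfolding eq using int by (simp add: conv_def del: partials.simps)
    qed
    also have "\<bar>\<dots>\<bar> \<le> (LINT y|lborel. ?N * \<bar>w y\<bar>)"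
    proof -
      have "\<bar>?E y * w y\<bar> \<le> ?N * \<bar>w y\<bar>" for y
        unfolding abs_mult using g
        by (intro mult_right_mono smooth_taylor M) (auto simp: bounded_smooth_def)
      then have "norm (LINT y|lborel. ?E y * w y) \<le> (LINT y|lborel. ?N * \<bar>w y\<bar>)"
        using intE w by (intro order_trans[OF Bochner_Integration.integral_norm_bound] integral_mono) auto
      then show ?thesis by simp
    qed
    also have "\<dots> = ((real DIM('a))\<^sup>2 * M * (LINT y|lborel. \<bar>w y\<bar>)) * (norm h)\<^sup>2" by simp
    finally show "\<bar>conv g w (x + h) - conv g w x - (\<Sum>b\<in>Basis. (h \<bullet> b) * conv (partials [b] g) w x)\<bar>
      \<le> ((real DIM('a))\<^sup>2 * M * (LINT y|lborel. \<bar>w y\<bar>)) * (norm h)\<^sup>2" .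
  qed
qed

lemma partial_conv:
  fixes g w :: "'a::euclidean_space \<Rightarrow> real"
  assumes "bounded_smooth g" "integrable lborel w" "b \<in> Basis"
  shows "partials [b] (conv g w) = conv (partials [b] g) w"
proof
  fix x
  have "partials [b] (conv g w) x = (\<Sum>c\<in>Basis. (b \<bullet> c) * conv (partials [c] g) w x)"
    by (rule partial_eqI[OF has_derivative_conv[OF assms(1,2)]])
  also have "\<dots> = (\<Sum>c\<in>Basis. if c = b then conv (partials [c] g) w x else 0)"
    using assms(3) by (intro sum.cong) (auto simp: inner_Basis)
  also have "\<dots> = conv (partials [b] g) w x" using assms(3) by simp
  finally show "partials [b] (conv g w) x = conv (partials [b] g) w x" .
qed

lemma partials_conv:
  assumes "bounded_smooth g" "integrable lborel w" "set bs \<subseteq> Basis"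
  shows "partials bs (conv g w) = conv (partials bs g) w"
  using assms(3)
proof (induction bs)
  case (Cons b bs)
  have "partials (b # bs) (conv g w) = partials [b] (partials bs (conv g w))" by simp
  also have "\<dots> = partials [b] (conv (partials bs g) w)" using Cons by simp
  also have "\<dots> = conv (partials [b] (partials bs g)) w"
    using Cons.prems by (intro partial_conv bounded_smooth_partials assms) auto
  finally show ?case by simp
qed simp

text \<open>All derivatives fall on the first factor, so the invariant keeps \<open>w\<close> fixed
  and lets \<open>g\<close> range over the bounded smooth functions.\<close>

lemma smooth_conv:
  assumes "bounded_smooth g" "integrable lborel w"
  shows "smooth (conv g w)"
proof (rule smooth_coinduct[where P = "\<lambda>f. \<exists>g. bounded_smooth g \<and> f = conv g w"])
  show "\<exists>h. bounded_smooth h \<and> conv g w = conv h w" using assms by blast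
  show "f differentiable (at x)" if "\<exists>g. bounded_smooth g \<and> f = conv g w" for f x
    using that has_derivative_conv[OF _ assms(2)] unfolding differentiable_def by blast
  show "\<exists>g. bounded_smooth g \<and> partials [b] f = conv g w"
    if "\<exists>g. bounded_smooth g \<and> f = conv g w" "b \<in> Basis" for f b
    using that partial_conv[OF _ assms(2)] bounded_smooth_partials[of _ "[b]"]
    by (metis empty_subsetI insert_subset list.set(1) list.set(2))
qed

subsection \<open>The space \<open>\<S>\<^sub>s\<close>\<close>

text \<open>From \<open>norm (y + z) \<le> 2 * max (norm y) R\<close>. Bounded shifts thus cost a
  constant factor in the weight, which is what lets estimates pass through translations and
  compactly supported convolutions.\<close>

lemma weight_shift:
  assumes "0 \<le> p" "norm z \<le> R"
  shows "1 + norm (y + z) powr p \<le> (1 + 2 powr p * (1 + R powr p)) * (1 + norm y powr p)"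
proof -
  have R: "0 \<le> R" using assms(2) norm_ge_zero order_trans by blast
  have "norm (y + z) \<le> 2 * max (norm y) R"
    using norm_triangle_ineq[of y z] assms(2) by linarith
  then have "norm (y + z) powr p \<le> (2 * max (norm y) R) powr p"
    using assms by (intro powr_mono2) auto
  also have "\<dots> = 2 powr p * max (norm y) R powr p" by (simp add: powr_mult)
  also have "\<dots> \<le> 2 powr p * (norm y powr p + R powr p)"
    by (intro mult_left_mono) (auto simp: max_def)
  also have "\<dots> \<le> 2 powr p * ((1 + R powr p) * (1 + norm y powr p))"
    by (intro mult_left_mono) (auto simp: algebra_simps)
  finally have "norm (y + z) powr p \<le> 2 powr p * ((1 + R powr p) * (1 + norm y powr p))" .
  moreover have "0 \<le> norm y powr p" by simp
  ultimately show ?thesis by (simp only: distrib_right mult_1_left mult.assoc)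
qed

text \<open>Takes the place of the seminorms in estimates: each partial derivative is bounded
  separately, with neither a supremum nor an \<open>L2_set\<close>. The two descriptions agree up to
  the number of partial derivatives of each order.\<close>

definition Ss_bounded :: "real \<Rightarrow> nat \<Rightarrow> ('a::euclidean_space \<Rightarrow> real) \<Rightarrow> real \<Rightarrow> bool" where
  "Ss_bounded s N \<phi> B \<longleftrightarrow> (\<forall>bs x. set bs \<subseteq> Basis \<and> length bs \<le> N \<longrightarrow>
     (1 + norm x powr (real DIM('a) + 2 * s)) * \<bar>partials bs \<phi> x\<bar> \<le> B)"

lemma Ss_boundedD:
  fixes \<phi> :: "'a::euclidean_space \<Rightarrow> real"
  assumes "Ss_bounded s N \<phi> B" "set bs \<subseteq> Basis" "length bs \<le> N"
  shows "(1 + norm x powr (real DIM('a) + 2 * s)) * \<bar>partials bs \<phi> x\<bar> \<le> B"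
  using assms by (auto simp: Ss_bounded_def)

lemma finite_Basis_lists: "finite {bs. set bs \<subseteq> (Basis :: 'a::euclidean_space set) \<and> length bs = k}"
  by (rule finite_lists_length_eq) simp

lemma Ss_partial_bound:
  fixes \<phi> :: "'a::euclidean_space \<Rightarrow> real"
  assumes "\<phi> \<in> Ss s" "set bs \<subseteq> Basis"
  shows "\<exists>B. \<forall>x. (1 + norm x powr (real DIM('a) + 2 * s)) * \<bar>partials bs \<phi> x\<bar> \<le> B"
proof -
  obtain B where B: "\<And>x. Ss_weighted s (length bs) \<phi> x \<le> B"
    using assms(1) by (auto simp: Ss_def bdd_above_def)
  have "(1 + norm x powr (real DIM('a) + 2 * s)) * \<bar>partials bs \<phi> x\<bar> \<le> B" for x
  proof -
    have "\<bar>partials bs \<phi> x\<bar> \<le> norm_D (length bs) \<phi> x"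
    proof -
      have "\<bar>partials bs \<phi> x\<bar> = L2_set (\<lambda>bs. partials bs \<phi> x) {bs}" by simp
      also have "\<dots> \<le> norm_D (length bs) \<phi> x"
        unfolding norm_D_def L2_set_def using assms(2)
        by (intro real_sqrt_le_mono sum_mono2 finite_Basis_lists) auto
      finally show ?thesis .
    qed
    then have "(1 + norm x powr (real DIM('a) + 2 * s)) * \<bar>partials bs \<phi> x\<bar>
      \<le> Ss_weighted s (length bs) \<phi> x"
      unfolding Ss_weighted_def by (intro mult_left_mono) (auto simp: add_nonneg_nonneg)
    with B[of x] show ?thesis by linarith
  qed
  then show ?thesis by blast
qed

lemma Ss_weighted_le:
  fixes \<phi> :: "'a::euclidean_space \<Rightarrow> real"
  assumes "\<And>bs. set bs \<subseteq> Basis \<Longrightarrow> length bs = k \<Longrightarrow>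
     (1 + norm x powr (real DIM('a) + 2 * s)) * \<bar>partials bs \<phi> x\<bar> \<le> B bs"
  shows "Ss_weighted s k \<phi> x \<le> (\<Sum>bs | set bs \<subseteq> (Basis :: 'a set) \<and> length bs = k. B bs)"
proof -
  let ?w = "1 + norm x powr (real DIM('a) + 2 * s)"
  have "norm_D k \<phi> x \<le> (\<Sum>bs | set bs \<subseteq> (Basis :: 'a set) \<and> length bs = k. \<bar>partials bs \<phi> x\<bar>)"
    unfolding norm_D_def by (rule L2_set_le_sum_abs)
  then have "Ss_weighted s k \<phi> x \<le> ?w * (\<Sum>bs | set bs \<subseteq> (Basis :: 'a set) \<and> length bs = k. \<bar>partials bs \<phi> x\<bar>)"
    unfolding Ss_weighted_def by (intro mult_left_mono) (auto simp: add_nonneg_nonneg)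
  also have "\<dots> \<le> (\<Sum>bs | set bs \<subseteq> (Basis :: 'a set) \<and> length bs = k. B bs)"
    unfolding sum_distrib_left using assms by (intro sum_mono) auto
  finally show ?thesis .
qed

lemma Ss_memI:
  fixes \<phi> :: "'a::euclidean_space \<Rightarrow> real"
  assumes "smooth \<phi>" "\<And>bs. set bs \<subseteq> Basis \<Longrightarrow>
     \<exists>B. \<forall>x. (1 + norm x powr (real DIM('a) + 2 * s)) * \<bar>partials bs \<phi> x\<bar> \<le> B"
  shows "\<phi> \<in> Ss s"
proof -
  obtain B where B: "\<And>bs x. set bs \<subseteq> (Basis :: 'a set) \<Longrightarrow>
     (1 + norm x powr (real DIM('a) + 2 * s)) * \<bar>partials bs \<phi> x\<bar> \<le> B bs"
    using assms(2) by metis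
  have "bdd_above (range (Ss_weighted s k \<phi>))" for k
    using Ss_weighted_le[of k _ s \<phi> B] B by (intro bdd_aboveI) blast
  with assms(1) show ?thesis by (simp add: Ss_def)
qed

lemma Ss_bounded_ex:
  fixes \<phi> :: "'a::euclidean_space \<Rightarrow> real"
  assumes "\<phi> \<in> Ss s"
  obtains B where "0 \<le> B" "Ss_bounded s N \<phi> B"
proof -
  obtain B where B: "\<And>bs x. set bs \<subseteq> (Basis :: 'a set) \<Longrightarrow>
     (1 + norm x powr (real DIM('a) + 2 * s)) * \<bar>partials bs \<phi> x\<bar> \<le> B bs"
    using Ss_partial_bound[OF assms] by metis
  have fin: "finite {bs. set bs \<subseteq> (Basis :: 'a set) \<and> length bs \<le> N}"
    by (rule finite_lists_length_le) simp
  have "Ss_bounded s N \<phi> (\<Sum>bs | set bs \<subseteq> (Basis :: 'a set) \<and> length bs \<le> N. \<bar>B bs\<bar>)"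
    unfolding Ss_bounded_def
  proof (intro allI impI)
    fix bs :: "'a list" and x :: 'a assume b: "set bs \<subseteq> Basis \<and> length bs \<le> N"
    then have "(1 + norm x powr (real DIM('a) + 2 * s)) * \<bar>partials bs \<phi> x\<bar> \<le> \<bar>B bs\<bar>"
      using B[of bs x] by linarith
    also have "\<dots> \<le> (\<Sum>bs | set bs \<subseteq> (Basis :: 'a set) \<and> length bs \<le> N. \<bar>B bs\<bar>)"
      using b by (intro member_le_sum fin) auto
    finally show "(1 + norm x powr (real DIM('a) + 2 * s)) * \<bar>partials bs \<phi> x\<bar> \<le> \<dots>" .
  qed
  then show ?thesis by (intro that[of "\<Sum>bs | set bs \<subseteq> (Basis :: 'a set) \<and> length bs \<le> N. \<bar>B bs\<bar>"])
    (auto intro: sum_nonneg)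
qed

lemma Ss_smooth: "\<phi> \<in> Ss s \<Longrightarrow> smooth \<phi>"
  by (simp add: Ss_def)

lemma Ss_lincomb:
  assumes "\<phi> \<in> Ss s" "\<psi> \<in> Ss s"
  shows "(\<lambda>x. a * \<phi> x + b * \<psi> x) \<in> Ss s"
proof (rule Ss_memI)
  show "smooth (\<lambda>x. a * \<phi> x + b * \<psi> x)" using assms by (intro smooth_lincomb Ss_smooth)
  fix bs :: "'a list" assume bs: "set bs \<subseteq> Basis"
  let ?w = "\<lambda>x::'a. 1 + norm x powr (real DIM('a) + 2 * s)"
  obtain B1 B2 where B: "\<And>x. ?w x * \<bar>partials bs \<phi> x\<bar> \<le> B1" "\<And>x. ?w x * \<bar>partials bs \<psi> x\<bar> \<le> B2"
    using Ss_partial_bound[OF assms(1) bs] Ss_partial_bound[OF assms(2) bs] by blast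
  have "?w x * \<bar>partials bs (\<lambda>x. a * \<phi> x + b * \<psi> x) x\<bar> \<le> \<bar>a\<bar> * B1 + \<bar>b\<bar> * B2" for x
  proof -
    have "\<bar>partials bs (\<lambda>x. a * \<phi> x + b * \<psi> x) x\<bar> \<le> \<bar>a\<bar> * \<bar>partials bs \<phi> x\<bar> + \<bar>b\<bar> * \<bar>partials bs \<psi> x\<bar>"
      using assms bs by (simp add: partials_lincomb Ss_smooth flip: abs_mult)
    then have "?w x * \<bar>partials bs (\<lambda>x. a * \<phi> x + b * \<psi> x) x\<bar>
        \<le> ?w x * (\<bar>a\<bar> * \<bar>partials bs \<phi> x\<bar> + \<bar>b\<bar> * \<bar>partials bs \<psi> x\<bar>)"
      by (intro mult_left_mono) (auto simp: add_nonneg_nonneg)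
    also have "\<dots> = \<bar>a\<bar> * (?w x * \<bar>partials bs \<phi> x\<bar>) + \<bar>b\<bar> * (?w x * \<bar>partials bs \<psi> x\<bar>)"
      by (simp add: algebra_simps)
    also have "\<dots> \<le> \<bar>a\<bar> * B1 + \<bar>b\<bar> * B2"
      using B by (intro add_mono mult_left_mono) auto
    finally show ?thesis .
  qed
  then show "\<exists>B. \<forall>x. ?w x * \<bar>partials bs (\<lambda>x. a * \<phi> x + b * \<psi> x) x\<bar> \<le> B" by blast
qed

lemma Ss_affine:
  assumes "\<phi> \<in> Ss s" "c \<noteq> 0" "0 \<le> s"
  shows "(\<lambda>x. \<phi> (z + c *\<^sub>R x)) \<in> Ss s"
proof (rule Ss_memI)
  show "smooth (\<lambda>x. \<phi> (z + c *\<^sub>R x))" using assms by (intro smooth_affine Ss_smooth)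
  fix bs :: "'a list" assume bs: "set bs \<subseteq> Basis"
  define p where "p = real DIM('a) + 2 * s"
  have p: "0 \<le> p" using assms by (simp add: p_def)
  \<comment> \<open>The factor from \<open>weight_shift\<close> for the shift
    \<open>z /\<^sub>R c\<close>, which undoes the translation part of the affine map.\<close>
  define A where "A = 1 + 2 powr p * (1 + norm (z /\<^sub>R c) powr p)"
  have A: "0 \<le> A" by (simp add: A_def)
  obtain B where B: "\<And>x. (1 + norm x powr p) * \<bar>partials bs \<phi> x\<bar> \<le> B"
    using Ss_partial_bound[OF assms(1) bs] unfolding p_def by blast
  let ?C = "\<bar>c\<bar> ^ length bs * (A * (1 + \<bar>1 / c\<bar> powr p) * B)"
  have "(1 + norm x powr p) * \<bar>partials bs (\<lambda>x. \<phi> (z + c *\<^sub>R x)) x\<bar> \<le> ?C" for x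
  proof -
    let ?v = "z + c *\<^sub>R x"
    have "x = ?v /\<^sub>R c + (- z /\<^sub>R c)" using assms(2) by (simp add: scaleR_add_right)
    then have "1 + norm x powr p \<le> A * (1 + norm (?v /\<^sub>R c) powr p)"
      using weight_shift[OF p, of "- z /\<^sub>R c" "norm (z /\<^sub>R c)" "?v /\<^sub>R c"] by (simp add: A_def)
    also have "\<dots> \<le> A * ((1 + \<bar>1 / c\<bar> powr p) * (1 + norm ?v powr p))"
    proof (rule mult_left_mono[OF _ A])
      have "norm (?v /\<^sub>R c) powr p = \<bar>1 / c\<bar> powr p * norm ?v powr p"
        by (simp add: powr_mult divide_inverse)
      then show "1 + norm (?v /\<^sub>R c) powr p \<le> (1 + \<bar>1 / c\<bar> powr p) * (1 + norm ?v powr p)"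
        by (simp add: algebra_simps)
    qed
    finally have "(1 + norm x powr p) * \<bar>partials bs \<phi> ?v\<bar>
        \<le> A * ((1 + \<bar>1 / c\<bar> powr p) * (1 + norm ?v powr p)) * \<bar>partials bs \<phi> ?v\<bar>"
      by (intro mult_right_mono) auto
    also have "\<dots> = A * (1 + \<bar>1 / c\<bar> powr p) * ((1 + norm ?v powr p) * \<bar>partials bs \<phi> ?v\<bar>)"
      by simp
    also have "\<dots> \<le> A * (1 + \<bar>1 / c\<bar> powr p) * B"
      using A by (intro mult_left_mono B) auto
    finally have "\<bar>c\<bar> ^ length bs * ((1 + norm x powr p) * \<bar>partials bs \<phi> ?v\<bar>) \<le> ?C"
      by (intro mult_left_mono) auto
    then show ?thesis
      by (simp add: partials_affine[OF Ss_smooth[OF assms(1)] bs] abs_mult power_abs mult.left_commute)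
  qed
  then show "\<exists>B. \<forall>x. (1 + norm x powr (real DIM('a) + 2 * s)) * \<bar>partials bs (\<lambda>x. \<phi> (z + c *\<^sub>R x)) x\<bar> \<le> B"
    unfolding p_def by blast
qed

lemma Ss_translate:
  assumes "\<phi> \<in> Ss s" "0 \<le> s"
  shows "(\<lambda>y. \<phi> (y - x)) \<in> Ss s"
  using Ss_affine[OF assms(1), of 1 "- x"] assms(2) by simp

lemma Ss_bounded_smooth:
  assumes "\<phi> \<in> Ss s"
  shows "bounded_smooth \<phi>"
  unfolding bounded_smooth_def
proof (intro conjI allI impI)
  show "smooth \<phi>" using assms by (rule Ss_smooth)
  fix bs :: "'a list" assume bs: "set bs \<subseteq> Basis"
  obtain B where B: "\<And>x. (1 + norm x powr (real DIM('a) + 2 * s)) * \<bar>partials bs \<phi> x\<bar> \<le> B"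
    using Ss_partial_bound[OF assms bs] by blast
  have "\<bar>partials bs \<phi> x\<bar> \<le> B" for x
  proof -
    have "1 * \<bar>partials bs \<phi> x\<bar> \<le> (1 + norm x powr (real DIM('a) + 2 * s)) * \<bar>partials bs \<phi> x\<bar>"
      by (intro mult_right_mono) auto
    with B[of x] show ?thesis by linarith
  qed
  then show "\<exists>B. \<forall>x. \<bar>partials bs \<phi> x\<bar> \<le> B" by blast
qed

lemma compact_support_Ss:
  assumes "smooth \<phi>" "\<And>x. R < norm x \<Longrightarrow> \<phi> x = 0" "0 \<le> s"
  shows "\<phi> \<in> Ss s"
proof (rule Ss_memI[OF assms(1)])
  fix bs :: "'a list" assume bs: "set bs \<subseteq> Basis"
  let ?w = "\<lambda>x::'a. 1 + norm x powr (real DIM('a) + 2 * s)"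
  obtain B where B: "B > 0" "\<And>x. x \<in> cball 0 R \<Longrightarrow> \<bar>partials bs \<phi> x\<bar> \<le> B"
    using smooth_bounded_on_compact[OF smooth_partials[OF assms(1) bs], of "cball 0 R"] by auto
  have "?w x * \<bar>partials bs \<phi> x\<bar> \<le> (1 + R powr (real DIM('a) + 2 * s)) * B" for x
  proof (cases "norm x \<le> R")
    case True
    then show ?thesis using B assms(3) by (intro mult_mono add_mono powr_mono2) auto
  next
    case False
    have "partials bs \<phi> x = 0"
      by (rule partials_zero_set[of "- cball 0 R"]) (use False assms(2) in auto)
    then show ?thesis using B by simp
  qed
  then show "\<exists>B. \<forall>x. ?w x * \<bar>partials bs \<phi> x\<bar> \<le> B" by blast
qed

text \<open>Differentiation lowers the degree of homogeneity further, so every derivative decays at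
  least as fast as the function. Bounds on the ball of radius 2 are carried outwards by
  scaling.\<close>

lemma homogeneous_Ss:
  fixes f :: "'a::euclidean_space \<Rightarrow> real"
  assumes "smooth f" "0 \<le> s"
    and hom: "\<And>t y. 1 \<le> t \<Longrightarrow> 1 \<le> norm y \<Longrightarrow> f (t *\<^sub>R y) = t powr - (real DIM('a) + 2 * s) * f y"
  shows "f \<in> Ss s"
proof (rule Ss_memI[OF assms(1)])
  fix bs :: "'a list" assume bs: "set bs \<subseteq> Basis"
  define p where "p = real DIM('a) + 2 * s"
  have p: "0 \<le> p" using assms by (simp add: p_def)
  obtain M where M: "M > 0" "\<And>x. x \<in> cball 0 2 \<Longrightarrow> \<bar>partials bs f x\<bar> \<le> M"
    using smooth_bounded_on_compact[OF smooth_partials[OF assms(1) bs], of "cball 0 2"] by auto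
  have "(1 + norm x powr p) * \<bar>partials bs f x\<bar> \<le> 2 * (1 + 2 powr p) * M" for x
  proof (cases "norm x \<le> 2")
    case True
    then have "(1 + norm x powr p) * \<bar>partials bs f x\<bar> \<le> (1 + 2 powr p) * M"
      using M p by (intro mult_mono add_mono powr_mono2) auto
    also have "\<dots> \<le> 2 * (1 + 2 powr p) * M" using M by (simp add: algebra_simps)
    finally show ?thesis .
  next
    case False
    \<comment> \<open>Rescaling to the sphere of radius 2 rather than 1 keeps \<open>y\<close> in
      the interior of the region where \<open>hom\<close> applies; equality of derivatives needs an
      open neighbourhood.\<close>
    define t where "t = norm x / 2"
    define y where "y = x /\<^sub>R t"
    have t: "t > 1" using False by (simp add: t_def)
    then have y: "x = t *\<^sub>R y" "norm y = 2" using False by (auto simp: y_def t_def)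
    have "partials bs (\<lambda>y. f (0 + t *\<^sub>R y)) y = partials bs (\<lambda>y. t powr - p * f y + 0 * f y) y"
      by (rule partials_cong_open[of "- cball 0 1"]) (use y t hom in \<open>auto simp: p_def\<close>)
    then have "t ^ length bs * partials bs f x = t powr - p * partials bs f y"
      by (simp only: partials_affine[OF assms(1) bs] partials_lincomb[OF assms(1,1) bs]) (simp add: y)
    then have "t ^ length bs * \<bar>partials bs f x\<bar> = t powr - p * \<bar>partials bs f y\<bar>"
      using t by (metis abs_mult abs_of_nonneg order.strict_implies_order powr_ge_zero zero_le_power zero_less_one less_trans)
    moreover have "1 * \<bar>partials bs f x\<bar> \<le> t ^ length bs * \<bar>partials bs f x\<bar>"
      using t by (intro mult_right_mono) auto
    moreover have "t powr - p * \<bar>partials bs f y\<bar> \<le> t powr - p * M"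
      using M(2)[of y] y by (intro mult_left_mono) auto
    ultimately have "\<bar>partials bs f x\<bar> \<le> t powr - p * M" by linarith
    moreover have "1 + norm x powr p \<le> 2 * norm x powr p"
      using False p by (simp add: ge_one_powr_ge_zero)
    ultimately have "(1 + norm x powr p) * \<bar>partials bs f x\<bar> \<le> (2 * norm x powr p) * (t powr - p * M)"
      by (intro mult_mono) auto
    also have "\<dots> = 2 * (2 powr p * M)"
    proof -
      have "norm x powr p = t powr p * 2 powr p" unfolding t_def by (simp flip: powr_mult)
      then show ?thesis using t by (simp add: powr_minus)
    qed
    also have "\<dots> \<le> 2 * (1 + 2 powr p) * M" using M by (simp add: algebra_simps)
    finally show ?thesis .
  qed
  then show "\<exists>B. \<forall>x. (1 + norm x powr (real DIM('a) + 2 * s)) * \<bar>partials bs f x\<bar> \<le> B"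
    unfolding p_def by blast
qed

text \<open>For \<open>y\<close> in the support of \<open>w\<close> the weights at \<open>x\<close>
  and \<open>x - y\<close> are comparable, so the decay of \<open>g\<close> passes to the
  convolution. Besides its support, only the integral of \<open>\<bar>w y\<bar>\<close>
  enters.\<close>

lemma Ss_conv:
  fixes g w :: "'a::euclidean_space \<Rightarrow> real"
  assumes g: "g \<in> Ss s" and s: "0 \<le> s" and w: "integrable lborel w" "\<And>x. R < norm x \<Longrightarrow> w x = 0"
  shows "conv g w \<in> Ss s"
proof (rule Ss_memI)
  show "smooth (conv g w)" by (rule smooth_conv[OF Ss_bounded_smooth[OF g] w(1)])
  fix bs :: "'a list" assume bs: "set bs \<subseteq> Basis"
  define p where "p = real DIM('a) + 2 * s"
  have p: "0 \<le> p" using s by (simp add: p_def)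
  define A where "A = 1 + 2 powr p * (1 + R powr p)"
  have A: "0 \<le> A" by (simp add: A_def)
  obtain B where B: "\<And>x. (1 + norm x powr p) * \<bar>partials bs g x\<bar> \<le> B"
    using Ss_partial_bound[OF g bs] unfolding p_def by blast
  have bw: "(1 + norm x powr p) * \<bar>partials bs g (x - y) * w y\<bar> \<le> A * B * \<bar>w y\<bar>" for x y
  proof (cases "norm y \<le> R")
    case True
    have "1 + norm x powr p \<le> A * (1 + norm (x - y) powr p)"
      using weight_shift[OF p True, of "x - y"] by (simp add: A_def)
    then have "(1 + norm x powr p) * \<bar>partials bs g (x - y)\<bar> \<le> A * (1 + norm (x - y) powr p) * \<bar>partials bs g (x - y)\<bar>"
      by (intro mult_right_mono) auto
    also have "\<dots> \<le> A * B" using mult_left_mono[OF B A, of "x - y"] by (simp add: mult.assoc)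
    finally have "(1 + norm x powr p) * \<bar>partials bs g (x - y)\<bar> * \<bar>w y\<bar> \<le> A * B * \<bar>w y\<bar>"
      by (intro mult_right_mono) auto
    then show ?thesis by (simp add: abs_mult mult.assoc)
  qed (use w(2)[of y] in auto)
  have "(1 + norm x powr p) * \<bar>partials bs (conv g w) x\<bar> \<le> A * B * (LINT y|lborel. \<bar>w y\<bar>)" for x
  proof -
    have int: "integrable lborel (\<lambda>y. partials bs g (x - y) * w y)"
      by (intro integrable_conv w(1) bounded_smooth_partials[OF Ss_bounded_smooth[OF g] bs])
    have "(1 + norm x powr p) * \<bar>partials bs (conv g w) x\<bar>
        = \<bar>LINT y|lborel. (1 + norm x powr p) * (partials bs g (x - y) * w y)\<bar>"
      unfolding partials_conv[OF Ss_bounded_smooth[OF g] w(1) bs] conv_def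
      by (simp add: abs_mult)
    also have "\<dots> \<le> (LINT y|lborel. \<bar>(1 + norm x powr p) * (partials bs g (x - y) * w y)\<bar>)"
      by (rule integral_abs_bound)
    also have "\<dots> \<le> (LINT y|lborel. A * B * \<bar>w y\<bar>)"
      using bw w(1) by (intro integral_mono integrable_abs integrable_mult_right int) (auto simp: abs_mult)
    finally show ?thesis by simp
  qed
  then show "\<exists>B. \<forall>x. (1 + norm x powr (real DIM('a) + 2 * s)) * \<bar>partials bs (conv g w) x\<bar> \<le> B"
    unfolding p_def by blast
qed

lemma Ss_integrable:
  fixes \<phi> :: "'a::euclidean_space \<Rightarrow> real"
  assumes "\<phi> \<in> Ss s" "0 < s"
  shows "integrable lborel \<phi>"
proof -
  define p where "p = real DIM('a) + 2 * s"
  obtain B where B: "0 \<le> B" "Ss_bounded s 0 \<phi> B" by (rule Ss_bounded_ex[OF assms(1)])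
  have B': "(1 + norm x powr p) * \<bar>\<phi> x\<bar> \<le> B" for x
    using Ss_boundedD[OF B(2), of "[]" x] by (simp add: p_def)
  have "integrable lborel (\<lambda>x::'a. indicator (- ball 0 1) x * norm x powr - p)"
    using assms by (intro integrable_powr_outside) (auto simp: p_def)
  moreover have "integrable lborel (\<lambda>x::'a. indicator (ball 0 1) x :: real)"
    by (intro integrable_real_indicator emeasure_lborel_ball_finite) simp
  ultimately have "integrable lborel (\<lambda>x::'a. B * (indicator (- ball 0 1) x * norm x powr - p) + B * indicator (ball 0 1) x)"
    by auto
  then show ?thesis
  proof (rule Bochner_Integration.integrable_bound)
    show "\<phi> \<in> borel_measurable lborel" using smooth_borel[OF Ss_smooth[OF assms(1)]] by simp
    have "\<bar>\<phi> x\<bar> \<le> B * (indicator (- ball 0 1) x * norm x powr - p) + B * indicator (ball 0 1) x" for x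
    proof (cases "norm x < 1")
      case True
      have "1 * \<bar>\<phi> x\<bar> \<le> (1 + norm x powr p) * \<bar>\<phi> x\<bar>" by (intro mult_right_mono) auto
      with B'[of x] True show ?thesis by simp
    next
      case False
      then have "0 < norm x powr p" by auto
      moreover have "norm x powr p * \<bar>\<phi> x\<bar> \<le> (1 + norm x powr p) * \<bar>\<phi> x\<bar>" by (intro mult_right_mono) auto
      ultimately have "\<bar>\<phi> x\<bar> \<le> B / norm x powr p" using B'[of x] by (simp add: field_simps)
      with False show ?thesis by (simp add: powr_minus divide_inverse)
    qed
    then show "AE x in lborel. norm (\<phi> x) \<le> norm (B * (indicator (- ball 0 1) x * norm x powr - p) + B * indicator (ball 0 1) x)"
      by (intro AE_I2) (smt (verit) real_norm_def)
  qed
qed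

subsection \<open>The dual space\<close>

lemma Ss_seminorm_le:
  fixes \<phi> :: "'a::euclidean_space \<Rightarrow> real"
  assumes "Ss_bounded s N \<phi> B" "k \<le> N"
  shows "Ss_seminorm s k \<phi> \<le> real (card {bs. set bs \<subseteq> (Basis :: 'a set) \<and> length bs = k}) * B"
  unfolding Ss_seminorm_def
proof (rule cSUP_least)
  show "Ss_weighted s k \<phi> x \<le> real (card {bs. set bs \<subseteq> (Basis :: 'a set) \<and> length bs = k}) * B" for x
    using Ss_weighted_le[of k x s \<phi> "\<lambda>_. B"] Ss_boundedD[OF assms(1)] assms(2) by auto
qed simp

lemma Ss_seminorm_triangle:
  fixes \<phi> \<psi> :: "'a::euclidean_space \<Rightarrow> real"
  assumes "\<phi> \<in> Ss s" "\<psi> \<in> Ss s"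
  shows "Ss_seminorm s k (\<lambda>x. \<phi> x + \<psi> x) \<le> Ss_seminorm s k \<phi> + Ss_seminorm s k \<psi>"
  unfolding Ss_seminorm_def[of s k "\<lambda>x. \<phi> x + \<psi> x"]
proof (rule cSUP_least)
  fix x :: 'a
  let ?w = "1 + norm x powr (real DIM('a) + 2 * s)"
  have "norm_D k (\<lambda>x. \<phi> x + \<psi> x) x = L2_set (\<lambda>bs. partials bs \<phi> x + partials bs \<psi> x)
      {bs. set bs \<subseteq> (Basis :: 'a set) \<and> length bs = k}"
    unfolding norm_D_def
    using partials_lincomb[OF assms[THEN Ss_smooth], where a = 1 and c = 1] by (intro L2_set_cong) auto
  also have "\<dots> \<le> norm_D k \<phi> x + norm_D k \<psi> x"
    unfolding norm_D_def by (rule L2_set_triangle_ineq)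
  finally have "Ss_weighted s k (\<lambda>x. \<phi> x + \<psi> x) x \<le> ?w * (norm_D k \<phi> x + norm_D k \<psi> x)"
    unfolding Ss_weighted_def by (intro mult_left_mono) (auto simp: add_nonneg_nonneg)
  also have "\<dots> = Ss_weighted s k \<phi> x + Ss_weighted s k \<psi> x"
    by (simp add: Ss_weighted_def distrib_left)
  also have "\<dots> \<le> Ss_seminorm s k \<phi> + Ss_seminorm s k \<psi>"
    unfolding Ss_seminorm_def using assms by (intro add_mono cSUP_upper) (auto simp: Ss_def)
  finally show "Ss_weighted s k (\<lambda>x. \<phi> x + \<psi> x) x \<le> Ss_seminorm s k \<phi> + Ss_seminorm s k \<psi>" .
qed simp

definition Ss_nhd :: "real \<Rightarrow> nat \<Rightarrow> real \<Rightarrow> ('a::euclidean_space \<Rightarrow> real) \<Rightarrow> ('a \<Rightarrow> real) set" where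
  "Ss_nhd s N \<delta> \<phi> = {\<psi> \<in> Ss s. \<forall>k\<le>N. Ss_seminorm s k (\<lambda>x. \<psi> x - \<phi> x) < \<delta>}"

text \<open>Subbasic sets are seminorm balls about arbitrary centres. The triangle inequality
  recentres each at \<open>\<phi>\<close>, and finite intersections are absorbed by raising
  \<open>N\<close> and lowering \<open>\<delta>\<close>. Membership in \<open>Ss s\<close> comes
  along because every subbasic set lies in it.\<close>

lemma Ss_topology_nhd:
  fixes \<phi> :: "'a::euclidean_space \<Rightarrow> real"
  assumes "openin (Ss_topology s) U" "\<phi> \<in> U"
  shows "\<phi> \<in> Ss s \<and> (\<exists>N \<delta>. \<delta> > 0 \<and> Ss_nhd s N \<delta> \<phi> \<subseteq> U)"
proof -
  have "generate_topology_on {{\<psi> \<in> Ss s. Ss_seminorm s k (\<lambda>x. \<psi> x - \<phi> x) < r} | \<phi> k r. \<phi> \<in> Ss s \<and> r > 0} U"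
    using assms(1) unfolding Ss_topology_def by (rule openin_topology_generated_by)
  then show ?thesis using assms(2)
  proof (induction arbitrary: \<phi>)
    case Empty
    then show ?case by simp
  next
    case (Int U V)
    have "\<phi> \<in> U" "\<phi> \<in> V" using Int.prems by auto
    from Int.IH(1)[OF this(1)] Int.IH(2)[OF this(2)]
    obtain N1 d1 N2 d2 where *: "\<phi> \<in> Ss s" "d1 > 0" "d2 > 0" "Ss_nhd s N1 d1 \<phi> \<subseteq> U" "Ss_nhd s N2 d2 \<phi> \<subseteq> V"
      by blast
    have "Ss_nhd s (max N1 N2) (min d1 d2) \<phi> \<subseteq> Ss_nhd s N1 d1 \<phi> \<inter> Ss_nhd s N2 d2 \<phi>"
      unfolding Ss_nhd_def by (auto simp: le_max_iff_disj)
    with *(4,5) have "Ss_nhd s (max N1 N2) (min d1 d2) \<phi> \<subseteq> U \<inter> V" by blast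
    moreover have "min d1 d2 > 0" using *(2,3) by simp
    ultimately show ?case using *(1) by blast
  next
    case (UN K)
    then obtain k where k: "k \<in> K" "\<phi> \<in> k" by blast
    from UN.IH[OF this] have "\<phi> \<in> Ss s" "\<exists>N \<delta>. \<delta> > 0 \<and> Ss_nhd s N \<delta> \<phi> \<subseteq> k" by auto
    moreover have "k \<subseteq> \<Union>K" using k by blast
    ultimately show ?case by (meson subset_trans)
  next
    case (Basis U)
    then obtain \<phi>0 k r where U: "U = {\<psi> \<in> Ss s. Ss_seminorm s k (\<lambda>x. \<psi> x - \<phi>0 x) < r}" "\<phi>0 \<in> Ss s"
      by blast
    with Basis have \<phi>: "\<phi> \<in> Ss s" "Ss_seminorm s k (\<lambda>x. \<phi> x - \<phi>0 x) < r" by auto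
    \<comment> \<open>The slack that \<open>\<phi>\<close> leaves inside the ball about
      \<open>\<phi>0\<close>.\<close>
    define \<delta> where "\<delta> = r - Ss_seminorm s k (\<lambda>x. \<phi> x - \<phi>0 x)"
    have "\<psi> \<in> U" if "\<psi> \<in> Ss_nhd s k \<delta> \<phi>" for \<psi>
    proof -
      have \<psi>: "\<psi> \<in> Ss s" "Ss_seminorm s k (\<lambda>x. \<psi> x - \<phi> x) < \<delta>"
        using that by (auto simp: Ss_nhd_def)
      have "(\<lambda>x. \<psi> x - \<phi> x) \<in> Ss s" "(\<lambda>x. \<phi> x - \<phi>0 x) \<in> Ss s"
        using Ss_lincomb[OF \<psi>(1) \<phi>(1), of 1 "-1"] Ss_lincomb[OF \<phi>(1) U(2), of 1 "-1"] by simp_all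
      from Ss_seminorm_triangle[OF this, of k]
      have "Ss_seminorm s k (\<lambda>x. \<psi> x - \<phi>0 x) < r" using \<psi>(2) by (simp add: \<delta>_def)
      with \<psi>(1) U(1) show ?thesis by simp
    qed
    moreover have "\<delta> > 0" using \<phi>(2) by (simp add: \<delta>_def)
    ultimately show ?case using \<phi>(1) by blast
  qed
qed

lemma Ss_dual_lincomb:
  assumes "u \<in> Ss_dual s" "\<phi> \<in> Ss s" "\<psi> \<in> Ss s"
  shows "u (\<lambda>x. a * \<phi> x + b * \<psi> x) = a * u \<phi> + b * u \<psi>"
  using assms by (simp add: Ss_dual_def)

lemma Ss_dual_diff:
  assumes "u \<in> Ss_dual s" "\<phi> \<in> Ss s" "\<psi> \<in> Ss s"
  shows "u (\<lambda>x. \<phi> x - \<psi> x) = u \<phi> - u \<psi>"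
  using Ss_dual_lincomb[OF assms, of 1 "-1"] by simp

lemma zero_Ss: "0 \<le> s \<Longrightarrow> (\<lambda>_. 0) \<in> Ss s"
  by (rule compact_support_Ss[OF smooth_const, where R = 0]) auto

lemma Ss_bounded_scale:
  fixes \<phi> :: "'a::euclidean_space \<Rightarrow> real"
  assumes "\<phi> \<in> Ss s" "Ss_bounded s N \<phi> B" "0 \<le> t"
  shows "Ss_bounded s N (\<lambda>x. t * \<phi> x) (t * B)"
  unfolding Ss_bounded_def
proof (intro allI impI)
  fix bs :: "'a list" and x :: 'a assume b: "set bs \<subseteq> Basis \<and> length bs \<le> N"
  have "partials bs (\<lambda>x. t * \<phi> x) x = t * partials bs \<phi> x"
    using partials_lincomb[OF assms(1,1)[THEN Ss_smooth], of bs t 0] b by simp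
  then show "(1 + norm x powr (real DIM('a) + 2 * s)) * \<bar>partials bs (\<lambda>x. t * \<phi> x) x\<bar> \<le> t * B"
    using mult_left_mono[OF Ss_boundedD[OF assms(2), of bs x] assms(3)] b assms(3)
    by (simp add: abs_mult mult.left_commute)
qed

text \<open>A neighbourhood of zero on which \<open>\<bar>u \<phi>\<bar> < 1\<close> involves
  finitely many seminorms, and scaling turns this into a linear bound by derivatives up to one fixed
  order. Later limits of \<open>u\<close> rest on this bound and on linearity.\<close>

lemma Ss_dual_bound:
  fixes u :: "('a::euclidean_space \<Rightarrow> real) \<Rightarrow> real"
  assumes u: "u \<in> Ss_dual s" and s: "0 \<le> s"
  obtains M N where "0 < M" "\<forall>\<phi> B. \<phi> \<in> Ss s \<longrightarrow> 0 \<le> B \<longrightarrow> Ss_bounded s N \<phi> B \<longrightarrow> \<bar>u \<phi>\<bar> \<le> M * B"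
proof -
  let ?U = "{\<phi> \<in> topspace (Ss_topology s). u \<phi> \<in> ball 0 1}"
  have "continuous_map (Ss_topology s) euclideanreal u" using u by (simp add: Ss_dual_def)
  then have "openin (Ss_topology s) ?U"
    by (rule openin_continuous_map_preimage) simp
  moreover have "(\<lambda>_. 0) \<in> ?U"
  proof -
    have "Ss_bounded s 0 (\<lambda>_::'a. 0) 0" by (simp add: Ss_bounded_def)
    from Ss_seminorm_le[OF this, of 0] have "Ss_seminorm s 0 (\<lambda>x::'a. 0 - 0) < 1" by simp
    then have "(\<lambda>_. 0) \<in> {\<psi> \<in> Ss s. Ss_seminorm s 0 (\<lambda>x::'a. \<psi> x - 0) < 1}"
      using zero_Ss[OF s] by simp
    moreover have "openin (Ss_topology s) {\<psi> \<in> Ss s. Ss_seminorm s 0 (\<lambda>x::'a. \<psi> x - (\<lambda>_. 0) x) < 1}"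
      unfolding Ss_topology_def
      by (rule topology_generated_by_Basis, rule CollectI, intro exI conjI, rule refl)
        (simp_all add: zero_Ss s)
    ultimately have "(\<lambda>_. 0) \<in> topspace (Ss_topology s :: ('a \<Rightarrow> real) topology)"
      by (intro subsetD[OF openin_subset])
    moreover have "u (\<lambda>_. 0) = 0"
      using Ss_dual_lincomb[OF u zero_Ss[OF s] zero_Ss[OF s], of 0 0] by simp
    ultimately show ?thesis by simp
  qed
  ultimately have "\<exists>N \<delta>. \<delta> > 0 \<and> Ss_nhd s N \<delta> (\<lambda>_. 0) \<subseteq> ?U"
    by (rule Ss_topology_nhd[THEN conjunct2])
  then obtain N \<delta> where
    N: "\<delta> > 0" "Ss_nhd s N \<delta> (\<lambda>_. 0) \<subseteq> ?U"
    by blast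
  have \<delta>: "\<delta> > 0"
    "\<And>\<psi>. \<psi> \<in> Ss s \<Longrightarrow> (\<And>k. k \<le> N \<Longrightarrow> Ss_seminorm s k (\<lambda>x. \<psi> x - 0) < \<delta>) \<Longrightarrow> \<psi> \<in> ?U"
    using N by (auto simp: Ss_nhd_def)
  \<comment> \<open>\<open>c\<close> exceeds the number of partial derivatives of each order up to
    \<open>N\<close>, which is the factor lost between \<open>Ss_bounded\<close> and the seminorms;
    the summand 1 makes it positive.\<close>
  define c where "c = 1 + (\<Sum>k\<le>N. real (card {bs. set bs \<subseteq> (Basis :: 'a set) \<and> length bs = k}))"
  have c: "c > 0" unfolding c_def by (intro add_pos_nonneg sum_nonneg) auto
  have bound: "\<bar>u \<phi>\<bar> \<le> (2 * c / \<delta>) * B" if \<phi>: "\<phi> \<in> Ss s" "0 < B" "Ss_bounded s N \<phi> B" for \<phi> B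
  proof -
    \<comment> \<open>Makes \<open>c * (t * B)\<close> equal to \<open>\<delta> / 2\<close>,
      strictly inside the neighbourhood.\<close>
    define t where "t = \<delta> / (2 * c * B)"
    have t: "t > 0" using \<delta>(1) c that by (simp add: t_def)
    have t\<phi>: "(\<lambda>x. t * \<phi> x) \<in> Ss s" using Ss_lincomb[OF \<phi>(1,1), of t 0] by simp
    have "(\<lambda>x. t * \<phi> x) \<in> ?U"
    proof (rule \<delta>(2)[OF t\<phi>])
      fix k assume k: "k \<le> N"
      have "Ss_seminorm s k (\<lambda>x. t * \<phi> x) \<le> real (card {bs. set bs \<subseteq> (Basis :: 'a set) \<and> length bs = k}) * (t * B)"
        using Ss_seminorm_le[OF Ss_bounded_scale[OF \<phi>(1,3)] k] t by simp
      also have "\<dots> \<le> c * (t * B)"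
      proof (rule mult_right_mono)
        have "real (card {bs. set bs \<subseteq> (Basis :: 'a set) \<and> length bs = k}) \<le> c - 1"
          unfolding c_def using k member_le_sum[of k "{..N}" "\<lambda>k. real (card {bs. set bs \<subseteq> (Basis :: 'a set) \<and> length bs = k})"] by simp
        then show "real (card {bs. set bs \<subseteq> (Basis :: 'a set) \<and> length bs = k}) \<le> c" by simp
      qed (use t \<phi> in simp)
      also have "\<dots> < \<delta>" using c \<phi>(2) \<delta>(1) by (simp add: t_def)
      finally show "Ss_seminorm s k (\<lambda>x. t * \<phi> x - 0) < \<delta>" by simp
    qed
    moreover have "u (\<lambda>x. t * \<phi> x) = t * u \<phi>"
      using Ss_dual_lincomb[OF u \<phi>(1,1), of t 0] by simp
    ultimately have "t * \<bar>u \<phi>\<bar> < 1" using t by (simp add: abs_mult)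
    then show ?thesis using \<delta>(1) c \<phi>(2) by (simp add: t_def field_simps)
  qed
  have M: "0 < 2 * c / \<delta>" using c \<delta>(1) by simp
  show ?thesis
  proof (rule that[OF M], intro allI impI)
    fix \<phi> :: "'a \<Rightarrow> real" and B assume \<phi>: "\<phi> \<in> Ss s" "0 \<le> B" "Ss_bounded s N \<phi> B"
    show "\<bar>u \<phi>\<bar> \<le> 2 * c / \<delta> * B"
    proof (rule field_le_epsilon)
      \<comment> \<open>The scaling above divides by \<open>B\<close>, so the case
        \<open>B = 0\<close> is reached by enlarging \<open>B\<close> by an arbitrarily small
        amount.\<close>
      fix e :: real assume e: "0 < e"
      have "Ss_bounded s N \<phi> (B + e / (2 * c / \<delta>))"
        unfolding Ss_bounded_def
      proof (intro allI impI)
        fix bs :: "'a list" and x :: 'a assume b: "set bs \<subseteq> Basis \<and> length bs \<le> N"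
        have "(1 + norm x powr (real DIM('a) + 2 * s)) * \<bar>partials bs \<phi> x\<bar> \<le> B"
          using Ss_boundedD[OF \<phi>(3)] b by blast
        also have "B \<le> B + e / (2 * c / \<delta>)" using e c \<delta>(1) by simp
        finally show "(1 + norm x powr (real DIM('a) + 2 * s)) * \<bar>partials bs \<phi> x\<bar> \<le> B + e / (2 * c / \<delta>)" .
      qed
      moreover have "0 < B + e / (2 * c / \<delta>)" using \<phi>(2) divide_pos_pos[OF e M] by linarith
      ultimately have "\<bar>u \<phi>\<bar> \<le> 2 * c / \<delta> * (B + e / (2 * c / \<delta>))" using bound[OF \<phi>(1)] by blast
      also have "\<dots> = 2 * c / \<delta> * B + e"
        unfolding distrib_left using c \<delta>(1) by simp
      finally show "\<bar>u \<phi>\<bar> \<le> 2 * c / \<delta> * B + e" .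
    qed
  qed
qed

section \<open>Continuity of the pairing under translation\<close>

lemma mult_le_trans:
  fixes w :: real
  assumes "w \<le> A * v" "v * t \<le> B" "0 \<le> t" "0 \<le> A"
  shows "w * t \<le> A * B"
proof -
  have "w * t \<le> (A * v) * t" using assms by (intro mult_right_mono)
  also have "\<dots> = A * (v * t)" by simp
  also have "\<dots> \<le> A * B" using assms by (intro mult_left_mono)
  finally show ?thesis .
qed

lemma partials_translate:
  assumes "smooth g" "set bs \<subseteq> Basis"
  shows "partials bs (\<lambda>y. g (y - x)) = (\<lambda>y. partials bs g (y - x))"
  using partials_affine[OF assms, of "- x" 1] by simp

text \<open>The mean value inequality is applied along the segment from \<open>y - x\<close> to
  \<open>y - x'\<close>, which stays in the ball of radius \<open>R\<close> about \<open>y\<close>;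
  the weight there is comparable to its value at \<open>y\<close>.\<close>

lemma Ss_translate_lipschitz:
  fixes g :: "'a::euclidean_space \<Rightarrow> real"
  assumes g: "g \<in> Ss s" and s: "0 \<le> s"
  obtains C where "0 \<le> C" "\<forall>bs x x' y. set bs \<subseteq> Basis \<longrightarrow> length bs \<le> N \<longrightarrow> norm x \<le> R \<longrightarrow> norm x' \<le> R \<longrightarrow>
    (1 + norm y powr (real DIM('a) + 2 * s)) * \<bar>partials bs g (y - x) - partials bs g (y - x')\<bar> \<le> C * norm (x - x')"
proof -
  define p where "p = real DIM('a) + 2 * s"
  have p: "0 \<le> p" using s by (simp add: p_def)
  define A where "A = 1 + 2 powr p * (1 + R powr p)"
  have A: "0 \<le> A" by (simp add: A_def)
  \<comment> \<open>One order more than \<open>N\<close>, for the derivative that the mean value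
    inequality consumes.\<close>
  obtain B where B: "0 \<le> B" "Ss_bounded s (Suc N) g B" by (rule Ss_bounded_ex[OF g])
  have lip: "(1 + norm y powr p) * \<bar>partials bs g (y - x) - partials bs g (y - x')\<bar> \<le> (real DIM('a) * (B * A)) * norm (x - x')"
    if bs: "set bs \<subseteq> Basis" "length bs \<le> N" and x: "norm x \<le> R" "norm x' \<le> R" for bs x x' and y :: 'a
  proof -
    let ?W = "1 + norm y powr p"
    have W: "0 < ?W" by (simp add: add_pos_nonneg)
    have "\<bar>partials bs g (y - x) - partials bs g (y - x')\<bar> \<le> real DIM('a) * (B * A / ?W) * norm ((y - x) - (y - x'))"
    proof (rule smooth_lipschitz[where S = "cball y R"])
      show "smooth (partials bs g)" using g bs by (simp add: Ss_smooth smooth_partials)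
      fix b z :: 'a assume b: "b \<in> Basis" "z \<in> cball y R"
      have "?W \<le> A * (1 + norm z powr p)"
        using weight_shift[OF p, of "y - z" R z] b by (simp add: A_def dist_norm)
      moreover have "(1 + norm z powr p) * \<bar>partials [b] (partials bs g) z\<bar> \<le> B"
        using Ss_boundedD[OF B(2), of "b # bs" z] b bs by (simp add: p_def)
      ultimately have "?W * \<bar>partials [b] (partials bs g) z\<bar> \<le> A * B"
        using A by (intro mult_le_trans) auto
      with W show "\<bar>partials [b] (partials bs g) z\<bar> \<le> B * A / ?W"
        by (simp add: field_simps)
    qed (use x in \<open>auto simp: dist_norm\<close>)
    also have "norm ((y - x) - (y - x')) = norm (x - x')" by (simp add: norm_minus_commute)
    finally have "?W * \<bar>partials bs g (y - x) - partials bs g (y - x')\<bar> \<le> ?W * (real DIM('a) * (B * A / ?W) * norm (x - x'))"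
      using W by (intro mult_left_mono) auto
    then show ?thesis using W by simp
  qed
  show ?thesis
  proof (rule that)
    show "0 \<le> real DIM('a) * (B * A)" using A B(1) by simp
    show "\<forall>bs x x' y. set bs \<subseteq> Basis \<longrightarrow> length bs \<le> N \<longrightarrow> norm x \<le> R \<longrightarrow> norm x' \<le> R \<longrightarrow>
      (1 + norm y powr (real DIM('a) + 2 * s)) * \<bar>partials bs g (y - x) - partials bs g (y - x')\<bar>
        \<le> real DIM('a) * (B * A) * norm (x - x')"
      using lip unfolding p_def by blast
  qed
qed

lemma Ss_dual_translate_lipschitz:
  fixes u :: "('a::euclidean_space \<Rightarrow> real) \<Rightarrow> real"
  assumes u: "u \<in> Ss_dual s" and g: "g \<in> Ss s" and s: "0 \<le> s"
  obtains C where "0 \<le> C" "\<forall>x x'. norm x \<le> R \<longrightarrow> norm x' \<le> R \<longrightarrow>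
    \<bar>u (\<lambda>y. g (y - x)) - u (\<lambda>y. g (y - x'))\<bar> \<le> C * norm (x - x')"
proof -
  obtain M N where M: "0 < M" "\<forall>\<phi> B. \<phi> \<in> Ss s \<longrightarrow> 0 \<le> B \<longrightarrow> Ss_bounded s N \<phi> B \<longrightarrow> \<bar>u \<phi>\<bar> \<le> M * B"
    by (rule Ss_dual_bound[OF u s])
  obtain C where C: "0 \<le> C" "\<forall>bs x x' y. set bs \<subseteq> Basis \<longrightarrow> length bs \<le> N \<longrightarrow> norm x \<le> R \<longrightarrow> norm x' \<le> R \<longrightarrow>
    (1 + norm y powr (real DIM('a) + 2 * s)) * \<bar>partials bs g (y - x) - partials bs g (y - x')\<bar> \<le> C * norm (x - x')"
    by (rule Ss_translate_lipschitz[OF g s, of N R])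
  have lip: "\<bar>u (\<lambda>y. g (y - x)) - u (\<lambda>y. g (y - x'))\<bar> \<le> (M * C) * norm (x - x')"
    if x: "norm x \<le> R" "norm x' \<le> R" for x x'
  proof -
    note tr = Ss_translate[OF g s]
    have eq: "partials bs (\<lambda>y. g (y - x) - g (y - x')) = (\<lambda>y. partials bs g (y - x) - partials bs g (y - x'))"
      if "set bs \<subseteq> Basis" for bs
      using partials_lincomb[OF tr[THEN Ss_smooth] tr[THEN Ss_smooth] that, of 1 x "-1" x']
      by (simp add: partials_translate[OF Ss_smooth[OF g] that])
    have "Ss_bounded s N (\<lambda>y. g (y - x) - g (y - x')) (C * norm (x - x'))"
      unfolding Ss_bounded_def
    proof (intro allI impI)
      fix bs :: "'a list" and y :: 'a assume b: "set bs \<subseteq> Basis \<and> length bs \<le> N"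
      show "(1 + norm y powr (real DIM('a) + 2 * s)) * \<bar>partials bs (\<lambda>y. g (y - x) - g (y - x')) y\<bar> \<le> C * norm (x - x')"
        unfolding eq[OF conjunct1[OF b]] using C(2) x b by blast
    qed
    then have "\<bar>u (\<lambda>y. g (y - x) - g (y - x'))\<bar> \<le> M * (C * norm (x - x'))"
      using Ss_lincomb[OF tr tr, of 1 x "-1" x'] C(1) by (intro M(2)[rule_format]) simp_all
    then show ?thesis using Ss_dual_diff[OF u tr tr] by simp
  qed
  show ?thesis
  proof (rule that)
    show "0 \<le> M * C" using M(1) C(1) by simp
    show "\<forall>x x'. norm x \<le> R \<longrightarrow> norm x' \<le> R \<longrightarrow>
        \<bar>u (\<lambda>y. g (y - x)) - u (\<lambda>y. g (y - x'))\<bar> \<le> M * C * norm (x - x')"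
      by (intro allI impI lip)
  qed
qed

lemma Ss_dual_translate_continuous:
  fixes u :: "('a::euclidean_space \<Rightarrow> real) \<Rightarrow> real"
  assumes u: "u \<in> Ss_dual s" and g: "g \<in> Ss s" and s: "0 \<le> s"
  shows "continuous_on UNIV (\<lambda>x. u (\<lambda>y. g (y - x)))"
proof -
  have "isCont (\<lambda>x. u (\<lambda>y. g (y - x))) a" for a
  proof -
    obtain C where C: "0 \<le> C" "\<forall>x x'. norm x \<le> norm a + 1 \<longrightarrow> norm x' \<le> norm a + 1 \<longrightarrow>
      \<bar>u (\<lambda>y. g (y - x)) - u (\<lambda>y. g (y - x'))\<bar> \<le> C * norm (x - x')"
      by (rule Ss_dual_translate_lipschitz[OF u g s, of "norm a + 1"])
    have "C-lipschitz_on (ball a 1) (\<lambda>x. u (\<lambda>y. g (y - x)))"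
    proof (rule lipschitz_onI)
      fix x x' assume x: "x \<in> ball a 1" "x' \<in> ball a 1"
      have "norm z \<le> norm a + 1" if "z \<in> ball a 1" for z
        using norm_triangle_sub[of z a] that by (simp add: dist_norm norm_minus_commute)
      with x have "norm x \<le> norm a + 1" "norm x' \<le> norm a + 1" by blast+
      then show "dist (u (\<lambda>y. g (y - x))) (u (\<lambda>y. g (y - x'))) \<le> C * dist x x'"
        using C(2) by (simp add: dist_norm)
    qed (rule C)
    from lipschitz_on_continuous_on[OF this] show ?thesis
      by (simp add: continuous_on_eq_continuous_at)
  qed
  then show ?thesis by (simp add: continuous_on_eq_continuous_at)
qed

section \<open>Interchange of the functional with an integral\<close>

lemma Ss_sum:
  assumes "finite X" "\<And>a. a \<in> X \<Longrightarrow> \<phi> a \<in> Ss s" "0 \<le> s"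
  shows "(\<lambda>y. \<Sum>a\<in>X. c a * \<phi> a y) \<in> Ss s"
  using assms(1,2)
proof (induction X)
  case (insert a X)
  then show ?case using Ss_lincomb[of "\<phi> a" s "\<lambda>y. \<Sum>a\<in>X. c a * \<phi> a y" "c a" 1] by simp
qed (simp add: zero_Ss assms(3))

lemma Ss_dual_sum:
  assumes "u \<in> Ss_dual s" "finite X" "\<And>a. a \<in> X \<Longrightarrow> \<phi> a \<in> Ss s" "0 \<le> s"
  shows "u (\<lambda>y. \<Sum>a\<in>X. c a * \<phi> a y) = (\<Sum>a\<in>X. c a * u (\<phi> a))"
  using assms(2,3)
proof (induction X)
  case (insert a X)
  have "u (\<lambda>y. c a * \<phi> a y + 1 * (\<Sum>a\<in>X. c a * \<phi> a y)) = c a * u (\<phi> a) + 1 * u (\<lambda>y. \<Sum>a\<in>X. c a * \<phi> a y)"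
    using insert by (intro Ss_dual_lincomb[OF assms(1)] Ss_sum assms(4)) auto
  then show ?case using insert by simp
next
  case empty
  show ?case using Ss_dual_lincomb[OF assms(1) zero_Ss zero_Ss, of 0 0] assms(4) by simp
qed

lemma partials_sum:
  assumes "finite X" "\<And>a. a \<in> X \<Longrightarrow> \<phi> a \<in> Ss s" "0 \<le> s" "set bs \<subseteq> Basis"
  shows "partials bs (\<lambda>y. \<Sum>a\<in>X. c a * \<phi> a y) = (\<lambda>y. \<Sum>a\<in>X. c a * partials bs (\<phi> a) y)"
  using assms(1,2)
proof (induction X)
  case (insert a X)
  have "partials bs (\<lambda>y. c a * \<phi> a y + 1 * (\<Sum>a\<in>X. c a * \<phi> a y))
      = (\<lambda>y. c a * partials bs (\<phi> a) y + 1 * partials bs (\<lambda>y. \<Sum>a\<in>X. c a * \<phi> a y) y)"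
  proof (rule partials_lincomb[OF _ _ assms(4)])
    show "smooth (\<phi> a)" using insert.prems by (intro Ss_smooth[where s = s]) simp
    show "smooth (\<lambda>y. \<Sum>a\<in>X. c a * \<phi> a y)"
      using insert by (intro Ss_smooth[where s = s] Ss_sum assms(3)) auto
  qed
  then show ?case using insert by simp
qed (use partials_zero_set[of UNIV "\<lambda>_. 0"] in auto)

text \<open>Successive case distinctions over the net select a nearby point measurably. The value
  \<open>0\<close> is the default away from the balls of the net, hence
  \<open>insert 0 X\<close>.\<close>

lemma finite_valued_approximation:
  fixes X :: "'a::euclidean_space set"
  assumes "finite X"
  shows "\<exists>p. p \<in> borel_measurable borel \<and> range p \<subseteq> insert 0 X \<and> (\<forall>x\<in>(\<Union>a\<in>X. ball a \<delta>). dist x (p x) < \<delta>)"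
  using assms
proof (induction X)
  case empty
  then show ?case by (intro exI[of _ "\<lambda>_. 0"]) auto
next
  case (insert a X)
  then obtain p where p: "p \<in> borel_measurable borel" "range p \<subseteq> insert 0 X"
      "\<forall>x\<in>(\<Union>a\<in>X. ball a \<delta>). dist x (p x) < \<delta>"
    using insert.IH by blast
  have "(\<lambda>x. if x \<in> ball a \<delta> then a else p x) \<in> borel_measurable borel"
    using p(1) by (intro measurable_If_set) auto
  moreover have "range (\<lambda>x. if x \<in> ball a \<delta> then a else p x) \<subseteq> insert 0 (insert a X)"
    using p(2) by auto
  ultimately show ?case
    using p(3) by (intro exI[of _ "\<lambda>x. if x \<in> ball a \<delta> then a else p x"]) (auto simp: dist_commute)
qed

text \<open>With a finite-valued argument the integral becomes a finite sum, through which
  \<open>u\<close> and the partial derivatives pass by linearity.\<close>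

lemma integral_finite_valued:
  fixes p :: "'a::euclidean_space \<Rightarrow> 'a" and G :: "'a \<Rightarrow> real"
  assumes "integrable lborel w" "p \<in> borel_measurable borel" "finite X" "range p \<subseteq> X"
  shows "integrable lborel (\<lambda>x. G (p x) * w x)"
    and "(LINT x|lborel. G (p x) * w x) = (\<Sum>a\<in>X. G a * (LINT x|lborel. indicator (p -` {a}) x * w x))"
proof -
  have eq: "G (p x) * w x = (\<Sum>a\<in>X. G a * (indicator (p -` {a}) x * w x))" for x
  proof -
    have "(\<Sum>a\<in>X. G a * (indicator (p -` {a}) x * w x)) = (\<Sum>a\<in>X. if p x = a then G a * w x else 0)"
      by (intro sum.cong) (auto simp: indicator_def)
    also have "\<dots> = G (p x) * w x" using assms(3,4) by (subst sum.delta') auto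
    finally show ?thesis by simp
  qed
  have int: "integrable lborel (\<lambda>x. indicator (p -` {a}) x * w x)" for a
  proof -
    have "p -` {a} \<in> sets lborel" using measurable_sets[OF assms(2), of "{a}"] by simp
    then show ?thesis using integrable_mult_indicator[OF _ assms(1), of "p -` {a}"] by simp
  qed
  show "integrable lborel (\<lambda>x. G (p x) * w x)" unfolding eq using int by auto
  show "(LINT x|lborel. G (p x) * w x) = (\<Sum>a\<in>X. G a * (LINT x|lborel. indicator (p -` {a}) x * w x))"
    unfolding eq using int by (subst Bochner_Integration.integral_sum) auto
qed

text \<open>Both sides are limits of the same finite sums, obtained by rounding \<open>x\<close> to a finite net.\<close>

lemma Ss_dual_conv:
  fixes u :: "('a::euclidean_space \<Rightarrow> real) \<Rightarrow> real"
  assumes u: "u \<in> Ss_dual s" and g: "g \<in> Ss s" and s: "0 \<le> s"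
    and w: "integrable lborel w" "\<And>x. R < norm x \<Longrightarrow> w x = 0"
  shows "u (conv g w) = (LINT x|lborel. u (\<lambda>y. g (y - x)) * w x)"
proof -
  let ?F = "\<lambda>x. u (\<lambda>y. g (y - x))"
  let ?I = "LINT x|lborel. \<bar>w x\<bar>"
  \<comment> \<open>The origin has to lie in the ball of radius \<open>R'\<close> even for negative
    \<open>R\<close>, since it is the default value of the rounding map below.\<close>
  define R' where "R' = max R 0"
  have R': "w x = 0" if "R' < norm x" for x using w(2) that by (simp add: R'_def)
  obtain M N where M: "0 < M" "\<forall>\<phi> B. \<phi> \<in> Ss s \<longrightarrow> 0 \<le> B \<longrightarrow> Ss_bounded s N \<phi> B \<longrightarrow> \<bar>u \<phi>\<bar> \<le> M * B"
    by (rule Ss_dual_bound[OF u s])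
  obtain C where C: "0 \<le> C" "\<forall>bs x x' y. set bs \<subseteq> Basis \<longrightarrow> length bs \<le> N \<longrightarrow> norm x \<le> R' \<longrightarrow> norm x' \<le> R' \<longrightarrow>
    (1 + norm y powr (real DIM('a) + 2 * s)) * \<bar>partials bs g (y - x) - partials bs g (y - x')\<bar> \<le> C * norm (x - x')"
    by (rule Ss_translate_lipschitz[OF g s, of N R'])
  obtain C' where C': "0 \<le> C'" "\<forall>x x'. norm x \<le> R' \<longrightarrow> norm x' \<le> R' \<longrightarrow> \<bar>?F x - ?F x'\<bar> \<le> C' * norm (x - x')"
    by (rule Ss_dual_translate_lipschitz[OF u g s, of R'])
  have Fm: "?F \<in> borel_measurable borel"
    by (intro borel_measurable_continuous_onI Ss_dual_translate_continuous[OF u g s])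
  \<comment> \<open>The rounding error is estimated once for a general Lipschitz integrand and used
    twice: for the scalar function \<open>?F\<close>, and for each partial derivative of
    \<open>g\<close> at a fixed \<open>y\<close>, where the Lipschitz constant carries the inverse
    weight.\<close>
  have err: "integrable lborel (\<lambda>x. G x * w x)"
      "\<bar>(LINT x|lborel. G x * w x) - (LINT x|lborel. G (p x) * w x)\<bar> \<le> L * \<delta> * ?I"
    if "0 \<le> L" "0 < \<delta>" and G: "G \<in> borel_measurable borel"
      "\<And>x x'. norm x \<le> R' \<Longrightarrow> norm x' \<le> R' \<Longrightarrow> \<bar>G x - G x'\<bar> \<le> L * norm (x - x')"
      and p: "p \<in> borel_measurable borel" "finite X" "range p \<subseteq> X" "X \<subseteq> cball 0 R'"
        "\<And>x. x \<in> cball 0 R' \<Longrightarrow> dist x (p x) < \<delta>"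
    for G :: "'a \<Rightarrow> real" and p L \<delta> X
  proof -
    have b: "\<bar>(G x - G (p x)) * w x\<bar> \<le> L * \<delta> * \<bar>w x\<bar>" for x
    proof (cases "norm x \<le> R'")
      case True
      have "p x \<in> cball 0 R'" using p(3,4) by blast
      then have "\<bar>G x - G (p x)\<bar> \<le> L * norm (x - p x)" using True by (intro G(2)) auto
      also have "\<dots> \<le> L * \<delta>" using p(5)[of x] True that(1) by (intro mult_left_mono) (auto simp: dist_norm)
      finally show ?thesis by (simp add: abs_mult mult_right_mono)
    qed (use R'[of x] in auto)
    have Gp: "integrable lborel (\<lambda>x. G (p x) * w x)" by (rule integral_finite_valued[OF w(1) p(1-3)])
    have "(\<lambda>x. G (p x) * w x) \<in> borel_measurable lborel" using Gp by (rule borel_measurable_integrable)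
    then have dm: "(\<lambda>x. (G x - G (p x)) * w x) \<in> borel_measurable lborel"
      unfolding left_diff_distrib using G(1) w(1) by auto
    have d: "integrable lborel (\<lambda>x. (G x - G (p x)) * w x)"
    proof (rule Bochner_Integration.integrable_bound)
      show "integrable lborel (\<lambda>x. L * \<delta> * \<bar>w x\<bar>)" using w(1) by auto
    qed (use b dm that in \<open>auto intro!: AE_I2 simp: abs_mult\<close>)
    have "integrable lborel (\<lambda>x. (G x - G (p x)) * w x + G (p x) * w x)" using d Gp by (rule Bochner_Integration.integrable_add)
    then show i: "integrable lborel (\<lambda>x. G x * w x)" by (simp add: algebra_simps)
    have "(LINT x|lborel. G x * w x) - (LINT x|lborel. G (p x) * w x) = (LINT x|lborel. (G x - G (p x)) * w x)"
      using i Gp by (simp add: left_diff_distrib)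
    also have "\<bar>\<dots>\<bar> \<le> (LINT x|lborel. \<bar>(G x - G (p x)) * w x\<bar>)" by (rule integral_abs_bound)
    also have "\<dots> \<le> (LINT x|lborel. L * \<delta> * \<bar>w x\<bar>)"
      using d w(1) b by (intro integral_mono integrable_abs integrable_mult_right) auto
    finally show "\<bar>(LINT x|lborel. G x * w x) - (LINT x|lborel. G (p x) * w x)\<bar> \<le> L * \<delta> * ?I" by simp
  qed
  have I: "0 \<le> ?I" by simp
  have key: "\<bar>u (conv g w) - (LINT x|lborel. ?F x * w x)\<bar> \<le> (M * C + C') * ?I * \<delta>" if \<delta>: "0 < \<delta>" for \<delta>
  proof -
    obtain X0 :: "'a set" where X0: "finite X0" "X0 \<subseteq> cball 0 R'" "cball 0 R' \<subseteq> (\<Union>a\<in>X0. ball a \<delta>)"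
    proof (rule compactE_image[OF compact_cball[of "0::'a" R'], of "cball 0 R'" "\<lambda>a. ball a \<delta>"])
      show "cball 0 R' \<subseteq> (\<Union>a\<in>cball (0::'a) R'. ball a \<delta>)" using \<delta> by force
      fix D assume D: "D \<subseteq> cball (0::'a) R'" "finite D" "cball 0 R' \<subseteq> (\<Union>a\<in>D. ball a \<delta>)"
      show thesis by (rule that[OF D(2,1,3)])
    qed simp
    obtain p where p: "p \<in> borel_measurable borel" "range p \<subseteq> insert 0 X0" "\<forall>x\<in>(\<Union>a\<in>X0. ball a \<delta>). dist x (p x) < \<delta>"
      using finite_valued_approximation[OF X0(1), of \<delta>] by blast
    define X where "X = insert 0 X0"
    have X: "finite X" "range p \<subseteq> X" "X \<subseteq> cball 0 R'" using X0 p by (auto simp: X_def R'_def)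
    have pd: "\<And>x. x \<in> cball 0 R' \<Longrightarrow> dist x (p x) < \<delta>" using p(3) X0(3) by blast
    define c where "c a = (LINT x|lborel. indicator (p -` {a}) x * w x)" for a
    let ?S = "\<lambda>y. \<Sum>a\<in>X. c a * g (y - a)"
    have S: "?S \<in> Ss s" using X by (intro Ss_sum Ss_translate g s)
    have cv: "conv g w \<in> Ss s" by (rule Ss_conv[OF g s w])
    have uS: "u ?S = (LINT x|lborel. ?F (p x) * w x)"
      using Ss_dual_sum[OF u X(1) _ s, of "\<lambda>a y. g (y - a)" c] Ss_translate[OF g s]
      unfolding integral_finite_valued(2)[OF w(1) p(1) X(1,2), of ?F] by (simp add: c_def mult.commute)
    have "Ss_bounded s N (\<lambda>y. conv g w y - ?S y) (C * \<delta> * ?I)"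
      unfolding Ss_bounded_def
    proof (intro allI impI)
      fix bs :: "'a list" and y :: 'a assume b: "set bs \<subseteq> Basis \<and> length bs \<le> N"
      let ?W = "1 + norm y powr (real DIM('a) + 2 * s)"
      have W: "0 < ?W" by (simp add: add_pos_nonneg)
      have g': "smooth (partials bs g)" using b by (intro smooth_partials Ss_smooth[OF g]) auto
      have "partials bs ?S y = (\<Sum>a\<in>X. c a * partials bs g (y - a))"
        using partials_sum[OF X(1) Ss_translate[OF g s] s, of bs c "\<lambda>a. a"] b
        by (simp add: partials_translate[OF Ss_smooth[OF g]])
      also have "\<dots> = (LINT x|lborel. partials bs g (y - p x) * w x)"
        using integral_finite_valued(2)[OF w(1) p(1) X(1,2), of "\<lambda>a. partials bs g (y - a)"]
        by (simp add: c_def mult.commute)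
      finally have "partials bs (\<lambda>y. conv g w y - ?S y) y
         = (LINT x|lborel. partials bs g (y - x) * w x) - (LINT x|lborel. partials bs g (y - p x) * w x)"
        using partials_lincomb[OF cv[THEN Ss_smooth] S[THEN Ss_smooth], of bs 1 "-1"] b
          partials_conv[OF Ss_bounded_smooth[OF g] w(1), of bs] by (simp add: conv_def)
      also have "\<bar>\<dots>\<bar> \<le> (C / ?W) * \<delta> * ?I"
      proof (rule err(2)[OF _ \<delta> _ _ p(1) X pd])
        show "0 \<le> C / ?W" using C(1) W by simp
        show "(\<lambda>x. partials bs g (y - x)) \<in> borel_measurable borel"
          using smooth_borel[OF g'] by measurable
        show "\<bar>partials bs g (y - x) - partials bs g (y - x')\<bar> \<le> C / ?W * norm (x - x')"
          if "norm x \<le> R'" "norm x' \<le> R'" for x x'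
          using C(2)[rule_format, of bs x x' y] b that W by (simp add: field_simps)
      qed
      finally have "?W * \<bar>partials bs (\<lambda>y. conv g w y - ?S y) y\<bar> \<le> ?W * ((C / ?W) * \<delta> * ?I)"
        using W by (intro mult_left_mono) auto
      also have "\<dots> = C * \<delta> * ?I" using W by simp
      finally show "?W * \<bar>partials bs (\<lambda>y. conv g w y - ?S y) y\<bar> \<le> C * \<delta> * ?I" .
    qed
    then have "\<bar>u (\<lambda>y. conv g w y - ?S y)\<bar> \<le> M * (C * \<delta> * ?I)"
      using Ss_lincomb[OF cv S, of 1 "-1"] C(1) \<delta> I by (intro M(2)[rule_format]) auto
    then have "\<bar>u (conv g w) - (LINT x|lborel. ?F (p x) * w x)\<bar> \<le> M * (C * \<delta> * ?I)"
      unfolding Ss_dual_diff[OF u cv S] uS .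
    moreover have "\<bar>(LINT x|lborel. ?F x * w x) - (LINT x|lborel. ?F (p x) * w x)\<bar> \<le> C' * \<delta> * ?I"
      by (rule err(2)[OF C'(1) \<delta> Fm C'(2)[rule_format] p(1) X pd])
    ultimately show ?thesis by (simp add: algebra_simps)
  qed
  have "\<bar>u (conv g w) - (LINT x|lborel. ?F x * w x)\<bar> \<le> 0"
  proof (rule field_le_epsilon)
    fix e :: real assume e: "0 < e"
    \<comment> \<open>Below, \<open>e\<close> is divided by \<open>A + 1\<close> instead of
      \<open>A\<close> to cover a vanishing \<open>A\<close>.\<close>
    define A where "A = (M * C + C') * ?I"
    have A: "0 \<le> A" using M(1) C(1) C'(1) I by (simp add: A_def)
    have "\<bar>u (conv g w) - (LINT x|lborel. ?F x * w x)\<bar> \<le> A * (e / (A + 1))"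
      using key[of "e / (A + 1)"] A e by (simp add: A_def)
    also have "\<dots> \<le> e" using A e by (simp add: field_simps)
    finally show "\<bar>u (conv g w) - (LINT x|lborel. ?F x * w x)\<bar> \<le> 0 + e" by simp
  qed
  then show ?thesis by simp
qed

subsection \<open>The truncated fractional Laplacian\<close>

text \<open>\<open>frac_lap\<close> is defined through \<open>Lim\<close>, which is informative only
  when the limit exists, so each evaluation of it goes through a convergence statement about this
  truncated integral.\<close>

definition trunc_lap :: "real \<Rightarrow> ('a::euclidean_space \<Rightarrow> real) \<Rightarrow> 'a \<Rightarrow> real \<Rightarrow> real" where
  "trunc_lap s f x \<epsilon> = (LINT y : - ball x \<epsilon> | lborel.
     (f x - f y) / norm (x - y) powr (real DIM('a) + 2 * s))"

lemma frac_lap_eqI: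
  assumes "(trunc_lap s f x \<longlongrightarrow> L) (at_right 0)"
  shows "frac_lap C s f x = C * L"
  using tendsto_Lim[OF _ assms] unfolding frac_lap_def trunc_lap_def by simp

text \<open>The sign \<open>c\<close> stays free because averaging the forms for \<open>1\<close>
  and \<open>-1\<close> produces the second differences that make the principal value
  converge.\<close>

lemma trunc_lap_translate:
  fixes f :: "'a::euclidean_space \<Rightarrow> real"
  assumes [measurable]: "f \<in> borel_measurable borel" and c: "\<bar>c\<bar> = 1"
  shows "trunc_lap s f x \<epsilon> = (LINT z|lborel. indicator (- ball 0 \<epsilon>) z *
     ((f x - f (x + c *\<^sub>R z)) / norm z powr (real DIM('a) + 2 * s)))"
proof -
  have "trunc_lap s f x \<epsilon> = (LINT z|lborel. indicator (- ball x \<epsilon>) (x + c *\<^sub>R z) *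
     ((f x - f (x + c *\<^sub>R z)) / norm (x - (x + c *\<^sub>R z)) powr (real DIM('a) + 2 * s)))"
    unfolding trunc_lap_def set_lebesgue_integral_def using c
    by (subst lborel_integral_affine[where c = c and t = x]) auto
  also have "\<dots> = (LINT z|lborel. indicator (- ball 0 \<epsilon>) z *
     ((f x - f (x + c *\<^sub>R z)) / norm z powr (real DIM('a) + 2 * s)))"
    using c by (intro Bochner_Integration.integral_cong) (auto simp: indicator_def dist_norm)
  finally show ?thesis .
qed

lemma trunc_integrable:
  fixes f :: "'a::euclidean_space \<Rightarrow> real"
  assumes [measurable]: "f \<in> borel_measurable borel" and f: "\<And>y. \<bar>f y\<bar> \<le> B" and "0 < s" "0 < \<epsilon>"
  shows "integrable lborel (\<lambda>z. indicator (- ball 0 \<epsilon>) z *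
     ((a - f (x + c *\<^sub>R z)) / norm z powr (real DIM('a) + 2 * s)))"
proof -
  have "integrable lborel (\<lambda>z::'a. (a - f (x + c *\<^sub>R z)) * (indicator (- ball 0 \<epsilon>) z * norm z powr - (real DIM('a) + 2 * s)))"
  proof (rule integrable_bounded_mult[where B = "\<bar>a\<bar> + B"])
    show "integrable lborel (\<lambda>z::'a. indicator (- ball 0 \<epsilon>) z * norm z powr - (real DIM('a) + 2 * s))"
      using assms by (intro integrable_powr_outside) auto
    show "\<bar>a - f (x + c *\<^sub>R z)\<bar> \<le> \<bar>a\<bar> + B" for z using f[of "x + c *\<^sub>R z"] by linarith
  qed measurable
  then show ?thesis unfolding powr_minus divide_inverse by (simp only: mult_ac)
qed

text \<open>The gradient terms at \<open>z\<close> and \<open>- z\<close> cancel, leaving the two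
  quadratic Taylor remainders.\<close>

lemma second_difference_bound:
  fixes f :: "'a::euclidean_space \<Rightarrow> real"
  assumes f: "smooth f"
  shows "\<exists>M. \<forall>z. norm z \<le> 1 \<longrightarrow> \<bar>2 * f x - f (x + z) - f (x - z)\<bar> \<le> M * (norm z)\<^sup>2"
proof -
  have "\<exists>B. \<forall>z\<in>cball x 1. \<bar>partials bs f z\<bar> \<le> B" if "set bs \<subseteq> Basis" for bs
    using smooth_bounded_on_compact[OF smooth_partials[OF f that] compact_cball[of x 1]] by metis
  from second_partials_bound[OF this] obtain M where
    "\<forall>b\<in>Basis. \<forall>c\<in>Basis. \<forall>z\<in>cball x 1. \<bar>partials [b, c] f z\<bar> \<le> M" by blast
  then have M: "\<bar>partials [b, c] f z\<bar> \<le> M" if "b \<in> Basis" "c \<in> Basis" "z \<in> cball x 1" for b c z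
    using that by blast
  have "\<bar>2 * f x - f (x + z) - f (x - z)\<bar> \<le> 2 * (real DIM('a))\<^sup>2 * M * (norm z)\<^sup>2" if z: "norm z \<le> 1" for z
  proof -
    let ?L = "\<lambda>h. \<Sum>b\<in>Basis. (h \<bullet> b) * partials [b] f x"
    have "\<bar>f (x + h) - f x - ?L h\<bar> \<le> (real DIM('a))\<^sup>2 * M * (norm h)\<^sup>2" if "norm h \<le> 1" for h
      using that by (intro smooth_taylor[OF f] M) auto
    from this[of z] this[of "- z"] z
    have "\<bar>f (x + z) - f x - ?L z\<bar> \<le> (real DIM('a))\<^sup>2 * M * (norm z)\<^sup>2"
      "\<bar>f (x - z) - f x - ?L (- z)\<bar> \<le> (real DIM('a))\<^sup>2 * M * (norm z)\<^sup>2" by simp_all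
    moreover have "?L (- z) = - ?L z" by (simp add: sum_negf)
    ultimately show ?thesis by (simp del: partials.simps)
  qed
  then show ?thesis by blast
qed

text \<open>After symmetrisation the integrand is of order \<open>norm z powr (2 - p)\<close> near
  the origin, integrable since \<open>s < 1\<close>, and of order \<open>norm z powr - p\<close> far
  away, integrable since \<open>0 < s\<close>. Dominated convergence then closes the excised
  ball.\<close>

lemma trunc_lap_converges:
  fixes f :: "'a::euclidean_space \<Rightarrow> real"
  assumes f: "smooth f" and B: "\<And>y. \<bar>f y\<bar> \<le> B" and s: "0 < s" "s < 1"
  shows "\<exists>L. (trunc_lap s f x \<longlongrightarrow> L) (at_right 0)"
proof -
  define p where "p = real DIM('a) + 2 * s"
  define h where "h z = (2 * f x - f (x + z) - f (x - z)) / norm z powr p" for z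
  have [measurable]: "f \<in> borel_measurable borel" using f by (rule smooth_borel)
  obtain M where M: "\<And>z. norm z \<le> 1 \<Longrightarrow> \<bar>2 * f x - f (x + z) - f (x - z)\<bar> \<le> M * (norm z)\<^sup>2"
    using second_difference_bound[OF f, of x] by blast
  \<comment> \<open>The exponent is cut off at zero because \<open>p - 2\<close> is negative in
    dimension one for \<open>s < 1/2\<close>; the integrand is then bounded near the origin, while
    \<open>integrable_powr_inside\<close> asks for a nonnegative exponent.\<close>
  define H where "H z = \<bar>M\<bar> * (indicator (cball 0 1) z * norm z powr - max (p - 2) 0)
      + 4 * B * (indicator (- ball 0 1) z * norm z powr - p)" for z :: 'a
  have H: "integrable lborel H"
    unfolding H_def using s
    by (intro Bochner_Integration.integrable_add integrable_mult_right integrable_powr_inside integrable_powr_outside)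
       (auto simp: p_def)
  have hH: "\<bar>h z\<bar> \<le> H z" for z
  proof (cases "norm z < 1")
    case True
    show ?thesis
    proof (cases "z = 0")
      case False
      have "\<bar>h z\<bar> \<le> M * (norm z)\<^sup>2 / norm z powr p"
        unfolding h_def using M[of z] True by (simp add: abs_divide divide_right_mono)
      also have "\<dots> = M * norm z powr (2 - p)"
        using False by (simp add: powr_diff powr_numeral)
      also have "\<dots> \<le> \<bar>M\<bar> * norm z powr - max (p - 2) 0"
        using False True by (intro mult_mono powr_mono') auto
      finally show ?thesis using True by (simp add: H_def)
    qed (simp add: h_def H_def)
  next
    case False
    have "\<bar>2 * f x - f (x + z) - f (x - z)\<bar> \<le> 4 * B" using B[of x] B[of "x + z"] B[of "x - z"] by linarith
    then have "\<bar>h z\<bar> \<le> 4 * B / norm z powr p" unfolding h_def by (simp add: abs_divide divide_right_mono)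
    also have "\<dots> = 4 * B * norm z powr - p" by (simp add: powr_minus divide_inverse)
    finally show ?thesis using False by (simp add: H_def add_increasing)
  qed
  have half: "trunc_lap s f x \<epsilon> = (LINT z|lborel. indicator (- ball 0 \<epsilon>) z * h z) / 2" if "0 < \<epsilon>" for \<epsilon>
  proof -
    let ?g = "\<lambda>c z. indicator (- ball 0 \<epsilon>) z * ((f x - f (x + c *\<^sub>R z)) / norm z powr p)"
    have int: "integrable lborel (?g c)" for c
      unfolding p_def using B that s by (intro trunc_integrable) auto
    have "trunc_lap s f x \<epsilon> + trunc_lap s f x \<epsilon> = integral\<^sup>L lborel (?g 1) + integral\<^sup>L lborel (?g (-1))"
      using trunc_lap_translate[of f 1 s x \<epsilon>] trunc_lap_translate[of f "-1" s x \<epsilon>] by (simp add: p_def)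
    also have "\<dots> = (LINT z|lborel. ?g 1 z + ?g (-1) z)"
      using int by (intro Bochner_Integration.integral_add[symmetric])
    also have "\<dots> = (LINT z|lborel. indicator (- ball 0 \<epsilon>) z * h z)"
      unfolding h_def by (intro Bochner_Integration.integral_cong) (auto simp: add_divide_distrib diff_divide_distrib algebra_simps)
    finally show ?thesis by simp
  qed
  have [measurable]: "h \<in> borel_measurable borel" unfolding h_def by measurable
  have "(trunc_lap s f x \<longlongrightarrow> (LINT z|lborel. h z) / 2) (at_right 0)"
  proof (rule tendsto_at_right_sequentially[OF zero_less_one])
    fix S :: "nat \<Rightarrow> real" assume S: "\<And>n. 0 < S n" "S \<longlonglongrightarrow> 0"
    have "(\<lambda>n. LINT z|lborel. indicator (- ball 0 (S n)) z * h z) \<longlonglongrightarrow> (LINT z|lborel. h z)"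
    proof (rule integral_dominated_convergence[where w = H])
      show "AE z in lborel. (\<lambda>n. indicator (- ball 0 (S n)) z * h z) \<longlonglongrightarrow> h z"
      proof (rule AE_I2)
        fix z :: 'a
        show "(\<lambda>n. indicator (- ball 0 (S n)) z * h z) \<longlonglongrightarrow> h z"
        proof (cases "z = 0")
          case False
          have "eventually (\<lambda>n. S n < norm z) sequentially"
            using order_tendstoD(2)[OF S(2)] False by simp
          then have "eventually (\<lambda>n. indicator (- ball 0 (S n)) z * h z = h z) sequentially"
            by eventually_elim simp
          then show ?thesis by (rule tendsto_eventually)
        qed (simp add: h_def)
      qed
      show "AE z in lborel. norm (indicator (- ball 0 (S n)) z * h z) \<le> H z" for n
      proof (rule AE_I2)
        fix z
        show "norm (indicator (- ball 0 (S n)) z * h z) \<le> H z"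
          using hH[of z] by (auto simp: indicator_def intro: order_trans[OF abs_ge_zero])
      qed
    qed (use H in auto)
    then show "(\<lambda>n. trunc_lap s f x (S n)) \<longlonglongrightarrow> (LINT z|lborel. h z) / 2"
      using S(1) by (simp add: half tendsto_divide)
  qed
  then show ?thesis by blast
qed

lemma trunc_lap_tendsto:
  fixes f :: "'a::euclidean_space \<Rightarrow> real"
  assumes "smooth f" "\<And>y. \<bar>f y\<bar> \<le> B" "0 < s" "s < 1" "C \<noteq> 0"
  shows "(trunc_lap s f x \<longlongrightarrow> frac_lap C s f x / C) (at_right 0)"
proof -
  obtain L where L: "(trunc_lap s f x \<longlongrightarrow> L) (at_right 0)"
    using trunc_lap_converges[OF assms(1-4)] by blast
  with frac_lap_eqI[OF L, of C] assms(5) show ?thesis by simp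
qed

text \<open>The substitution rescales the excised ball as well, so the identity relates different
  truncation radii; letting them tend to zero gives homogeneity of order
  \<open>2 * s\<close>.\<close>

lemma trunc_lap_affine:
  fixes f :: "'a::euclidean_space \<Rightarrow> real"
  assumes [measurable]: "f \<in> borel_measurable borel" and c: "c \<noteq> 0"
  shows "trunc_lap s (\<lambda>y. a * f (t + c *\<^sub>R y)) x \<epsilon>
    = a * \<bar>c\<bar> powr (2 * s) * trunc_lap s f (t + c *\<^sub>R x) (\<bar>c\<bar> * \<epsilon>)"
proof -
  define p where "p = real DIM('a) + 2 * s"
  let ?v = "t + c *\<^sub>R x"
  let ?I = "LINT z|lborel. indicator (- ball 0 \<epsilon>) z * ((f ?v - f (?v + c *\<^sub>R z)) / norm z powr p)"
  have "trunc_lap s f ?v (\<bar>c\<bar> * \<epsilon>)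
      = (LINT z|lborel. indicator (- ball 0 (\<bar>c\<bar> * \<epsilon>)) z * ((f ?v - f (?v + z)) / norm z powr p))"
    using trunc_lap_translate[of f 1 s ?v "\<bar>c\<bar> * \<epsilon>"] by (simp add: p_def)
  also have "\<dots> = \<bar>c\<bar> ^ DIM('a) * (LINT z|lborel. indicator (- ball 0 (\<bar>c\<bar> * \<epsilon>)) (0 + c *\<^sub>R z) *
       ((f ?v - f (?v + (0 + c *\<^sub>R z))) / norm (0 + c *\<^sub>R z) powr p))"
    by (rule lborel_integral_affine[OF _ c]) measurable
  also have "\<dots> = \<bar>c\<bar> ^ DIM('a) * (LINT z|lborel. \<bar>c\<bar> powr - p *
      (indicator (- ball 0 \<epsilon>) z * ((f ?v - f (?v + c *\<^sub>R z)) / norm z powr p)))"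
  proof -
    have "indicator (- ball 0 (\<bar>c\<bar> * \<epsilon>)) (0 + c *\<^sub>R z) * ((f ?v - f (?v + (0 + c *\<^sub>R z))) / norm (0 + c *\<^sub>R z) powr p)
        = \<bar>c\<bar> powr - p * (indicator (- ball 0 \<epsilon>) z * ((f ?v - f (?v + c *\<^sub>R z)) / norm z powr p))" for z
      unfolding powr_minus divide_inverse using c by (simp add: indicator_def powr_mult)
    then show ?thesis by (simp only:)
  qed
  also have "\<dots> = \<bar>c\<bar> ^ DIM('a) * \<bar>c\<bar> powr - p * ?I"
    by (subst integral_mult_right_zero) (simp only: mult.assoc)
  also have "\<bar>c\<bar> ^ DIM('a) * \<bar>c\<bar> powr - p = \<bar>c\<bar> powr - (2 * s)"
    using c by (simp add: powr_realpow[symmetric] powr_add[symmetric] p_def)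
  finally have "\<bar>c\<bar> powr (2 * s) * trunc_lap s f ?v (\<bar>c\<bar> * \<epsilon>) = ?I"
    using c by (simp add: powr_minus)
  moreover have "trunc_lap s (\<lambda>y. a * f (t + c *\<^sub>R y)) x \<epsilon> = a * ?I"
  proof -
    have "trunc_lap s (\<lambda>y. a * f (t + c *\<^sub>R y)) x \<epsilon> = (LINT z|lborel.
        a * (indicator (- ball 0 \<epsilon>) z * ((f ?v - f (?v + c *\<^sub>R z)) / norm z powr p)))"
      using trunc_lap_translate[of "\<lambda>y. a * f (t + c *\<^sub>R y)" 1 s x \<epsilon>]
      by (simp add: p_def algebra_simps diff_divide_distrib)
    also have "\<dots> = a * ?I" by (rule integral_mult_right_zero)
    finally show ?thesis .
  qed
  ultimately show ?thesis by (simp add: mult.assoc)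
qed

lemma frac_lap_affine:
  fixes f :: "'a::euclidean_space \<Rightarrow> real"
  assumes f: "smooth f" "\<And>y. \<bar>f y\<bar> \<le> B" and s: "0 < s" "s < 1" and C: "C \<noteq> 0" and c: "c \<noteq> 0"
  shows "frac_lap C s (\<lambda>y. a * f (t + c *\<^sub>R y)) x = a * \<bar>c\<bar> powr (2 * s) * frac_lap C s f (t + c *\<^sub>R x)"
proof -
  have "filterlim (\<lambda>\<epsilon>. \<bar>c\<bar> * \<epsilon>) (at_right 0) (at_right 0)"
    unfolding filterlim_at using c
    by (auto intro!: tendsto_eq_intros simp: eventually_at_right_less eventually_at_filter)
  from filterlim_compose[OF trunc_lap_tendsto[OF f s C] this]
  have "((\<lambda>\<epsilon>. trunc_lap s f (t + c *\<^sub>R x) (\<bar>c\<bar> * \<epsilon>)) \<longlongrightarrow> frac_lap C s f (t + c *\<^sub>R x) / C) (at_right 0)" .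
  then have "(trunc_lap s (\<lambda>y. a * f (t + c *\<^sub>R y)) x \<longlongrightarrow>
      a * \<bar>c\<bar> powr (2 * s) * (frac_lap C s f (t + c *\<^sub>R x) / C)) (at_right 0)"
    unfolding trunc_lap_affine[OF smooth_borel[OF f(1)] c, abs_def] by (intro tendsto_mult tendsto_const)
  from frac_lap_eqI[OF this, of C] C show ?thesis by simp
qed

lemma frac_lap_diff:
  fixes f g :: "'a::euclidean_space \<Rightarrow> real"
  assumes f: "smooth f" "\<And>y. \<bar>f y\<bar> \<le> A" and g: "smooth g" "\<And>y. \<bar>g y\<bar> \<le> B"
    and s: "0 < s" "s < 1" and C: "C \<noteq> 0"
  shows "frac_lap C s (\<lambda>y. f y - g y) x = frac_lap C s f x - frac_lap C s g x"
proof -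
  note [measurable] = smooth_borel[OF f(1)] smooth_borel[OF g(1)]
  have eq: "trunc_lap s (\<lambda>y. f y - g y) x \<epsilon> = trunc_lap s f x \<epsilon> - trunc_lap s g x \<epsilon>" if "0 < \<epsilon>" for \<epsilon>
  proof -
    define p where "p = real DIM('a) + 2 * s"
    let ?I = "\<lambda>f z. indicator (- ball 0 \<epsilon>) z * ((f x - f (x + 1 *\<^sub>R z)) / norm z powr p)"
    have tr: "trunc_lap s f x \<epsilon> = integral\<^sup>L lborel (?I f)" if "f \<in> borel_measurable borel" for f :: "'a \<Rightarrow> real"
      unfolding p_def by (rule trunc_lap_translate[OF that]) simp
    have "integral\<^sup>L lborel (?I (\<lambda>y. f y - g y)) = (LINT z|lborel. ?I f z - ?I g z)"
      by (intro Bochner_Integration.integral_cong) (auto simp: diff_divide_distrib indicator_def)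
    also have "\<dots> = integral\<^sup>L lborel (?I f) - integral\<^sup>L lborel (?I g)"
      unfolding p_def using f g s that
      by (intro Bochner_Integration.integral_diff trunc_integrable) auto
    finally show ?thesis by (simp only: tr borel_measurable_diff \<open>f \<in> borel_measurable borel\<close> \<open>g \<in> borel_measurable borel\<close>)
  qed
  have "((\<lambda>\<epsilon>. trunc_lap s f x \<epsilon> - trunc_lap s g x \<epsilon>) \<longlongrightarrow> frac_lap C s f x / C - frac_lap C s g x / C) (at_right 0)"
    by (intro tendsto_diff trunc_lap_tendsto[OF f s C] trunc_lap_tendsto[OF g s C])
  then have "(trunc_lap s (\<lambda>y. f y - g y) x \<longlongrightarrow> frac_lap C s f x / C - frac_lap C s g x / C) (at_right 0)"
    by (rule Lim_transform_eventually)
      (use eq in \<open>auto simp: eventually_at_right_field intro!: exI[of _ 1]\<close>)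
  from frac_lap_eqI[OF this, of C] C show ?thesis by (simp add: right_diff_distrib)
qed

text \<open>Since \<open>f x = 0\<close> and \<open>f\<close> vanishes near \<open>x\<close>, the
  truncated integral no longer changes once \<open>\<epsilon>\<close> is below
  \<open>norm x - R\<close>, and the limit is attained.\<close>

lemma frac_lap_outside_support:
  fixes f :: "'a::euclidean_space \<Rightarrow> real"
  assumes f: "\<And>y. R < norm y \<Longrightarrow> f y = 0" and x: "R < norm x"
  shows "frac_lap C s f x = - C * (LINT y|lborel. norm (x - y) powr - (real DIM('a) + 2 * s) * f y)"
proof -
  let ?I = "LINT y|lborel. norm (x - y) powr - (real DIM('a) + 2 * s) * f y"
  have "trunc_lap s f x \<epsilon> = - ?I" if "\<epsilon> < norm x - R" for \<epsilon>
  proof -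
    have "trunc_lap s f x \<epsilon> = (LINT y|lborel. - (norm (x - y) powr - (real DIM('a) + 2 * s) * f y))"
      unfolding trunc_lap_def set_lebesgue_integral_def
    proof (intro Bochner_Integration.integral_cong refl)
      fix y
      have "f y = 0" if "dist x y < \<epsilon>"
        using f[of y] norm_triangle_sub[of x y] that \<open>\<epsilon> < norm x - R\<close> by (simp add: dist_norm)
      then show "indicator (- ball x \<epsilon>) y *\<^sub>R ((f x - f y) / norm (x - y) powr (real DIM('a) + 2 * s))
         = - (norm (x - y) powr - (real DIM('a) + 2 * s) * f y)"
        unfolding powr_minus divide_inverse using f[OF x] by (auto simp: indicator_def)
    qed
    then show ?thesis by simp
  qed
  moreover have "eventually (\<lambda>\<epsilon>. \<epsilon> < norm x - R) (at_right 0)"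
    using x by (auto simp: eventually_at_right_field intro!: exI[of _ "norm x - R"])
  ultimately have "eventually (\<lambda>\<epsilon>. trunc_lap s f x \<epsilon> = - ?I) (at_right 0)"
    by (auto elim: eventually_mono)
  then have "(trunc_lap s f x \<longlongrightarrow> - ?I) (at_right 0)" by (rule tendsto_eventually)
  from frac_lap_eqI[OF this, of C] show ?thesis by simp
qed

subsection \<open>The mollifier \<open>\<gamma>\<close>\<close>

lemma AE_zero_imp_zero:
  fixes D :: "'a::euclidean_space \<Rightarrow> real"
  assumes "continuous_on UNIV D" "open S" "AE x in lborel. x \<in> S \<longrightarrow> D x = 0" "x \<in> S"
  shows "D x = 0"
proof (rule ccontr)
  assume "D x \<noteq> 0"
  let ?U = "{x\<in>S. D x \<noteq> 0}"
  have "open (D -` (- {0}))" using assms(1) by (intro open_vimage) auto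
  then have "open (S \<inter> D -` (- {0}))" using assms(2) by blast
  moreover have "S \<inter> D -` (- {0}) = ?U" by auto
  ultimately have U: "open ?U" by simp
  have "{x \<in> space lborel. \<not> (x \<in> S \<longrightarrow> D x = 0)} \<in> null_sets lborel"
    using assms(3) U by (subst AE_iff_null[symmetric]) auto
  moreover have "{x \<in> space lborel. \<not> (x \<in> S \<longrightarrow> D x = 0)} = ?U" by auto
  ultimately have "?U \<in> null_sets lborel" by simp
  then have "negligible ?U"
    using null_sets_completionI by (auto simp: negligible_iff_null_sets)
  moreover have "?U \<noteq> {}" using \<open>D x \<noteq> 0\<close> assms(4) by blast
  ultimately show False using open_not_negligible U by blast
qed

locale regularisation =
  fixes s C K :: real and \<Gamma> :: "'a::euclidean_space \<Rightarrow> real"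
  assumes s_pos: "0 < s" and s_less_1: "s < 1" and s_less: "2 * s < real DIM('a)"
    and C_pos: "0 < C" and K_pos: "0 < K" and reg: "regularised_Phi C K s \<Gamma>"
begin

abbreviation \<gamma> :: "'a \<Rightarrow> real" where "\<gamma> \<equiv> frac_lap C s \<Gamma>"

lemma smooth_Gamma: "smooth \<Gamma>" and Gamma_pos: "0 < \<Gamma> x"
  and Gamma_outside: "1 \<le> norm x \<Longrightarrow> \<Gamma> x = Phi K s x"
  and smooth_gamma: "smooth \<gamma>" and gamma_pos: "0 < \<gamma> x"
  and integrable_gamma: "integrable lborel \<gamma>" and integral_gamma: "integral\<^sup>L lborel \<gamma> = 1"
  and Gamma_scaled_antimono: "0 < l1 \<Longrightarrow> l1 < l2 \<Longrightarrow> Gamma_scaled s \<Gamma> l2 x \<le> Gamma_scaled s \<Gamma> l1 x"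
  using reg unfolding regularised_Phi_def by (auto simp: has_bochner_integral_iff)

lemma Gamma_radial:
  assumes "norm x = norm y" shows "\<Gamma> x = \<Gamma> y"
  using reg assms unfolding regularised_Phi_def radial_decreasing_def by metis

lemma Gamma_le_0: "\<Gamma> x \<le> \<Gamma> 0"
proof -
  obtain g where g: "\<And>x. \<Gamma> x = g (norm x)" "antimono_on {0..} g"
    using reg unfolding regularised_Phi_def radial_decreasing_def by auto
  then show ?thesis using monotone_onD[OF g(2), of 0 "norm x"] by simp
qed

lemma Gamma_bounded: "\<bar>\<Gamma> x\<bar> \<le> \<Gamma> 0"
  using Gamma_le_0[of x] Gamma_pos[of x] by simp

lemma gamma_even: "\<gamma> (- x) = \<gamma> x"
proof -
  have "(\<lambda>y. 1 * \<Gamma> (0 + (-1) *\<^sub>R y)) = \<Gamma>"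
    using Gamma_radial[of "- _"] by (auto simp: fun_eq_iff)
  then show ?thesis
    using frac_lap_affine[OF smooth_Gamma Gamma_bounded s_pos s_less_1, of C "-1" 1 0 x] C_pos by simp
qed

lemma Gamma_scaled_affine:
  "Gamma_scaled s \<Gamma> l (y - x) = l powr - (real DIM('a) - 2 * s) * \<Gamma> (- x /\<^sub>R l + (1 / l) *\<^sub>R y)"
  unfolding Gamma_scaled_def by (simp add: scaleR_diff_right divide_inverse)

lemma smooth_Gamma_scaled: "smooth (\<lambda>y. Gamma_scaled s \<Gamma> l (y - x))"
  unfolding Gamma_scaled_affine
  using smooth_mult[OF smooth_const smooth_affine[OF smooth_Gamma]] .

lemma Gamma_scaled_bounded: "\<bar>Gamma_scaled s \<Gamma> l x\<bar> \<le> l powr - (real DIM('a) - 2 * s) * \<Gamma> 0"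
  unfolding Gamma_scaled_def by (simp add: abs_mult mult_left_mono Gamma_bounded)

text \<open>The order \<open>2 * s\<close> of the operator turns the normalisation
  \<open>l powr - (n - 2 * s)\<close> of the potential into the mass-preserving
  \<open>l powr - n\<close>.\<close>

lemma frac_lap_Gamma_scaled:
  assumes "0 < l"
  shows "frac_lap C s (\<lambda>y. Gamma_scaled s \<Gamma> l (y - x)) y = gamma_scaled C s \<Gamma> l (y - x)"
proof -
  have "frac_lap C s (\<lambda>y. Gamma_scaled s \<Gamma> l (y - x)) y
     = l powr - (real DIM('a) - 2 * s) * \<bar>1 / l\<bar> powr (2 * s) * \<gamma> (- x /\<^sub>R l + (1 / l) *\<^sub>R y)"
    unfolding Gamma_scaled_affine using assms C_pos
    by (intro frac_lap_affine[OF smooth_Gamma Gamma_bounded s_pos s_less_1]) auto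
  also have "l powr - (real DIM('a) - 2 * s) * \<bar>1 / l\<bar> powr (2 * s) = l powr - real DIM('a)"
  proof -
    have "\<bar>1 / l\<bar> powr (2 * s) = l powr - (2 * s)"
      using assms by (simp add: powr_divide powr_minus_divide)
    then show ?thesis by (simp flip: powr_add)
  qed
  finally show ?thesis
    by (simp add: gamma_scaled_def scaleR_diff_right divide_inverse)
qed

lemma Gamma_scaled_outside:
  assumes "0 < l" "l \<le> norm x"
  shows "Gamma_scaled s \<Gamma> l x = Phi K s x"
proof -
  have "\<Gamma> (x /\<^sub>R l) = K * (norm x / l) powr - (real DIM('a) - 2 * s)"
    using Gamma_outside[of "x /\<^sub>R l"] assms by (simp add: Phi_def field_simps)
  then show ?thesis
    using assms by (simp add: Gamma_scaled_def Phi_def powr_divide)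
qed

lemma frac_lap_Gamma_scaled_diff:
  assumes "0 < l1" "0 < l2"
  shows "frac_lap C s (\<lambda>y. Gamma_scaled s \<Gamma> l1 (y - x) - Gamma_scaled s \<Gamma> l2 (y - x))
    = (\<lambda>y. gamma_scaled C s \<Gamma> l1 (y - x) - gamma_scaled C s \<Gamma> l2 (y - x))"
  using frac_lap_diff[OF smooth_Gamma_scaled Gamma_scaled_bounded smooth_Gamma_scaled Gamma_scaled_bounded s_pos s_less_1]
    C_pos assms by (auto simp: frac_lap_Gamma_scaled)

text \<open>The singular part \<open>\<Phi> - \<Gamma>\<close> is integrable and supported in the unit ball, so away from the
  unit ball \<open>(-\<Delta>)\<^sup>s (\<Gamma> - \<Phi>)\<close> is a convolution with \<open>|z|\<^bsup>-n-2s\<^esup>\<close>. Replacing that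
  kernel by \<open>\<kappa>\<close>, a smooth function agreeing with it outside the unit ball, does not change the
  values at points of norm at least 2.\<close>

definition w :: "'a \<Rightarrow> real" where "w x = Phi K s x - \<Gamma> x"

text \<open>Far out \<open>\<Gamma>\<close> is \<open>K\<close> times the norm to the power
  \<open>- (n - 2 * s)\<close>, and the exponent chosen here converts this into the power
  \<open>- (n + 2 * s)\<close>. Since \<open>\<Gamma>\<close> is smooth and positive on the whole
  space, so is \<open>\<kappa>\<close>, which therefore serves as a regularised kernel.\<close>

definition \<kappa> :: "'a \<Rightarrow> real" where
  "\<kappa> x = (\<Gamma> x / K) powr ((real DIM('a) + 2 * s) / (real DIM('a) - 2 * s))"

lemma w_outside: "1 \<le> norm x \<Longrightarrow> w x = 0"
  by (simp add: w_def Gamma_outside)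

lemma w_measurable [measurable]: "w \<in> borel_measurable borel"
proof -
  note [measurable] = smooth_borel[OF smooth_Gamma]
  show ?thesis unfolding w_def Phi_def by measurable
qed

lemma integrable_w: "integrable lborel w"
proof (rule Bochner_Integration.integrable_bound)
  show "integrable lborel (\<lambda>x::'a. K * (indicator (cball 0 1) x * norm x powr - (real DIM('a) - 2 * s)) + \<Gamma> 0 * indicator (ball 0 1) x)"
    using s_pos s_less
    by (intro Bochner_Integration.integrable_add integrable_mult_right integrable_powr_inside integrable_real_indicator
        emeasure_lborel_ball_finite) auto
  have "\<bar>w x\<bar> \<le> K * (indicator (cball 0 1) x * norm x powr - (real DIM('a) - 2 * s)) + \<Gamma> 0 * indicator (ball 0 1) x" for x
  proof (cases "norm x < 1")
    case True
    have "\<bar>w x\<bar> \<le> \<bar>Phi K s x\<bar> + \<bar>\<Gamma> x\<bar>" by (simp add: w_def)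
    with True Gamma_bounded[of x] K_pos show ?thesis by (simp add: Phi_def)
  next
    case False
    with w_outside[of x] K_pos show ?thesis by (simp add: add_nonneg_nonneg)
  qed
  then show "AE x in lborel. norm (w x)
      \<le> norm (K * (indicator (cball 0 1) x * norm x powr - (real DIM('a) - 2 * s)) + \<Gamma> 0 * indicator (ball 0 1) x)"
    by (intro AE_I2) (metis abs_ge_self order_trans real_norm_def)
qed simp

lemma smooth_kappa: "smooth \<kappa>"
  unfolding \<kappa>_def
proof (rule smooth_powr)
  show "smooth (\<lambda>x. \<Gamma> x / K)"
    using smooth_mult[OF smooth_const[of "1 / K"] smooth_Gamma] by simp
qed (simp add: Gamma_pos K_pos)

lemma kappa_outside:
  assumes "1 \<le> norm x"
  shows "\<kappa> x = norm x powr - (real DIM('a) + 2 * s)"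
proof -
  have "\<Gamma> x / K = norm x powr - (real DIM('a) - 2 * s)"
    using Gamma_outside[OF assms] K_pos by (simp add: Phi_def)
  moreover have "- (real DIM('a) - 2 * s) * ((real DIM('a) + 2 * s) / (real DIM('a) - 2 * s)) = - (real DIM('a) + 2 * s)"
    using s_less by (simp add: field_simps)
  ultimately show ?thesis unfolding \<kappa>_def by (simp only: powr_powr)
qed

lemma kappa_Ss: "\<kappa> \<in> Ss s"
proof (rule homogeneous_Ss[OF smooth_kappa])
  fix t :: real and y :: 'a assume t: "1 \<le> t" "1 \<le> norm y"
  then have "1 * 1 \<le> t * norm y" by (intro mult_mono) auto
  then have "1 \<le> norm (t *\<^sub>R y)" using t by simp
  from kappa_outside[OF this] kappa_outside[OF t(2)] t
  show "\<kappa> (t *\<^sub>R y) = t powr - (real DIM('a) + 2 * s) * \<kappa> y" by (simp add: powr_mult)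
qed (use s_pos in simp)

lemma conv_kappa_w_Ss: "conv \<kappa> w \<in> Ss s"
  using s_pos w_outside by (intro Ss_conv[OF kappa_Ss _ integrable_w, where R = 1]) auto

lemma conv_kappa_w:
  assumes "2 < norm x"
  shows "conv \<kappa> w x = (LINT y|lborel. norm (x - y) powr - (real DIM('a) + 2 * s) * w y)"
    and "integrable lborel (\<lambda>y. norm (x - y) powr - (real DIM('a) + 2 * s) * w y)"
proof -
  have eq: "\<kappa> (x - y) * w y = norm (x - y) powr - (real DIM('a) + 2 * s) * w y" for y
  proof (cases "norm y < 1")
    case True
    then have "1 \<le> norm (x - y)" using assms norm_triangle_sub[of x y] by linarith
    then show ?thesis by (simp add: kappa_outside)
  qed (simp add: w_outside)
  show "conv \<kappa> w x = (LINT y|lborel. norm (x - y) powr - (real DIM('a) + 2 * s) * w y)"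
    unfolding conv_def eq ..
  show "integrable lborel (\<lambda>y. norm (x - y) powr - (real DIM('a) + 2 * s) * w y)"
    using integrable_conv[OF Ss_bounded_smooth[OF kappa_Ss] integrable_w, of x] unfolding eq .
qed

text \<open>The difference of the scalings at \<open>1/2\<close> and \<open>1\<close> vanishes
  outside the unit ball, so \<open>frac_lap_outside_support\<close> expresses its fractional
  Laplacian at \<open>x\<close> by integrals over \<open>w\<close> and its dilate. After a change of
  variables one of these is the convolution at \<open>2 *\<^sub>R x\<close> and the other the
  convolution at \<open>x\<close>, matching the two terms of \<open>gamma_scaled\<close>.\<close>

lemma gamma_minus_conv_homogeneous:
  assumes x: "2 < norm x"
  shows "2 ^ DIM('a) * (\<gamma> (2 *\<^sub>R x) - C * conv \<kappa> w (2 *\<^sub>R x)) = \<gamma> x - C * conv \<kappa> w x"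
proof -
  define n where "n = real DIM('a)"
  define p where "p = n + 2 * s"
  have two_n: "(2::real) ^ DIM('a) = 2 powr n" by (simp add: n_def powr_realpow)
  let ?f = "\<lambda>y. Gamma_scaled s \<Gamma> (1/2) y - Gamma_scaled s \<Gamma> 1 y"
  \<comment> \<open>By homogeneity \<open>Phi\<close> is invariant under this rescaling, so it can
    be subtracted from both terms, which turns \<open>\<Gamma>\<close> into
    \<open>- w\<close>.\<close>
  have f: "?f y = - (2 powr (n - 2 * s) * w (2 *\<^sub>R y) - w y)" for y
  proof -
    have "Phi K s (2 *\<^sub>R y) = 2 powr - (n - 2 * s) * Phi K s y"
      by (simp add: Phi_def powr_mult n_def)
    then have "2 powr (n - 2 * s) * Phi K s (2 *\<^sub>R y) = Phi K s y"
      by (simp flip: powr_add mult.assoc)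
    then have "2 powr (n - 2 * s) * w (2 *\<^sub>R y) = Phi K s y - 2 powr (n - 2 * s) * \<Gamma> (2 *\<^sub>R y)"
      by (simp add: w_def right_diff_distrib)
    moreover have "(1/2::real) powr - (n - 2 * s) = 2 powr (n - 2 * s)"
      using powr_minus[of 2 "n - 2 * s"] by (simp add: powr_divide inverse_eq_divide)
    ultimately show ?thesis by (simp add: Gamma_scaled_def w_def n_def)
  qed
  have "gamma_scaled C s \<Gamma> (1/2) x - gamma_scaled C s \<Gamma> 1 x = frac_lap C s ?f x"
    using frac_lap_Gamma_scaled_diff[of "1/2" 1 0] by simp
  also have "\<dots> = - C * (LINT y|lborel. norm (x - y) powr - p * ?f y)"
    unfolding p_def n_def
    by (rule frac_lap_outside_support[where R = 1]) (use x in \<open>auto simp: Gamma_scaled_outside\<close>)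
  also have "(LINT y|lborel. norm (x - y) powr - p * ?f y)
      = - ((LINT y|lborel. norm (x - y) powr - p * (2 powr (n - 2 * s) * w (2 *\<^sub>R y))) - conv \<kappa> w x)"
  proof -
    have "integrable lborel (\<lambda>y. norm (x - y) powr - p * (2 powr (n - 2 * s) * w (2 *\<^sub>R y)))"
    proof -
      have "integrable lborel (\<lambda>y. norm (2 *\<^sub>R x - y) powr - p * w y)"
        unfolding p_def n_def using x by (intro conv_kappa_w(2)) simp
      then have "integrable lborel (\<lambda>y. norm (2 *\<^sub>R x - (0 + 2 *\<^sub>R y)) powr - p * w (0 + 2 *\<^sub>R y))"
        by (subst lborel_integrable_affine) auto
      then have "integrable lborel (\<lambda>y. 2 powr (n - 2 * s) * 2 powr p * (norm (2 *\<^sub>R x - (0 + 2 *\<^sub>R y)) powr - p * w (0 + 2 *\<^sub>R y)))"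
        by (rule integrable_mult_right)
      moreover have "norm (2 *\<^sub>R x - (0 + 2 *\<^sub>R y)) powr - p = 2 powr - p * norm (x - y) powr - p" for y
        by (simp add: powr_mult flip: scaleR_diff_right)
      ultimately show ?thesis by (simp add: powr_minus mult_ac)
    qed
    moreover have "integrable lborel (\<lambda>y. norm (x - y) powr - p * w y)"
      unfolding p_def n_def by (rule conv_kappa_w(2)[OF x])
    ultimately show ?thesis
      unfolding f conv_kappa_w(1)[OF x] p_def[symmetric] n_def[symmetric]
      by (simp add: right_diff_distrib)
  qed
  also have "(LINT y|lborel. norm (x - y) powr - p * (2 powr (n - 2 * s) * w (2 *\<^sub>R y)))
      = 2 ^ DIM('a) * conv \<kappa> w (2 *\<^sub>R x)"
  proof -
    have "conv \<kappa> w (2 *\<^sub>R x) = (LINT y|lborel. norm (2 *\<^sub>R x - y) powr - p * w y)"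
      unfolding p_def n_def using x by (intro conv_kappa_w(1)) simp
    also have "\<dots> = \<bar>2\<bar> ^ DIM('a) * (LINT y|lborel. norm (2 *\<^sub>R x - (0 + 2 *\<^sub>R y)) powr - p * w (0 + 2 *\<^sub>R y))"
      by (rule lborel_integral_affine) auto
    also have "\<dots> = 2 powr n * (LINT y|lborel. 2 powr - p * (norm (x - y) powr - p * w (2 *\<^sub>R y)))"
    proof -
      have "norm (2 *\<^sub>R x - (0 + 2 *\<^sub>R y)) powr - p = 2 powr - p * norm (x - y) powr - p" for y
        by (simp add: powr_mult flip: scaleR_diff_right)
      then show ?thesis by (simp only: two_n abs_numeral add_0_left mult.assoc)
    qed
    finally have "2 ^ DIM('a) * conv \<kappa> w (2 *\<^sub>R x)
       = (2 powr n * 2 powr n * 2 powr - p) * (LINT y|lborel. norm (x - y) powr - p * w (2 *\<^sub>R y))"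
      by (simp add: two_n)
    \<comment> \<open>One factor \<open>2 powr n\<close> is the one in the claim, the other the
      Jacobian of the dilation; \<open>2 powr - p\<close> is the homogeneity of the kernel.\<close>
    also have "2 powr n * 2 powr n * 2 powr - p = 2 powr (n - 2 * s)"
      by (simp add: p_def flip: powr_add)
    also have "2 powr (n - 2 * s) * (LINT y|lborel. norm (x - y) powr - p * w (2 *\<^sub>R y))
        = (LINT y|lborel. 2 powr (n - 2 * s) * (norm (x - y) powr - p * w (2 *\<^sub>R y)))"
      by (rule integral_mult_right_zero[symmetric])
    finally show ?thesis by (simp only: mult.left_commute)
  qed
  finally have "gamma_scaled C s \<Gamma> (1/2) x - gamma_scaled C s \<Gamma> 1 x
      = C * (2 ^ DIM('a) * conv \<kappa> w (2 *\<^sub>R x) - conv \<kappa> w x)" by (simp add: right_diff_distrib)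
  moreover have "gamma_scaled C s \<Gamma> (1/2) x = 2 ^ DIM('a) * \<gamma> (2 *\<^sub>R x)" "gamma_scaled C s \<Gamma> 1 x = \<gamma> x"
    by (simp_all add: gamma_scaled_def powr_divide powr_minus powr_realpow)
  ultimately show ?thesis by (simp add: algebra_simps)
qed

text \<open>By homogeneity the integral of \<open>|\<gamma> - C \<kappa> * w|\<close> over all dyadic annuli is the same, hence zero.\<close>

lemma gamma_eq_conv:
  assumes x1: "2 < norm x1"
  shows "\<gamma> x1 = C * conv \<kappa> w x1"
proof -
  define D where "D x = \<gamma> x - C * conv \<kappa> w x" for x
  have smooth_D: "smooth D"
    using smooth_lincomb[OF smooth_gamma Ss_smooth[OF conv_kappa_w_Ss], of 1 "- C"] by (simp add: D_def[abs_def])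
  note [measurable] = smooth_borel[OF smooth_D]
  have int_D: "integrable lborel D"
    unfolding D_def[abs_def] using integrable_gamma Ss_integrable[OF conv_kappa_w_Ss s_pos] by auto
  \<comment> \<open>Chosen so that \<open>x1\<close> lies strictly between the radii
    \<open>R\<close> and \<open>2 * R\<close>, while \<open>R\<close> is at least 2 so that the
    homogeneity identity applies beyond it.\<close>
  define R where "R = max 2 (norm x1 * 2 / 3)"
  have R: "2 \<le> R" "R < norm x1" "norm x1 < 2 * R" using x1 by (auto simp: R_def max_def)
  have int: "integrable lborel (\<lambda>x. indicator {x. r < norm x} x * \<bar>D x\<bar>)" for r
    using integrable_bounded_mult[OF integrable_abs[OF int_D], of "indicator {x. r < norm x}" 1]
    by (auto simp: indicator_def)
  \<comment> \<open>Dilation by 2 maps the tail beyond \<open>R\<close> onto the tail beyond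
    \<open>2 * R\<close> and preserves the integral of \<open>\<bar>D x\<bar>\<close>. Both tails
    are finite, so their difference, the integral over the annulus, vanishes.\<close>
  have "(LINT x|lborel. indicator {x. 2 * R < norm x} x * \<bar>D x\<bar>)
      = \<bar>2\<bar> ^ DIM('a) * (LINT x|lborel. indicator {x. 2 * R < norm x} (0 + 2 *\<^sub>R x) * \<bar>D (0 + 2 *\<^sub>R x)\<bar>)"
    by (rule lborel_integral_affine) auto
  also have "\<dots> = (LINT x|lborel. 2 ^ DIM('a) * (indicator {x. 2 * R < norm x} (0 + 2 *\<^sub>R x) * \<bar>D (0 + 2 *\<^sub>R x)\<bar>))"
    by simp
  also have "\<dots> = (LINT x|lborel. indicator {x. R < norm x} x * \<bar>D x\<bar>)"
  proof (intro Bochner_Integration.integral_cong refl)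
    fix x
    have "2 ^ DIM('a) * \<bar>D (2 *\<^sub>R x)\<bar> = \<bar>D x\<bar>" if "R < norm x"
    proof -
      have "2 ^ DIM('a) * D (2 *\<^sub>R x) = D x"
        using gamma_minus_conv_homogeneous[of x] that R(1) unfolding D_def by simp
      then have "\<bar>D x\<bar> = \<bar>2 ^ DIM('a) * D (2 *\<^sub>R x)\<bar>" by simp
      then show ?thesis by (simp add: abs_mult)
    qed
    then show "2 ^ DIM('a) * (indicator {x. 2 * R < norm x} (0 + 2 *\<^sub>R x) * \<bar>D (0 + 2 *\<^sub>R x)\<bar>)
        = indicator {x. R < norm x} x * \<bar>D x\<bar>"
      by (auto simp: indicator_def)
  qed
  finally have "(LINT x|lborel. indicator {x. R < norm x} x * \<bar>D x\<bar> - indicator {x. 2 * R < norm x} x * \<bar>D x\<bar>) = 0"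
    using int by simp
  moreover have "integrable lborel (\<lambda>x. indicator {x. R < norm x} x * \<bar>D x\<bar> - indicator {x. 2 * R < norm x} x * \<bar>D x\<bar>)"
    using int by (intro Bochner_Integration.integrable_diff)
  moreover have "0 \<le> indicator {x. R < norm x} x * \<bar>D x\<bar> - indicator {x. 2 * R < norm x} x * \<bar>D x\<bar>" for x
    using R(1) by (auto simp: indicator_def)
  ultimately have "AE x in lborel. indicator {x. R < norm x} x * \<bar>D x\<bar> - indicator {x. 2 * R < norm x} x * \<bar>D x\<bar> = 0"
    by (subst (asm) integral_nonneg_eq_0_iff_AE) auto
  then have "AE x in lborel. x \<in> {x. R < norm x \<and> norm x < 2 * R} \<longrightarrow> D x = 0"
    by eventually_elim (auto simp: indicator_def split: if_splits)
  moreover have "open {x::'a. R < norm x \<and> norm x < 2 * R}"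
    by (intro open_Collect_conj open_Collect_less continuous_intros)
  ultimately have "D x1 = 0"
    using R by (intro AE_zero_imp_zero[OF smooth_continuous_on[OF smooth_D]]) auto
  then show ?thesis by (simp add: D_def)
qed

text \<open>Subtracting \<open>C * conv \<kappa> w x\<close> leaves a smooth function that vanishes
  beyond radius 2, and both pieces lie in the space.\<close>

lemma gamma_Ss: "\<gamma> \<in> Ss s"
proof -
  have "(\<lambda>x. 1 * \<gamma> x + (- C) * conv \<kappa> w x) \<in> Ss s"
  proof (rule compact_support_Ss[where R = 2])
    show "smooth (\<lambda>x. 1 * \<gamma> x + (- C) * conv \<kappa> w x)"
      by (rule smooth_lincomb[OF smooth_gamma Ss_smooth[OF conv_kappa_w_Ss]])
  qed (use gamma_eq_conv s_pos in auto)
  from Ss_lincomb[OF this conv_kappa_w_Ss, of 1 C] show ?thesis by simp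
qed

end

context regularisation
begin

subsection \<open>Mollification with \<open>\<gamma>\<^sub>\<lambda>\<close>\<close>

abbreviation gam :: "real \<Rightarrow> 'a \<Rightarrow> real" where "gam \<equiv> gamma_scaled C s \<Gamma>"

abbreviation eps :: "nat \<Rightarrow> real" where "eps m \<equiv> inverse (real (Suc m))"

lemma gam_even: "gam l (- y) = gam l y"
  by (simp add: gamma_scaled_def gamma_even)

lemma gam_pos: "0 < l \<Longrightarrow> 0 < gam l x"
  by (simp add: gamma_scaled_def gamma_pos)

lemma gam_Ss:
  assumes "0 < l"
  shows "gam l \<in> Ss s"
proof -
  have "(\<lambda>x. \<gamma> (0 + (1 / l) *\<^sub>R x)) \<in> Ss s"
    using assms s_pos by (intro Ss_affine[OF gamma_Ss]) auto
  from Ss_lincomb[OF this this, of "l powr - real DIM('a)" 0] show ?thesis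
    by (simp add: gamma_scaled_def[abs_def] divide_inverse)
qed

lemma gam_mult_integral:
  assumes l: "0 < l" and [measurable]: "h \<in> borel_measurable borel"
  shows "(LINT z|lborel. h z * gam l z) = (LINT z|lborel. h (l *\<^sub>R z) * \<gamma> z)"
proof -
  note [measurable] = smooth_borel[OF smooth_gamma] smooth_borel[OF Ss_smooth[OF gam_Ss[OF l]]]
  have "(LINT z|lborel. h z * gam l z) = \<bar>l\<bar> ^ DIM('a) * (LINT z|lborel. h (0 + l *\<^sub>R z) * gam l (0 + l *\<^sub>R z))"
    using l by (intro lborel_integral_affine) auto
  also have "\<dots> = (LINT z|lborel. l ^ DIM('a) * (h (l *\<^sub>R z) * gam l (l *\<^sub>R z)))"
    using l by simp
  also have "\<dots> = (LINT z|lborel. h (l *\<^sub>R z) * \<gamma> z)"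
  proof -
    have "l ^ DIM('a) * gam l (l *\<^sub>R z) = \<gamma> z" for z
      using l by (simp add: gamma_scaled_def powr_minus powr_realpow)
    then have "l ^ DIM('a) * (h (l *\<^sub>R z) * gam l (l *\<^sub>R z)) = h (l *\<^sub>R z) * \<gamma> z" for z
      by (metis mult.left_commute)
    then show ?thesis by (simp only:)
  qed
  finally show ?thesis .
qed

lemma integrable_gam: "0 < l \<Longrightarrow> integrable lborel (gam l)"
  using Ss_integrable[OF gam_Ss s_pos] .

lemma integral_gam: "0 < l \<Longrightarrow> integral\<^sup>L lborel (gam l) = 1"
  using gam_mult_integral[of l "\<lambda>_. 1"] integral_gamma by simp

lemma eps_tendsto: "eps \<longlonglongrightarrow> 0"
  using LIMSEQ_inverse_real_of_nat by simp

text \<open>For \<open>norm y \<le> 2 * R\<close> the Lipschitz bound on \<open>\<psi>\<close> gives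
  smallness. Further out \<open>\<psi> y\<close> is zero and only \<open>z\<close> with
  \<open>norm z \<ge> norm y / 2\<close> contribute; there \<open>gam l\<close> is at most a
  constant times \<open>l powr (2 * s)\<close> times \<open>norm y powr - p\<close>, which
  compensates the weight exactly.\<close>

lemma mollify_pointwise:
  assumes \<psi>: "smooth \<psi>" "\<And>x. R < norm x \<Longrightarrow> \<psi> x = 0" and R: "1 \<le> R"
  shows "\<exists>e. e \<longlonglongrightarrow> 0 \<and> (\<forall>m y. (1 + norm y powr (real DIM('a) + 2 * s)) * \<bar>conv \<psi> (gam (eps m)) y - \<psi> y\<bar> \<le> e m)"
proof -
  define p where "p = real DIM('a) + 2 * s"
  have p: "0 < p" using s_pos by (simp add: p_def add_nonneg_pos)
  have \<psi>S: "\<psi> \<in> Ss s" using \<psi> s_pos by (intro compact_support_Ss[where R = R]) auto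
  note [measurable] = smooth_borel[OF \<psi>(1)] smooth_borel[OF smooth_gamma]
  obtain B where B: "0 \<le> B" "Ss_bounded s 1 \<psi> B" by (rule Ss_bounded_ex[OF \<psi>S])
  have B': "\<bar>partials bs \<psi> x\<bar> \<le> B" if "set bs \<subseteq> Basis" "length bs \<le> 1" for bs x
  proof -
    have "1 * \<bar>partials bs \<psi> x\<bar> \<le> (1 + norm x powr p) * \<bar>partials bs \<psi> x\<bar>"
      by (intro mult_right_mono) auto
    with Ss_boundedD[OF B(2) that, of x] show ?thesis by (simp add: p_def)
  qed
  have \<psi>B: "\<bar>\<psi> x\<bar> \<le> B" for x using B'[of "[]" x] by simp
  define L where "L = real DIM('a) * B"
  have L: "0 \<le> L" using B(1) by (simp add: L_def)
  have lip: "\<bar>\<psi> x - \<psi> y\<bar> \<le> L * norm (x - y)" for x y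
    unfolding L_def using B'[of "[_]"] by (intro smooth_lipschitz[OF \<psi>(1), where S = UNIV]) auto
  obtain A where A: "0 \<le> A" "Ss_bounded s 0 \<gamma> A" by (rule Ss_bounded_ex[OF gamma_Ss])
  \<comment> \<open>Rescaling the decay of \<open>\<gamma>\<close> produces the powers
    \<open>l powr - n\<close> and \<open>l powr p\<close>, whose product is the small factor
    \<open>l powr (2 * s)\<close>.\<close>
  have gam_le: "gam l z \<le> A * l powr (2 * s) * norm z powr - p" if "0 < l" "z \<noteq> 0" for l z
  proof -
    let ?v = "z /\<^sub>R l"
    have v: "0 < norm ?v powr p" using that by simp
    have "norm ?v powr p * \<gamma> ?v \<le> (1 + norm ?v powr p) * \<bar>\<gamma> ?v\<bar>"
      using gamma_pos[of ?v] by (simp add: algebra_simps)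
    also have "\<dots> \<le> A" using Ss_boundedD[OF A(2), of "[]" ?v] by (simp add: p_def)
    finally have "\<gamma> ?v \<le> A / norm ?v powr p" using v by (simp add: field_simps)
    also have "\<dots> = A * (l powr p * norm z powr - p)"
      using that by (simp add: powr_mult inverse_powr powr_minus_divide) (simp add: field_simps)
    finally have "gam l z \<le> l powr - real DIM('a) * (A * (l powr p * norm z powr - p))"
      unfolding gamma_scaled_def by (intro mult_left_mono) auto
    also have "\<dots> = A * (l powr - real DIM('a) * l powr p) * norm z powr - p" by simp
    also have "l powr - real DIM('a) * l powr p = l powr (2 * s)"
      by (simp add: p_def flip: powr_add)
    finally show ?thesis .
  qed
  \<comment> \<open>The Lipschitz bound is capped at \<open>2 * B\<close> because the decay of
    \<open>\<gamma>\<close> guarantees a first moment only for \<open>2 * s > 1\<close>; the capped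
    integrand is dominated by a multiple of \<open>\<gamma>\<close>.\<close>
  define I where "I l = (LINT z|lborel. min (L * norm (l *\<^sub>R z)) (2 * B) * \<gamma> z)" for l
  define J where "J = (LINT z|lborel. \<bar>\<psi> z\<bar>)"
  define e where "e m = (1 + (2 * R) powr p) * I (eps m) + 2 * (A * 2 powr p * J) * eps m powr (2 * s)" for m
  have I_nonneg: "0 \<le> I l" for l
    unfolding I_def using L B(1) gamma_pos by (intro integral_nonneg_AE AE_I2 mult_nonneg_nonneg) (auto intro: less_imp_le)
  have J_nonneg: "0 \<le> J" by (simp add: J_def)
  have "(\<lambda>m. I (eps m)) \<longlonglongrightarrow> (LINT z|(lborel :: 'a measure). 0)"
    unfolding I_def
  proof (rule integral_dominated_convergence[where w = "\<lambda>z. 2 * B * \<gamma> z"])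
    show "integrable lborel (\<lambda>z. 2 * B * \<gamma> z)" using integrable_gamma by simp
    show "AE z in lborel. (\<lambda>m. min (L * norm (eps m *\<^sub>R z)) (2 * B) * \<gamma> z) \<longlonglongrightarrow> 0"
    proof (rule AE_I2)
      fix z :: 'a
      have "(\<lambda>m. L * (eps m * norm z)) \<longlonglongrightarrow> L * (0 * norm z)"
        by (intro tendsto_intros eps_tendsto)
      moreover have "L * (eps m * norm z) = L * norm (eps m *\<^sub>R z)" for m by (simp add: abs_of_nonneg)
      ultimately have "(\<lambda>m. L * norm (eps m *\<^sub>R z)) \<longlonglongrightarrow> 0" by (simp only: mult_zero_left mult_zero_right)
      from tendsto_min[OF this tendsto_const]
      have "(\<lambda>m. min (L * norm (eps m *\<^sub>R z)) (2 * B)) \<longlonglongrightarrow> min 0 (2 * B)" .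
      from tendsto_mult[OF this tendsto_const]
      have "(\<lambda>m. min (L * norm (eps m *\<^sub>R z)) (2 * B) * \<gamma> z) \<longlonglongrightarrow> min 0 (2 * B) * \<gamma> z" .
      then show "(\<lambda>m. min (L * norm (eps m *\<^sub>R z)) (2 * B) * \<gamma> z) \<longlonglongrightarrow> 0" using B(1) by simp
    qed
    show "AE z in lborel. norm (min (L * norm (eps m *\<^sub>R z)) (2 * B) * \<gamma> z) \<le> 2 * B * \<gamma> z" for m
    proof (rule AE_I2)
      fix z :: 'a
      have "0 \<le> min (L * norm (eps m *\<^sub>R z)) (2 * B)" using L B(1) by simp
      moreover have "min (L * norm (eps m *\<^sub>R z)) (2 * B) * \<gamma> z \<le> 2 * B * \<gamma> z"
        using gamma_pos[of z] by (intro mult_right_mono) auto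
      ultimately show "norm (min (L * norm (eps m *\<^sub>R z)) (2 * B) * \<gamma> z) \<le> 2 * B * \<gamma> z"
        using gamma_pos[of z] by (simp add: abs_mult)
    qed
  qed measurable
  then have I_lim: "(\<lambda>m. I (eps m)) \<longlonglongrightarrow> 0" by simp
  have "(\<lambda>m. eps m powr (2 * s)) \<longlonglongrightarrow> 0"
    using s_pos by (intro tendsto_zero_powrI[OF eps_tendsto tendsto_const]) auto
  then have "(\<lambda>m. e m) \<longlonglongrightarrow> (1 + (2 * R) powr p) * 0 + 2 * (A * 2 powr p * J) * 0"
    unfolding e_def by (intro tendsto_intros I_lim)
  then have e_lim: "e \<longlonglongrightarrow> 0" by simp
  have "(1 + norm y powr p) * \<bar>conv \<psi> (gam l) y - \<psi> y\<bar>
      \<le> (1 + (2 * R) powr p) * I l + 2 * (A * 2 powr p * J) * l powr (2 * s)" if l: "0 < l" for l y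
  proof -
    note [measurable] = smooth_borel[OF Ss_smooth[OF gam_Ss[OF l]]]
    have int: "integrable lborel (\<lambda>z. \<psi> (y - z) * gam l z)"
      by (intro integrable_conv Ss_bounded_smooth[OF \<psi>S] integrable_gam l)
    show ?thesis
    proof (cases "norm y \<le> 2 * R")
      case True
      have d: "integrable lborel (\<lambda>z. (\<psi> (y - z) - \<psi> y) * gam l z)"
        unfolding left_diff_distrib using int integrable_gam[OF l] by auto
      have "conv \<psi> (gam l) y - \<psi> y = (LINT z|lborel. (\<psi> (y - z) - \<psi> y) * gam l z)"
        unfolding conv_def left_diff_distrib using int integrable_gam[OF l] by (simp add: integral_gam l)
      also have "\<bar>\<dots>\<bar> \<le> (LINT z|lborel. \<bar>(\<psi> (y - z) - \<psi> y) * gam l z\<bar>)" by (rule integral_abs_bound)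
      also have "\<dots> \<le> (LINT z|lborel. min (L * norm z) (2 * B) * gam l z)"
      proof (rule integral_mono)
        show "integrable lborel (\<lambda>z. min (L * norm z) (2 * B) * gam l z)"
          using L B(1) by (intro integrable_bounded_mult[OF integrable_gam[OF l], where B = "2 * B"]) (auto simp: abs_le_iff)
        fix z
        have "\<bar>\<psi> (y - z) - \<psi> y\<bar> \<le> min (L * norm z) (2 * B)"
          using lip[of "y - z" y] \<psi>B[of "y - z"] \<psi>B[of y] by simp
        then show "\<bar>(\<psi> (y - z) - \<psi> y) * gam l z\<bar> \<le> min (L * norm z) (2 * B) * gam l z"
          using gam_pos[OF l, of z] by (simp add: abs_mult mult_right_mono)
      qed (use d in auto)
      also have "\<dots> = I l" unfolding I_def by (rule gam_mult_integral[OF l]) measurable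
      finally have "(1 + norm y powr p) * \<bar>conv \<psi> (gam l) y - \<psi> y\<bar> \<le> (1 + (2 * R) powr p) * I l"
        using True p by (intro mult_mono add_mono powr_mono2) auto
      also have "\<dots> \<le> (1 + (2 * R) powr p) * I l + 2 * (A * 2 powr p * J) * l powr (2 * s)"
        using A(1) J_nonneg by simp
      finally show ?thesis .
    next
      case False
      then have y: "1 \<le> norm y" "R < norm y" using R by auto
      let ?k = "A * l powr (2 * s) * (2 powr p * norm y powr - p)"
      have "\<bar>conv \<psi> (gam l) y - \<psi> y\<bar> = \<bar>LINT z|lborel. \<psi> (y - z) * gam l z\<bar>"
        using \<psi>(2)[OF y(2)] by (simp add: conv_def)
      also have "\<dots> \<le> (LINT z|lborel. \<bar>\<psi> (y - z) * gam l z\<bar>)" by (rule integral_abs_bound)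
      also have "\<dots> \<le> (LINT z|lborel. ?k * \<bar>\<psi> (y - z)\<bar>)"
      proof (rule integral_mono)
        have "integrable lborel (\<lambda>z. \<psi> (y + (-1) *\<^sub>R z))"
          by (subst lborel_integrable_affine) (auto intro: Ss_integrable[OF \<psi>S s_pos])
        then show "integrable lborel (\<lambda>z. ?k * \<bar>\<psi> (y - z)\<bar>)" by simp
        fix z
        show "\<bar>\<psi> (y - z) * gam l z\<bar> \<le> ?k * \<bar>\<psi> (y - z)\<bar>"
        proof (cases "norm (y - z) \<le> R")
          case True
          then have z: "norm y / 2 \<le> norm z" using False norm_triangle_sub[of y z] by linarith
          with y have z0: "z \<noteq> 0" by auto
          have "norm z powr - p \<le> (norm y / 2) powr - p" using z y p by (intro powr_mono2') auto
          also have "\<dots> = 2 powr p * norm y powr - p"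
            by (simp add: powr_divide powr_minus_divide)
          finally have "A * l powr (2 * s) * norm z powr - p \<le> ?k" using A(1) by (intro mult_left_mono) auto
          with gam_le[OF l z0] have "gam l z \<le> ?k" by linarith
          then have "\<bar>\<psi> (y - z)\<bar> * gam l z \<le> \<bar>\<psi> (y - z)\<bar> * ?k" by (intro mult_left_mono) auto
          then show ?thesis using gam_pos[OF l, of z] by (simp add: abs_mult mult.commute)
        qed (use \<psi>(2)[of "y - z"] in simp)
      qed (use int in auto)
      also have "\<dots> = ?k * (LINT z|lborel. \<bar>\<psi> (y + (-1) *\<^sub>R z)\<bar>)" by simp
      also have "(LINT z|lborel. \<bar>\<psi> (y + (-1) *\<^sub>R z)\<bar>) = J"
        unfolding J_def using lborel_integral_affine[of "\<lambda>z. \<bar>\<psi> z\<bar>" "-1" y] by simp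
      finally have "(1 + norm y powr p) * \<bar>conv \<psi> (gam l) y - \<psi> y\<bar> \<le> (2 * norm y powr p) * (?k * J)"
        using y p by (intro mult_mono) (auto simp: ge_one_powr_ge_zero)
      also have "\<dots> = 2 * (A * 2 powr p * J) * l powr (2 * s)"
        using y by (auto simp: powr_minus field_simps)
      also have "\<dots> \<le> (1 + (2 * R) powr p) * I l + 2 * (A * 2 powr p * J) * l powr (2 * s)"
        using I_nonneg[of l] by simp
      finally show ?thesis .
    qed
  qed
  then have "\<forall>m y. (1 + norm y powr p) * \<bar>conv \<psi> (gam (eps m)) y - \<psi> y\<bar> \<le> e m"
    unfolding e_def by simp
  with e_lim show ?thesis unfolding p_def by blast
qed

text \<open>\<open>Ss_dual_conv\<close> rewrites the integral as \<open>u\<close> of the mollified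
  function, and the weighted estimate is applied to each of the finitely many partial derivatives of
  \<open>\<phi>\<close> that enter the bound on \<open>u\<close>.\<close>

lemma mollify_dual:
  assumes u: "u \<in> Ss_dual s" and \<phi>: "smooth \<phi>" "\<And>x. R < norm x \<Longrightarrow> \<phi> x = 0"
  shows "(\<lambda>m. LINT x|lborel. u (\<lambda>y. gam (eps m) (y - x)) * \<phi> x) \<longlonglongrightarrow> u \<phi>"
proof -
  have s: "0 \<le> s" using s_pos by simp
  have \<phi>S: "\<phi> \<in> Ss s" using \<phi> s by (intro compact_support_Ss[where R = R]) auto
  note \<phi>i = Ss_integrable[OF \<phi>S s_pos]
  obtain M N where M: "0 < M" "\<forall>\<phi> B. \<phi> \<in> Ss s \<longrightarrow> 0 \<le> B \<longrightarrow> Ss_bounded s N \<phi> B \<longrightarrow> \<bar>u \<phi>\<bar> \<le> M * B"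
    by (rule Ss_dual_bound[OF u s])
  have "\<exists>e. e \<longlonglongrightarrow> 0 \<and> (\<forall>m y. (1 + norm y powr (real DIM('a) + 2 * s)) *
      \<bar>conv (partials bs \<phi>) (gam (eps m)) y - partials bs \<phi> y\<bar> \<le> e m)" if "set bs \<subseteq> Basis" for bs
  proof (rule mollify_pointwise[where R = "max R 1"])
    show "smooth (partials bs \<phi>)" by (rule smooth_partials[OF \<phi>(1) that])
    show "partials bs \<phi> x = 0" if "max R 1 < norm x" for x
      by (rule partials_zero_set[of "- cball 0 R"]) (use that \<phi>(2) in auto)
  qed simp
  then obtain e where e: "\<And>bs. set bs \<subseteq> Basis \<Longrightarrow> e bs \<longlonglongrightarrow> 0"
    "\<And>bs m y. set bs \<subseteq> Basis \<Longrightarrow> (1 + norm y powr (real DIM('a) + 2 * s)) *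
      \<bar>conv (partials bs \<phi>) (gam (eps m)) y - partials bs \<phi> y\<bar> \<le> e bs m"
    by metis
  let ?X = "{bs. set bs \<subseteq> (Basis :: 'a set) \<and> length bs \<le> N}"
  have fin: "finite ?X" by (rule finite_lists_length_le) simp
  define E where "E m = (\<Sum>bs\<in>?X. e bs m)" for m
  have E_lim: "E \<longlonglongrightarrow> 0"
  proof -
    have "(\<lambda>m. \<Sum>bs\<in>?X. e bs m) \<longlonglongrightarrow> (\<Sum>bs\<in>?X. 0)" using e(1) by (intro tendsto_sum) auto
    then show ?thesis by (simp add: E_def[abs_def])
  qed
  have e_nonneg: "0 \<le> e bs m" if "set bs \<subseteq> Basis" for bs m
    using e(2)[OF that, of 0 m] by (rule order_trans[rotated]) simp
  have bound: "\<bar>(LINT x|lborel. u (\<lambda>y. gam (eps m) (y - x)) * \<phi> x) - u \<phi>\<bar> \<le> M * E m" for m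
  proof -
    have l: "0 < eps m" by simp
    note gS = gam_Ss[OF l] and gi = integrable_gam[OF l]
    \<comment> \<open>Both orders of the convolution are used: with the compactly supported
      \<open>\<phi>\<close> as second factor it is seen to lie in \<open>Ss s\<close>, and with
      \<open>\<phi>\<close> as first factor its derivatives fall on \<open>\<phi>\<close>.\<close>
    have "conv (gam (eps m)) \<phi> = conv \<phi> (gam (eps m))"
      by (rule conv_commute) (intro smooth_borel Ss_smooth[where s = s] gS \<phi>S)+
    moreover have cS: "conv (gam (eps m)) \<phi> \<in> Ss s" by (rule Ss_conv[OF gS s \<phi>i \<phi>(2)])
    ultimately have cS': "conv \<phi> (gam (eps m)) \<in> Ss s" by simp
    have "Ss_bounded s N (\<lambda>y. conv \<phi> (gam (eps m)) y - \<phi> y) (E m)"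
      unfolding Ss_bounded_def
    proof (intro allI impI)
      fix bs :: "'a list" and y :: 'a assume b: "set bs \<subseteq> Basis \<and> length bs \<le> N"
      have "partials bs (\<lambda>y. conv \<phi> (gam (eps m)) y - \<phi> y) y = conv (partials bs \<phi>) (gam (eps m)) y - partials bs \<phi> y"
        using partials_lincomb[OF Ss_smooth[OF cS'] \<phi>(1), of bs 1 "-1"] b
          partials_conv[OF Ss_bounded_smooth[OF \<phi>S] gi, of bs] by simp
      then have "(1 + norm y powr (real DIM('a) + 2 * s)) * \<bar>partials bs (\<lambda>y. conv \<phi> (gam (eps m)) y - \<phi> y) y\<bar> \<le> e bs m"
        using e(2)[of bs y m] b by simp
      also have "\<dots> \<le> E m" unfolding E_def using b e_nonneg by (intro member_le_sum fin) auto
      finally show "(1 + norm y powr (real DIM('a) + 2 * s)) * \<bar>partials bs (\<lambda>y. conv \<phi> (gam (eps m)) y - \<phi> y) y\<bar> \<le> E m" .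
    qed
    moreover have "0 \<le> E m" unfolding E_def using e_nonneg by (intro sum_nonneg) auto
    moreover have "(\<lambda>y. conv \<phi> (gam (eps m)) y - \<phi> y) \<in> Ss s"
      using Ss_lincomb[OF cS' \<phi>S, of 1 "-1"] by simp
    ultimately have "\<bar>u (\<lambda>y. conv \<phi> (gam (eps m)) y - \<phi> y)\<bar> \<le> M * E m" using M(2) by blast
    then have "\<bar>u (conv \<phi> (gam (eps m))) - u \<phi>\<bar> \<le> M * E m"
      by (simp only: Ss_dual_diff[OF u cS' \<phi>S])
    then show ?thesis
      using Ss_dual_conv[OF u gS s \<phi>i \<phi>(2)] \<open>conv (gam (eps m)) \<phi> = conv \<phi> (gam (eps m))\<close> by simp
  qed
  have "(\<lambda>m. (LINT x|lborel. u (\<lambda>y. gam (eps m) (y - x)) * \<phi> x) - u \<phi>) \<longlonglongrightarrow> 0"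
  proof (rule tendsto_rabs_zero_cancel, rule tendsto_sandwich[OF _ _ tendsto_const])
    show "(\<lambda>m. M * E m) \<longlonglongrightarrow> 0" using tendsto_mult[OF tendsto_const E_lim, of M] by simp
  qed (use bound in auto)
  then show ?thesis by (simp add: LIM_zero_iff)
qed

end

subsection \<open>The lower semicontinuous representative\<close>

text \<open>A connected set that meets both \<open>\<Omega>\<close> and its complement meets the
  frontier. With an empty frontier the distance is infinite, and the same argument covers that
  case.\<close>

lemma less_edist_imp_cball_subset:
  fixes x :: "'a::euclidean_space"
  assumes "x \<in> \<Omega>" "0 < l" "ereal l < edist_to x (frontier \<Omega>)"
  shows "cball x l \<subseteq> \<Omega>"
proof (rule ccontr)
  assume "\<not> cball x l \<subseteq> \<Omega>"
  moreover have "x \<in> cball x l \<inter> \<Omega>" using assms(1,2) by simp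
  ultimately have "cball x l \<inter> frontier \<Omega> \<noteq> {}"
    by (intro connected_Int_frontier convex_connected convex_cball) blast+
  then obtain z where z: "z \<in> frontier \<Omega>" "dist x z \<le> l" by auto
  then have "edist_to x (frontier \<Omega>) \<le> ereal (dist x z)"
    unfolding edist_to_def by (intro INF_lower)
  also have "\<dots> \<le> ereal l" using z by simp
  finally show False using assms(3) by simp
qed

lemma cball_subset_imp_le_edist:
  assumes "open \<Omega>" "cball x r \<subseteq> \<Omega>"
  shows "ereal r \<le> edist_to x (frontier \<Omega>)"
  unfolding edist_to_def
proof (rule INF_greatest)
  fix y assume "y \<in> frontier \<Omega>"
  then have "y \<notin> \<Omega>" using assms(1) by (simp add: frontier_def interior_open)
  with assms(2) have "y \<notin> cball x r" by blast
  then show "ereal r \<le> ereal (dist x y)" by simp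
qed

lemma compact_subset_open_cball:
  fixes A :: "'a::euclidean_space set"
  assumes "compact A" "open \<Omega>" "A \<subseteq> \<Omega>"
  obtains \<delta> where "0 < \<delta>" "\<forall>x\<in>A. cball x \<delta> \<subseteq> \<Omega>"
proof -
  have "\<exists>d>0. \<forall>x\<in>A. \<forall>y\<in>- \<Omega>. d \<le> dist x y"
    using assms by (intro separate_compact_closed) auto
  then obtain d where d: "0 < d" "\<forall>x\<in>A. \<forall>y\<in>- \<Omega>. d \<le> dist x y" by blast
  have "\<forall>x\<in>A. cball x (d / 2) \<subseteq> \<Omega>"
  proof (intro ballI subsetI)
    fix x y assume "x \<in> A" "y \<in> cball x (d / 2)"
    then have "\<not> d \<le> dist x y" using d(1) by simp
    with d(2) \<open>x \<in> A\<close> show "y \<in> \<Omega>" by blast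
  qed
  with d(1) show ?thesis by (intro that[of "d / 2"]) auto
qed

locale superharmonic = regularisation s C K \<Gamma>
  for s C K :: real and \<Gamma> :: "'a::euclidean_space \<Rightarrow> real" +
  fixes \<Omega> :: "'a set" and u :: "('a \<Rightarrow> real) \<Rightarrow> real"
  assumes open_Omega: "open \<Omega>" and u: "u \<in> Ss_dual s"
    and u_nonneg: "distr_nonneg_on \<Omega> (frac_lap_distr C s u)"
begin

text \<open>The argument is \<open>y - x\<close> so that \<open>Ss_dual_conv\<close> applies
  literally; since \<open>gam l\<close> is even, this is the pairing of the theorem.\<close>

definition v :: "real \<Rightarrow> 'a \<Rightarrow> real" where "v l x = u (\<lambda>y. gam l (y - x))"

text \<open>The supremum runs over the radii admissible at \<open>x\<close> itself, which makes the
  required lower bound immediate. The price is an index set that depends on \<open>x\<close>, so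
  semicontinuity and measurability each need an argument.\<close>

definition rep :: "'a \<Rightarrow> ereal" where
  "rep x = (SUP l\<in>{l. 0 < l \<and> ereal l < edist_to x (frontier \<Omega>)}. ereal (v l x))"

lemma v_continuous: "0 < l \<Longrightarrow> continuous_on A (v l)"
  unfolding v_def[abs_def] using s_pos
  by (intro continuous_on_subset[OF Ss_dual_translate_continuous[OF u gam_Ss]]) auto

lemma v_measurable [measurable]: "0 < l \<Longrightarrow> v l \<in> borel_measurable borel"
  by (intro borel_measurable_continuous_onI v_continuous)

lemma v_antimono:
  assumes "0 < l1" "l1 \<le> l2" "cball x l2 \<subseteq> \<Omega>"
  shows "v l2 x \<le> v l1 x"
proof (cases "l1 = l2")
  case False
  with assms have l: "l1 < l2" "0 < l2" by auto
  let ?\<phi> = "\<lambda>y. Gamma_scaled s \<Gamma> l1 (y - x) - Gamma_scaled s \<Gamma> l2 (y - x)"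
  have "smooth ?\<phi>"
    using smooth_lincomb[OF smooth_Gamma_scaled smooth_Gamma_scaled, of 1 l1 x "-1" l2 x] by simp
  moreover have "?\<phi> y = 0" if "y \<notin> cball x l2" for y
  proof -
    have "l2 \<le> norm (y - x)" using that by (simp add: dist_norm norm_minus_commute)
    with l assms(1) show ?thesis by (simp add: Gamma_scaled_outside)
  qed
  then have cl: "closure {y. ?\<phi> y \<noteq> 0} \<subseteq> cball x l2"
    by (intro closure_minimal closed_cball) blast
  moreover have "compact (closure {y. ?\<phi> y \<noteq> 0})"
    using compact_Int_closed[OF compact_cball[of x l2] closed_closure, of "{y. ?\<phi> y \<noteq> 0}"] cl
    by (simp add: Int_absorb1)
  ultimately have "?\<phi> \<in> test_functions \<Omega>"
    using assms(3) by (auto simp: test_functions_def)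
  moreover have "0 \<le> ?\<phi> y" for y using Gamma_scaled_antimono[OF assms(1) l(1)] by simp
  ultimately have "0 \<le> u (frac_lap C s ?\<phi>)"
    using u_nonneg by (auto simp: distr_nonneg_on_def frac_lap_distr_def)
  also have "\<dots> = v l1 x - v l2 x"
    unfolding frac_lap_Gamma_scaled_diff[OF assms(1) l(2)] v_def
    using assms(1) l(2) s_pos by (intro Ss_dual_diff[OF u] Ss_translate gam_Ss) auto
  finally show ?thesis by simp
qed simp

lemma v_le_rep:
  assumes "0 < l" "ereal l < edist_to x (frontier \<Omega>)"
  shows "ereal (v l x) \<le> rep x"
  unfolding rep_def using assms by (intro SUP_upper) auto

lemma rep_lower_semicontinuous: "lower_semicontinuous_on \<Omega> rep"
  unfolding lower_semicontinuous_on_def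
proof (intro conjI ballI allI)
  fix x assume "x \<in> \<Omega>"
  then obtain r where r: "r > 0" "cball x r \<subseteq> \<Omega>" using open_Omega open_contains_cball by blast
  \<comment> \<open>Half the radius, because admissible radii lie strictly below the distance; a
    single one keeps the supremum away from \<open>-\<infinity>\<close>.\<close>
  have "ereal (r / 2) < ereal r" using r(1) by simp
  also have "\<dots> \<le> edist_to x (frontier \<Omega>)" by (rule cball_subset_imp_le_edist[OF open_Omega r(2)])
  finally have "ereal (v (r / 2) x) \<le> rep x" using r(1) by (intro v_le_rep) auto
  then show "rep x \<noteq> -\<infinity>" by auto
next
  fix a
  have "\<exists>T. open T \<and> x \<in> T \<and> T \<subseteq> {x\<in>\<Omega>. a < rep x}" if x: "x \<in> {x\<in>\<Omega>. a < rep x}" for x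
  proof -
    from x obtain l where l: "0 < l" "ereal l < edist_to x (frontier \<Omega>)" "a < ereal (v l x)"
      unfolding rep_def less_SUP_iff by auto
    \<comment> \<open>\<open>r - l\<close> is the room by which \<open>x\<close> may move while
      \<open>l\<close> stays admissible. Taking a real \<open>r\<close> also handles an infinite
      distance.\<close>
    obtain r where r: "ereal l < ereal r" "ereal r < edist_to x (frontier \<Omega>)"
      using ereal_dense2[OF l(2)] by auto
    let ?T = "\<Omega> \<inter> ball x (r - l) \<inter> {y. a < ereal (v l y)}"
    have "open {y. a < ereal (v l y)}"
      by (intro open_Collect_less continuous_on_const continuous_on_ereal v_continuous l(1))
    then have "open ?T" using open_Omega by blast
    moreover have "x \<in> ?T" using x l(3) r(1) by simp
    moreover have "?T \<subseteq> {x\<in>\<Omega>. a < rep x}"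
    proof
      fix y assume y: "y \<in> ?T"
      have "ereal l < ereal (r - dist x y)" using y by simp
      also have "\<dots> \<le> edist_to y (frontier \<Omega>)"
        unfolding edist_to_def
      proof (rule INF_greatest)
        fix z assume "z \<in> frontier \<Omega>"
        then have "edist_to x (frontier \<Omega>) \<le> ereal (dist x z)"
          unfolding edist_to_def by (intro INF_lower)
        with r(2) have "ereal r < ereal (dist x z)" by (rule less_le_trans)
        then show "ereal (r - dist x y) \<le> ereal (dist y z)" using dist_triangle[of x z y] by simp
      qed
      finally have "ereal (v l y) \<le> rep y" using l(1) by (intro v_le_rep)
      moreover have "a < ereal (v l y)" using y by blast
      ultimately show "y \<in> {x\<in>\<Omega>. a < rep x}" using y by auto
    qed
    ultimately show ?thesis by blast
  qed
  then have "open {x\<in>\<Omega>. a < rep x}" by (subst open_subopen) blast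
  then show "openin (top_of_set \<Omega>) {x\<in>\<Omega>. a < rep x}"
    by (rule open_openin_trans[OF open_Omega]) auto
qed

text \<open>Among admissible radii \<open>v\<close> grows as the radius shrinks, so the sequence
  overtakes every competitor in the supremum; conversely its terms are eventually competitors
  themselves.\<close>

lemma rep_tendsto:
  assumes "x \<in> \<Omega>"
  shows "(\<lambda>m. ereal (v (eps m) x)) \<longlonglongrightarrow> rep x"
proof (rule order_tendstoI)
  fix a assume "a < rep x"
  then obtain l where l: "0 < l" "ereal l < edist_to x (frontier \<Omega>)" "a < ereal (v l x)"
    unfolding rep_def less_SUP_iff by auto
  have "eventually (\<lambda>m. eps m < l) sequentially" by (rule order_tendstoD(2)[OF eps_tendsto l(1)])
  then show "eventually (\<lambda>m. a < ereal (v (eps m) x)) sequentially"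
  proof eventually_elim
    case (elim m)
    then have "v l x \<le> v (eps m) x"
      using less_edist_imp_cball_subset[OF assms l(1,2)] by (intro v_antimono) auto
    with l(3) show ?case by (metis ereal_less_eq(3) less_le_trans)
  qed
next
  fix a assume a: "rep x < a"
  obtain r where r: "r > 0" "cball x r \<subseteq> \<Omega>" using assms open_Omega open_contains_cball by blast
  have "eventually (\<lambda>m. eps m < r) sequentially" by (rule order_tendstoD(2)[OF eps_tendsto r(1)])
  then show "eventually (\<lambda>m. ereal (v (eps m) x) < a) sequentially"
  proof eventually_elim
    case (elim m)
    have "ereal (eps m) < ereal r" using elim by simp
    also have "\<dots> \<le> edist_to x (frontier \<Omega>)" by (rule cball_subset_imp_le_edist[OF open_Omega r(2)])
    finally have "ereal (v (eps m) x) \<le> rep x" by (intro v_le_rep) auto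
    with a show ?case by simp
  qed
qed

lemma v_eps_mono:
  assumes "cball x \<delta> \<subseteq> \<Omega>" "eps m0 \<le> \<delta>" "m0 \<le> m" "m \<le> m'"
  shows "v (eps m) x \<le> v (eps m') x"
proof (rule v_antimono)
  show "eps m' \<le> eps m" using assms(4) by (simp add: field_simps)
  have "eps m \<le> eps m0" using assms(3) by (simp add: field_simps)
  then show "cball x (eps m) \<subseteq> \<Omega>" using assms(1,2) by (meson order_trans subset_cball)
qed simp

lemma v_eps_le_rep:
  assumes "x \<in> \<Omega>" "cball x \<delta> \<subseteq> \<Omega>" "eps m0 \<le> \<delta>" "m0 \<le> m"
  shows "ereal (v (eps m) x) \<le> rep x"
  using rep_tendsto[OF assms(1)]
proof (rule tendsto_lowerbound)
  show "eventually (\<lambda>m'. ereal (v (eps m) x) \<le> ereal (v (eps m') x)) sequentially"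
    using eventually_ge_at_top[of m] by eventually_elim (simp add: v_eps_mono[OF assms(2-4)] del: of_nat_Suc)
qed simp

text \<open>Differences of two scalings of \<open>\<Gamma>\<close> are smooth, nonnegative and
  supported in a ball; they are positive at the centre because \<open>2 * s < DIM('a)\<close> makes
  the scaling factor strictly decreasing. By compactness finitely many of them cover
  \<open>A\<close>.\<close>

lemma ex_bump:
  assumes A: "compact A" "A \<subseteq> \<Omega>"
  obtains \<theta> where "\<theta> \<in> test_functions \<Omega>" "\<forall>x. 0 \<le> \<theta> x" "\<forall>x\<in>A. 0 < \<theta> x"
proof -
  obtain \<delta> where \<delta>: "0 < \<delta>" "\<forall>x\<in>A. cball x \<delta> \<subseteq> \<Omega>"
    by (rule compact_subset_open_cball[OF A(1) open_Omega A(2)])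
  define \<rho> where "\<rho> a y = Gamma_scaled s \<Gamma> (\<delta> / 2) (y - a) - Gamma_scaled s \<Gamma> \<delta> (y - a)" for a y
  have \<rho>_smooth: "smooth (\<rho> a)" for a
    unfolding \<rho>_def[abs_def]
    using smooth_lincomb[OF smooth_Gamma_scaled smooth_Gamma_scaled, of 1 "\<delta> / 2" a "-1" \<delta> a] by simp
  have \<rho>_nonneg: "0 \<le> \<rho> a y" for a y
    unfolding \<rho>_def using Gamma_scaled_antimono[of "\<delta> / 2" \<delta>] \<delta>(1) by simp
  have \<rho>_zero: "\<rho> a y = 0" if "\<delta> < norm (y - a)" for a y
    unfolding \<rho>_def using that \<delta>(1) by (simp add: Gamma_scaled_outside)
  have \<rho>_pos: "0 < \<rho> a a" for a
  proof -
    have "\<delta> powr - (real DIM('a) - 2 * s) < (\<delta> / 2) powr - (real DIM('a) - 2 * s)"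
      using \<delta>(1) s_less by (intro powr_less_mono2_neg) auto
    then show ?thesis using Gamma_pos[of 0] by (simp add: \<rho>_def Gamma_scaled_def)
  qed
  have op: "open {y. 0 < \<rho> a y}" for a
    by (intro open_Collect_less continuous_on_const smooth_continuous_on \<rho>_smooth)
  obtain X where X: "X \<subseteq> A" "finite X" "A \<subseteq> (\<Union>a\<in>X. {y. 0 < \<rho> a y})"
  proof (rule compactE_image[OF A(1), of A "\<lambda>a. {y. 0 < \<rho> a y}"])
    show "A \<subseteq> (\<Union>a\<in>A. {y. 0 < \<rho> a y})" using \<rho>_pos by blast
    fix X assume X: "X \<subseteq> A" "finite X" "A \<subseteq> (\<Union>a\<in>X. {y. 0 < \<rho> a y})"
    show thesis by (rule that[OF X])
  qed (rule op)
  let ?\<theta> = "\<lambda>y. \<Sum>a\<in>X. 1 * \<rho> a y"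
  have "\<rho> a \<in> Ss s" for a
  proof (rule compact_support_Ss[OF \<rho>_smooth])
    show "\<rho> a x = 0" if "\<delta> + norm a < norm x" for x
      using that norm_triangle_sub[of x a] by (intro \<rho>_zero) simp
  qed (use s_pos in simp)
  then have sm: "smooth ?\<theta>" using X(2) s_pos by (intro Ss_smooth[OF Ss_sum]) auto
  have cp: "compact (\<Union>a\<in>X. cball a \<delta>)" using X(2) by (intro compact_UN) auto
  have "{y. ?\<theta> y \<noteq> 0} \<subseteq> (\<Union>a\<in>X. cball a \<delta>)"
  proof (rule subsetI, rule ccontr)
    fix y assume y: "y \<in> {y. ?\<theta> y \<noteq> 0}" "y \<notin> (\<Union>a\<in>X. cball a \<delta>)"
    then have "\<rho> a y = 0" if "a \<in> X" for a
      using that by (intro \<rho>_zero) (auto simp: dist_norm norm_minus_commute)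
    with y(1) show False by simp
  qed
  then have cl: "closure {y. ?\<theta> y \<noteq> 0} \<subseteq> (\<Union>a\<in>X. cball a \<delta>)"
    by (intro closure_minimal compact_imp_closed[OF cp])
  moreover have "compact (closure {y. ?\<theta> y \<noteq> 0})"
    using compact_Int_closed[OF cp closed_closure, of "{y. ?\<theta> y \<noteq> 0}"] cl by (simp add: Int_absorb1)
  moreover have "(\<Union>a\<in>X. cball a \<delta>) \<subseteq> \<Omega>" using X(1) \<delta>(2) by blast
  ultimately have "?\<theta> \<in> test_functions \<Omega>" using sm by (auto simp: test_functions_def)
  moreover have "\<forall>x. 0 \<le> ?\<theta> x" using \<rho>_nonneg by (auto intro: sum_nonneg)
  moreover have "\<forall>x\<in>A. 0 < ?\<theta> x"
  proof
    fix x assume "x \<in> A"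
    then obtain a where "a \<in> X" "0 < \<rho> a x" using X(3) by blast
    then show "0 < ?\<theta> x" using \<rho>_nonneg X(2) by (intro sum_pos2[of X a]) auto
  qed
  ultimately show ?thesis by (rule that)
qed

section \<open>Passage to the limit against test functions\<close>

lemma test_function_limit:
  assumes \<phi>: "\<phi> \<in> test_functions \<Omega>"
  shows "(\<lambda>m. LINT x|lborel. v (eps m) x * \<phi> x) \<longlonglongrightarrow> u \<phi>"
proof -
  let ?S = "closure {x. \<phi> x \<noteq> 0}"
  have S: "smooth \<phi>" "compact ?S" using \<phi> by (auto simp: test_functions_def)
  obtain R where R: "\<forall>x\<in>?S. norm x \<le> R"
    using compact_imp_bounded[OF S(2)] unfolding bounded_iff by blast
  show ?thesis unfolding v_def
  proof (rule mollify_dual[OF u S(1)])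
    fix x :: 'a assume "R < norm x"
    then have "x \<notin> ?S" using R by (meson not_less)
    then show "\<phi> x = 0" using closure_subset[of "{x. \<phi> x \<noteq> 0}"] by blast
  qed
qed

lemma integrable_continuous_mult_test:
  assumes "continuous_on UNIV g" "\<phi> \<in> test_functions \<Omega>"
  shows "integrable lborel (\<lambda>x. g x * \<phi> x)"
proof -
  let ?S = "closure {x. \<phi> x \<noteq> 0}"
  have S: "smooth \<phi>" "compact ?S" using assms(2) by (auto simp: test_functions_def)
  have "continuous_on ?S (\<lambda>x. g x * \<phi> x)"
    using assms(1) by (intro continuous_intros smooth_continuous_on[OF S(1)]) (auto intro: continuous_on_subset)
  then have "set_integrable lborel ?S (\<lambda>x. g x * \<phi> x)" by (rule borel_integrable_compact[OF S(2), folded set_integrable_def])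
  moreover have "indicator ?S x *\<^sub>R (g x * \<phi> x) = g x * \<phi> x" for x
    using closure_subset[of "{x. \<phi> x \<noteq> 0}"] by (auto simp: indicator_def)
  ultimately show ?thesis unfolding set_integrable_def by (simp only:)
qed

text \<open>Measurability is read off the sequence \<open>eps m\<close>, since the supremum is over
  uncountably many radii. The sequential limit is known to equal \<open>rep\<close> only on
  \<open>\<Omega>\<close>, hence the indicator.\<close>

lemma rep_measurable_on:
  assumes "A \<in> sets borel" "A \<subseteq> \<Omega>"
  shows "(\<lambda>x. indicator A x * real_of_ereal (rep x)) \<in> borel_measurable borel"
proof -
  have "(\<lambda>x. indicator A x * real_of_ereal (liminf (\<lambda>m. ereal (v (eps m) x)))) \<in> borel_measurable borel"
    using assms(1) by (intro borel_measurable_times borel_measurable_indicator borel_measurable_real_of_ereal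
      borel_measurable_liminf borel_measurable_ereal v_measurable) auto
  moreover have "indicator A x * real_of_ereal (liminf (\<lambda>m. ereal (v (eps m) x))) = indicator A x * real_of_ereal (rep x)" for x
    using lim_imp_Liminf[OF _ rep_tendsto[of x]] assms(2) by (auto simp: indicator_def)
  ultimately show ?thesis by (simp only:)
qed

text \<open>Tested with a nonnegative bump \<open>\<theta>\<close>, the increasing functions
  \<open>v (eps m)\<close> have convergent, hence bounded, integrals. Monotone convergence makes
  their limit, minus a continuous term, integrable against \<open>\<theta>\<close>, and
  \<open>\<theta>\<close> is bounded below on \<open>A\<close>.\<close>

lemma rep_locally_integrable:
  assumes A: "compact A" "A \<subseteq> \<Omega>"
  shows "(AE x in lborel. x \<in> A \<longrightarrow> \<bar>rep x\<bar> \<noteq> \<infinity>) \<and> set_integrable lborel A (\<lambda>x. real_of_ereal (rep x))"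
proof -
  obtain \<theta> where \<theta>: "\<theta> \<in> test_functions \<Omega>" "\<forall>x. 0 \<le> \<theta> x" "\<forall>x\<in>A. 0 < \<theta> x"
    by (rule ex_bump[OF A])
  let ?S = "closure {x. \<theta> x \<noteq> 0}"
  have S: "smooth \<theta>" "compact ?S" "?S \<subseteq> \<Omega>" using \<theta>(1) by (auto simp: test_functions_def)
  note [measurable] = smooth_borel[OF S(1)]
  have "A \<subseteq> {x. \<theta> x \<noteq> 0}" using \<theta>(3) by auto
  then have AS: "A \<subseteq> ?S" using closure_subset by (rule subset_trans)
  obtain \<delta> where \<delta>: "0 < \<delta>" "\<forall>x\<in>?S. cball x \<delta> \<subseteq> \<Omega>"
    by (rule compact_subset_open_cball[OF S(2) open_Omega S(3)])
  \<comment> \<open>From index \<open>m0\<close> on, the balls of radius \<open>eps m\<close> about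
    points of the support stay in \<open>\<Omega>\<close>, so monotonicity holds on the whole
    support at once.\<close>
  obtain m0 where m0: "eps m0 \<le> \<delta>" using reals_Archimedean[OF \<delta>(1)] less_imp_le by blast
  define h where "h m x = (v (eps (m + m0)) x - v (eps m0) x) * \<theta> x" for m x
  have h_int: "integrable lborel (h m)" for m
    unfolding h_def
    by (intro integrable_continuous_mult_test \<theta>(1) continuous_on_diff v_continuous) auto
  have h0: "h m x = 0" if "x \<notin> ?S" for m x
    using that closure_subset[of "{x. \<theta> x \<noteq> 0}"] by (auto simp: h_def)
  have h_nonneg: "0 \<le> h m x" for m x
  proof (cases "x \<in> ?S")
    case True
    have "v (eps m0) x \<le> v (eps (m + m0)) x"
      by (rule v_eps_mono[OF _ m0]) (use True \<delta> in auto)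
    then show ?thesis using \<theta>(2) by (simp add: h_def)
  qed (simp add: h0)
  have h_mono: "h m x \<le> h (Suc m) x" for m x
  proof (cases "x \<in> ?S")
    case True
    have "v (eps (m + m0)) x \<le> v (eps (Suc m + m0)) x"
      by (rule v_eps_mono[OF _ m0]) (use True \<delta> in auto)
    then show ?thesis using \<theta>(2) unfolding h_def by (intro mult_right_mono) auto
  qed (simp add: h0)
  have "(\<lambda>m. integral\<^sup>L lborel (h m)) \<longlonglongrightarrow> u \<theta> - (LINT x|lborel. v (eps m0) x * \<theta> x)"
  proof -
    have "integral\<^sup>L lborel (h m) = (LINT x|lborel. v (eps (m + m0)) x * \<theta> x) - (LINT x|lborel. v (eps m0) x * \<theta> x)" for m
      unfolding h_def left_diff_distrib
      by (intro Bochner_Integration.integral_diff integrable_continuous_mult_test \<theta>(1) v_continuous) auto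
    moreover have "(\<lambda>m. LINT x|lborel. v (eps (m + m0)) x * \<theta> x) \<longlonglongrightarrow> u \<theta>"
      using LIMSEQ_ignore_initial_segment[OF test_function_limit[OF \<theta>(1)], of m0] .
    ultimately show ?thesis by (simp only:) (intro tendsto_diff tendsto_const)
  qed
  then have "Bseq (\<lambda>m. integral\<^sup>L lborel (h m))" by (intro convergent_imp_Bseq convergentI)
  then obtain c where c': "\<forall>m. norm (integral\<^sup>L lborel (h m)) \<le> c" by (rule BseqE)
  have c: "integral\<^sup>L lborel (h m) \<le> c" for m
    using c'[rule_format, of m] by simp
  \<comment> \<open>Taken in \<open>ennreal\<close> because at this stage the limit may still be
    infinite.\<close>
  define G where "G x = (SUP m. ennreal (h m x))" for x
  have G_int: "(\<integral>\<^sup>+x. G x \<partial>lborel) \<le> ennreal c"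
  proof -
    have "(\<integral>\<^sup>+x. G x \<partial>lborel) = (SUP m. \<integral>\<^sup>+x. ennreal (h m x) \<partial>lborel)"
      unfolding G_def
    proof (rule nn_integral_monotone_convergence_SUP)
      show "incseq (\<lambda>m x. ennreal (h m x))"
        by (intro incseq_SucI le_funI ennreal_leI h_mono)
    qed (use h_int in auto)
    also have "\<dots> \<le> ennreal c"
      using h_int h_nonneg c by (intro SUP_least) (auto simp: nn_integral_eq_integral intro: ennreal_leI)
    finally show ?thesis .
  qed
  have G_meas: "G \<in> borel_measurable lborel"
    unfolding G_def[abs_def] using h_int by (intro borel_measurable_SUP) auto
  have "AE x in lborel. G x \<noteq> \<infinity>"
    using G_int by (intro nn_integral_noteq_infinite[OF G_meas]) (auto simp: top_unique)
  then have fin: "AE x in lborel. x \<in> A \<longrightarrow> \<bar>rep x\<bar> \<noteq> \<infinity> \<and>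
      ennreal (\<theta> x * (real_of_ereal (rep x) - v (eps m0) x)) \<le> G x"
  proof eventually_elim
    case (elim x)
    show ?case
    proof
      assume x: "x \<in> A"
      then have x': "x \<in> ?S" "x \<in> \<Omega>" "0 < \<theta> x" using AS A(2) \<theta>(3) by auto
      have "0 \<le> G x" by simp
      obtain g where g: "G x = ennreal g" "0 \<le> g" using elim by (cases "G x") auto
      have hg: "h m x \<le> g" for m
      proof -
        have "ennreal (h m x) \<le> ennreal g" unfolding g(1)[symmetric] G_def by (rule SUP_upper) simp
        then show ?thesis using g(2) h_nonneg[of m x] by simp
      qed
      have "v (eps (m + m0)) x \<le> v (eps m0) x + g / \<theta> x" for m
        using hg[of m] x'(3) by (simp add: h_def field_simps)
      then have "\<forall>m\<ge>0. ereal (v (eps (m + m0)) x) \<le> ereal (v (eps m0) x + g / \<theta> x)" by simp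
      with LIMSEQ_ignore_initial_segment[OF rep_tendsto[OF x'(2)], of m0]
      have up: "rep x \<le> ereal (v (eps m0) x + g / \<theta> x)" by (intro LIMSEQ_le_const2) auto
      moreover have "ereal (v (eps m0) x) \<le> rep x"
        using x' \<delta> by (intro v_eps_le_rep[OF _ _ m0]) auto
      ultimately have fin: "\<bar>rep x\<bar> \<noteq> \<infinity>" by (cases "rep x") auto
      then obtain r where r: "rep x = ereal r" by auto
      from up have "\<theta> x * (r - v (eps m0) x) \<le> g" using x'(3) by (simp add: r field_simps)
      with fin g(1) show "\<bar>rep x\<bar> \<noteq> \<infinity> \<and> ennreal (\<theta> x * (real_of_ereal (rep x) - v (eps m0) x)) \<le> G x"
        by (auto simp: r intro: ennreal_leI)
    qed
  qed
  have Ab: "A \<in> sets borel" using A(1) by (simp add: borel_compact)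
  note repm = rep_measurable_on[OF Ab A(2)]
  \<comment> \<open>Its sign is known only where \<open>rep x\<close> is finite, since
    \<open>real_of_ereal\<close> sends infinity to \<open>0\<close>; the comparison with
    \<open>G\<close> therefore holds almost everywhere.\<close>
  let ?d = "\<lambda>x. indicator A x * real_of_ereal (rep x) - indicator A x * v (eps m0) x"
  have vint: "integrable lborel (\<lambda>x. indicator A x * v (eps m0) x)"
    using borel_integrable_compact[OF A(1) v_continuous[of "eps m0"]] by simp
  have dm: "?d \<in> borel_measurable borel"
    using repm vint by auto
  have d_nonneg: "0 \<le> ?d x" if "x \<in> A \<longrightarrow> \<bar>rep x\<bar> \<noteq> \<infinity>" for x
  proof (cases "x \<in> A")
    case True
    then have "ereal (v (eps m0) x) \<le> rep x"
      using AS A(2) \<delta> by (intro v_eps_le_rep[OF _ _ m0]) auto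
    with True that show ?thesis by (cases "rep x") auto
  qed simp
  have d_int: "integrable lborel (\<lambda>x. \<theta> x * ?d x)"
  proof (rule integrableI_bounded)
    have "(\<integral>\<^sup>+x. ennreal (norm (\<theta> x * ?d x)) \<partial>lborel) \<le> (\<integral>\<^sup>+x. G x \<partial>lborel)"
    proof (rule nn_integral_mono_AE)
      from fin show "AE x in lborel. ennreal (norm (\<theta> x * ?d x)) \<le> G x"
      proof eventually_elim
        case (elim x)
        then have "0 \<le> ?d x" by (intro d_nonneg) auto
        with \<theta>(2) have "norm (\<theta> x * ?d x) = \<theta> x * ?d x" by simp
        with elim show ?case by (cases "x \<in> A") auto
      qed
    qed
    also have "\<dots> < \<infinity>" using G_int by (simp add: order_le_less_trans)
    finally show "(\<integral>\<^sup>+x. ennreal (norm (\<theta> x * ?d x)) \<partial>lborel) < \<infinity>" .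
  qed (use dm in measurable)
  \<comment> \<open>The reciprocal of this constant removes the weight \<open>\<theta>\<close> on
    \<open>A\<close>. An empty \<open>A\<close> is treated apart, as no minimum is attained
    there.\<close>
  have "\<exists>c>0. \<forall>x\<in>A. c \<le> \<theta> x"
  proof (cases "A = {}")
    case False
    obtain x where x: "x \<in> A" "\<And>y. y \<in> A \<Longrightarrow> \<theta> x \<le> \<theta> y"
      using continuous_attains_inf[OF A(1) False smooth_continuous_on[OF S(1)]] by blast
    with \<theta>(3) show ?thesis by blast
  qed (auto intro: exI[of _ 1])
  then obtain c where c: "0 < c" "\<And>x. x \<in> A \<Longrightarrow> c \<le> \<theta> x" by blast
  have "integrable lborel ?d"
  proof (rule Bochner_Integration.integrable_bound)
    show "integrable lborel (\<lambda>x. (1 / c) * (\<theta> x * ?d x))" using d_int by (intro integrable_mult_right)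
    show "?d \<in> borel_measurable lborel" using dm by simp
    have "\<bar>?d x\<bar> \<le> \<bar>(1 / c) * (\<theta> x * ?d x)\<bar>" for x
    proof (cases "x \<in> A")
      case True
      then have "1 \<le> \<theta> x / c" using c by simp
      then have "1 * \<bar>?d x\<bar> \<le> (\<theta> x / c) * \<bar>?d x\<bar>" by (intro mult_right_mono) auto
      also have "\<dots> = \<bar>(1 / c) * (\<theta> x * ?d x)\<bar>" using c(1) \<theta>(2) by (simp add: abs_mult)
      finally show ?thesis by simp
    qed simp
    then show "AE x in lborel. norm (?d x) \<le> norm ((1 / c) * (\<theta> x * ?d x))" by (intro AE_I2) simp
  qed
  from Bochner_Integration.integrable_add[OF this vint]
  have "set_integrable lborel A (\<lambda>x. real_of_ereal (rep x))"
    by (simp add: set_integrable_def)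
  moreover have "AE x in lborel. x \<in> A \<longrightarrow> \<bar>rep x\<bar> \<noteq> \<infinity>" using fin by eventually_elim auto
  ultimately show ?thesis by blast
qed

lemma rep_finite_AE: "AE x in lborel. x \<in> \<Omega> \<longrightarrow> \<bar>rep x\<bar> \<noteq> \<infinity>"
proof -
  obtain D where D: "\<And>n::nat. compact (D n)" "\<And>n. D n \<subseteq> \<Omega>" "\<Union>(range D) = \<Omega>"
  proof (rule open_Union_compact_subsets[OF open_Omega])
    fix D :: "nat \<Rightarrow> 'a set"
    assume "\<And>n. compact (D n)" "\<And>n. D n \<subseteq> \<Omega>" "\<Union>(range D) = \<Omega>"
    then show thesis by (rule that)
  qed
  have "AE x in lborel. \<forall>n. x \<in> D n \<longrightarrow> \<bar>rep x\<bar> \<noteq> \<infinity>"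
    unfolding AE_all_countable by (intro allI rep_locally_integrable[THEN conjunct1] D)
  then show ?thesis
  proof eventually_elim
    case (elim x)
    show ?case
    proof
      assume "x \<in> \<Omega>"
      then have "x \<in> \<Union>(range D)" by (simp only: D(3))
      then obtain n where "x \<in> D n" by (elim UN_E)
      with elim show "\<bar>rep x\<bar> \<noteq> \<infinity>" by (elim allE[of _ n]) (rule mp)
    qed
  qed
qed

text \<open>A test function may change sign, so dominated convergence takes the place of monotone
  convergence: on the support \<open>v (eps m)\<close> lies between \<open>v (eps m0)\<close> and
  \<open>rep\<close>, both integrable there.\<close>

lemma rep_coincides: "coincides_on \<Omega> u rep"
  unfolding coincides_on_def
proof (intro conjI allI impI ballI)
  show "AE x in lborel. x \<in> \<Omega> \<longrightarrow> \<bar>rep x\<bar> \<noteq> \<infinity>" by (rule rep_finite_AE)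
  show "set_integrable lborel A (\<lambda>x. real_of_ereal (rep x))" if "compact A \<and> A \<subseteq> \<Omega>" for A
    using that rep_locally_integrable by blast
  fix \<phi> assume \<phi>: "\<phi> \<in> test_functions \<Omega>"
  let ?S = "closure {x. \<phi> x \<noteq> 0}"
  have S: "smooth \<phi>" "compact ?S" "?S \<subseteq> \<Omega>" using \<phi> by (auto simp: test_functions_def)
  note [measurable] = smooth_borel[OF S(1)]
  have \<phi>0: "\<phi> x = 0" if "x \<notin> ?S" for x
    using that closure_subset[of "{x. \<phi> x \<noteq> 0}"] by auto
  obtain B0 where B0: "B0 > 0" "\<And>x. x \<in> ?S \<Longrightarrow> \<bar>\<phi> x\<bar> \<le> B0"
  proof (rule smooth_bounded_on_compact[OF S(1,2)])
    fix B0 assume "B0 > 0" "\<And>x. x \<in> ?S \<Longrightarrow> \<bar>\<phi> x\<bar> \<le> B0"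
    then show thesis by (rule that)
  qed
  have B: "\<bar>\<phi> x\<bar> \<le> B0" for x
    using B0(1) B0(2)[of x] \<phi>0[of x] by (cases "x \<in> ?S") simp_all
  obtain \<delta> where \<delta>: "0 < \<delta>" "\<forall>x\<in>?S. cball x \<delta> \<subseteq> \<Omega>"
    by (rule compact_subset_open_cball[OF S(2) open_Omega S(3)])
  obtain m0 where m0: "eps m0 \<le> \<delta>" using reals_Archimedean[OF \<delta>(1)] less_imp_le by blast
  let ?r = "\<lambda>x. indicator ?S x * real_of_ereal (rep x)"
  let ?w = "\<lambda>x. indicator ?S x * v (eps m0) x"
  have r_int: "integrable lborel ?r"
    using rep_locally_integrable[OF S(2,3)] by (simp add: set_integrable_def)
  have w_int: "integrable lborel ?w"
    using borel_integrable_compact[OF S(2) v_continuous[of "eps m0"]] by simp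
  have "(\<lambda>m. LINT x|lborel. v (eps (m + m0)) x * \<phi> x) \<longlonglongrightarrow> (LINT x|lborel. ?r x * \<phi> x)"
  proof (rule integral_dominated_convergence[where w = "\<lambda>x. B0 * (\<bar>?r x\<bar> + \<bar>?w x\<bar>)"])
    show "integrable lborel (\<lambda>x. B0 * (\<bar>?r x\<bar> + \<bar>?w x\<bar>))"
      using r_int w_int by auto
    show "(\<lambda>x. ?r x * \<phi> x) \<in> borel_measurable lborel" using r_int by auto
    show "(\<lambda>x. v (eps (m + m0)) x * \<phi> x) \<in> borel_measurable lborel" for m
      using v_measurable[of "eps (m + m0)"] by auto
    show "AE x in lborel. (\<lambda>m. v (eps (m + m0)) x * \<phi> x) \<longlonglongrightarrow> ?r x * \<phi> x"
      using rep_finite_AE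
    proof eventually_elim
      case (elim x)
      show ?case
      proof (cases "x \<in> ?S")
        case True
        then have "x \<in> \<Omega>" using S(3) by blast
        from mp[OF elim this] obtain r where r: "rep x = ereal r" by (cases "rep x") auto
        have "(\<lambda>m. v (eps (m + m0)) x) \<longlonglongrightarrow> r"
          using LIMSEQ_ignore_initial_segment[OF rep_tendsto[OF \<open>x \<in> \<Omega>\<close>], of m0]
          unfolding r lim_ereal .
        from tendsto_mult[OF this tendsto_const] show ?thesis using True by (simp add: r)
      next
        case False
        from \<phi>0[OF this] B0(1) False show ?thesis by simp
      qed
    qed
    show "AE x in lborel. norm (v (eps (m + m0)) x * \<phi> x) \<le> B0 * (\<bar>?r x\<bar> + \<bar>?w x\<bar>)" for m
      using rep_finite_AE
    proof eventually_elim
      case (elim x)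
      show ?case
      proof (cases "x \<in> ?S")
        case True
        then have x: "x \<in> \<Omega>" "cball x \<delta> \<subseteq> \<Omega>" using S(3) \<delta>(2) by blast+
        from mp[OF elim x(1)] obtain r where r: "rep x = ereal r" by (cases "rep x") auto
        have "v (eps m0) x \<le> v (eps (m + m0)) x" by (rule v_eps_mono[OF x(2) m0]) auto
        moreover have "v (eps (m + m0)) x \<le> r"
          using v_eps_le_rep[OF x m0, of "m + m0"] by (simp add: r)
        ultimately have "\<bar>v (eps (m + m0)) x\<bar> \<le> \<bar>?r x\<bar> + \<bar>?w x\<bar>" using True by (simp add: r)
        then have "\<bar>v (eps (m + m0)) x\<bar> * \<bar>\<phi> x\<bar> \<le> (\<bar>?r x\<bar> + \<bar>?w x\<bar>) * B0"
          using B[of x] by (intro mult_mono) auto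
        then show ?thesis by (simp add: abs_mult mult.commute)
      next
        case False
        from \<phi>0[OF this] B0(1) False show ?thesis by simp
      qed
    qed
  qed
  moreover have "(\<lambda>m. LINT x|lborel. v (eps (m + m0)) x * \<phi> x) \<longlonglongrightarrow> u \<phi>"
    using LIMSEQ_ignore_initial_segment[OF test_function_limit[OF \<phi>], of m0] .
  ultimately have "u \<phi> = (LINT x|lborel. ?r x * \<phi> x)" by (rule LIMSEQ_unique[rotated])
  also have "\<dots> = (LINT x : \<Omega> | lborel. real_of_ereal (rep x) * \<phi> x)"
    unfolding set_lebesgue_integral_def
  proof (intro Bochner_Integration.integral_cong refl)
    show "?r x * \<phi> x = indicator \<Omega> x *\<^sub>R (real_of_ereal (rep x) * \<phi> x)" for x
      using S(3) \<phi>0[of x] by (cases "x \<in> ?S") auto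
  qed
  finally show "u \<phi> = (LINT x : \<Omega> | lborel. real_of_ereal (rep x) * \<phi> x)" .
qed

lemma rep_ge:
  assumes "0 < l" "ereal l < edist_to x (frontier \<Omega>)"
  shows "ereal (u (\<lambda>y. gam l (x - y))) \<le> rep x"
proof -
  have "(\<lambda>y. gam l (x - y)) = (\<lambda>y. gam l (y - x))"
    using gam_even[of l "_ - x"] by simp
  with v_le_rep[OF assms] show ?thesis by (simp add: v_def)
qed

end

theorem proposition4p7:
  fixes s C K :: real
    and \<Gamma> :: "'a::euclidean_space \<Rightarrow> real"
    and u :: "('a \<Rightarrow> real) \<Rightarrow> real"
    and \<Omega> :: "'a set"
  assumes "0 < s" and "s < min 1 (real DIM('a) / 2)"
    and "is_frac_lap_constant TYPE('a) s C"
    and "is_Phi_constant TYPE('a) s C K"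
    and "regularised_Phi C K s \<Gamma>"
    and "open \<Omega>"
    and "u \<in> Ss_dual s"
    and "distr_nonneg_on \<Omega> (frac_lap_distr C s u)"
  shows "\<exists>f :: 'a \<Rightarrow> ereal.
           lower_semicontinuous_on \<Omega> f \<and> coincides_on \<Omega> u f \<and>
           (\<forall>x0\<in>\<Omega>. \<forall>l>0. ereal l < edist_to x0 (frontier \<Omega>) \<longrightarrow>
              f x0 \<ge> ereal (u (\<lambda>y. gamma_scaled C s \<Gamma> l (x0 - y))))"
proof -
  interpret superharmonic s C K \<Gamma> \<Omega> u
    using assms by unfold_locales (auto simp: is_frac_lap_constant_def is_Phi_constant_def)
  show ?thesis
    using rep_lower_semicontinuous rep_coincides rep_ge by blast
qed

end
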